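(* Assume GRH. For any pair $a,b$ of distinct reduced residues modulo $q$, \[ V(q;a,b) = 2\phi(q) \big( \mathcal{L}(q) + K_q(a-b) + \iota_q(-ab^{-1})\log2 \big) + 2M^*(q;a,b). \]
   Context: GRH: every nontrivial zero of every Dirichlet $L$-function has real part $\frac12$. For a Dirichlet character $\chi$, $b(\chi)=\sum_{\gamma\in\mathbb R,\ L(1/2+i\gamma,\chi)=0}\frac1{1/4+\gamma^2}$ (zeros with multiplicity), and $V(q;a,b)=\sum_{\chi\bmod q}|\chi(b)-\chi(a)|^2b(\chi)$. $\Lambda$ is the von Mangoldt function, $\gamma_0$ Euler's constant. Define $\mathcal{L}(q)=\log q-\sum_{p\mid q}\frac{\log p}{p-1}+\frac{\Lambda(q)}{\phi(q)}-(\gamma_0+\log 2\pi)$; $\iota_q(n)=1$ if $n\equiv1\pmod q$ and $0$ otherwise; $K_q(n)=\frac{\Lambda(q/(q,n))}{\phi(q/(q,n))}-\frac{\Lambda(q)}{\phi(q)}$. Arguments such as $ab^{-1}$ denote integers representing the residue class $ab^{-1}\bmod q$. For a character $\chi\bmod q$, $\chi^*$ is the primitive character inducing $\chi$. Define $M^*(q;a,b)=\sum_{\chi\bmod q,\ \chi\ne\chi_0}|\chi(a)-\chi(b)|^2\frac{L'(1,\chi^* )}{L(1,\chi^* )}$, where $\chi_0$ is the principal character. *)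

theory Defs
  imports
    "HOL-Complex_Analysis.Complex_Analysis"
    "HOL-Number_Theory.Number_Theory"
begin

text \<open>
  A character modulo \<open>q\<close> is regarded as a \<open>q\<close>-periodic function on all integers that vanishes
  exactly off the integers coprime to \<open>q\<close>.  There are finitely many for each \<open>q\<close>.
\<close>

definition dirichlet_character :: "nat \<Rightarrow> (int \<Rightarrow> complex) \<Rightarrow> bool" where
  "dirichlet_character q chi \<longleftrightarrow>
     q > 0 \<and>
     (\<forall>m n. chi (m * n) = chi m * chi n) \<and>
     (\<forall>n. chi (n + int q) = chi n) \<and>
     (\<forall>n. chi n \<noteq> 0 \<longleftrightarrow> coprime n (int q))"

definition dirichlet_characters :: "nat \<Rightarrow> (int \<Rightarrow> complex) set" where
  "dirichlet_characters q = {chi. dirichlet_character q chi}"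

definition principal_character :: "nat \<Rightarrow> int \<Rightarrow> complex" where
  "principal_character q n = (if coprime n (int q) then 1 else 0)"

definition induces :: "nat \<Rightarrow> (int \<Rightarrow> complex) \<Rightarrow> nat \<Rightarrow> (int \<Rightarrow> complex) \<Rightarrow> bool" where
  "induces d \<psi> q chi \<longleftrightarrow>
     dirichlet_character d \<psi> \<and> dirichlet_character q chi \<and> d dvd q \<and>
     (\<forall>n. coprime n (int q) \<longrightarrow> chi n = \<psi> n)"

definition primitive_character :: "nat \<Rightarrow> (int \<Rightarrow> complex) \<Rightarrow> bool" where
  "primitive_character d \<psi> \<longleftrightarrow>
     dirichlet_character d \<psi> \<and> (\<forall>e \<xi>. induces e \<xi> d \<psi> \<longrightarrow> e = d)"

definition primitive_inducing :: "nat \<Rightarrow> (int \<Rightarrow> complex) \<Rightarrow> int \<Rightarrow> complex" where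
  "primitive_inducing q chi = (THE \<psi>. \<exists>d. primitive_character d \<psi> \<and> induces d \<psi> q chi)"

text \<open>
  The meromorphic continuation of \<open>\<Sum>\<^sub>n chi(n) n\<^sup>-\<^sup>s\<close> (\<open>Re s > 1\<close>) to the whole plane.
  Nice meromorphy makes it unique as a function: removable singularities are filled in, and the
  value at a pole, which for these functions can only be the point \<open>1\<close> for principal \<open>chi\<close>, is set
  to \<open>0\<close>.  The series index is shifted, so that it starts at \<open>1\<close>.
\<close>

definition dirichlet_L :: "(int \<Rightarrow> complex) \<Rightarrow> complex \<Rightarrow> complex" where
  "dirichlet_L chi =
     (THE f. f nicely_meromorphic_on UNIV \<and>
        (\<forall>s. Re s > 1 \<longrightarrow> (\<lambda>n. chi (int (Suc n)) / of_nat (Suc n) powr s) sums f s))"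

text \<open>
  The nontrivial zeros are those with real part strictly between \<open>0\<close> and \<open>1\<close>; in particular the
  zeros on the imaginary axis that imprimitive characters acquire from Euler factors are excluded.
\<close>

definition GRH :: bool where
  "GRH \<longleftrightarrow>
     (\<forall>q chi s. dirichlet_character q chi \<and> 0 < Re s \<and> Re s < 1 \<and> dirichlet_L chi s = 0
        \<longrightarrow> Re s = 1 / 2)"

text \<open>\<open>zorder\<close> at a zero is its multiplicity.\<close>

definition b_chi :: "(int \<Rightarrow> complex) \<Rightarrow> real" where
  "b_chi chi =
     (\<Sum>\<^sub>\<infinity>\<gamma>\<in>{\<gamma>::real. dirichlet_L chi (Complex (1 / 2) \<gamma>) = 0}.
        of_int (zorder (dirichlet_L chi) (Complex (1 / 2) \<gamma>)) / (1 / 4 + \<gamma>\<^sup>2))"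

definition V_q :: "nat \<Rightarrow> int \<Rightarrow> int \<Rightarrow> real" where
  "V_q q a b = (\<Sum>chi\<in>dirichlet_characters q. (cmod (chi b - chi a))\<^sup>2 * b_chi chi)"

definition calL :: "nat \<Rightarrow> real" where
  "calL q =
     ln (real q) - (\<Sum>p\<in>prime_factors q. ln (real p) / (real p - 1))
       + mangoldt q / real (totient q) - (euler_mascheroni + ln (2 * pi))"

definition iota_q :: "nat \<Rightarrow> int \<Rightarrow> real" where
  "iota_q q n = (if [n = 1] (mod int q) then 1 else 0)"

definition K_q :: "nat \<Rightarrow> int \<Rightarrow> real" where
  "K_q q n =
     (let d = q div nat (gcd (int q) n)
      in mangoldt d / real (totient d) - mangoldt q / real (totient q))"

definition M_star :: "nat \<Rightarrow> int \<Rightarrow> int \<Rightarrow> complex" where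
  "M_star q a b =
     (\<Sum>chi\<in>dirichlet_characters q - {principal_character q}.
        of_real ((cmod (chi a - chi b))\<^sup>2) *
        (deriv (dirichlet_L (primitive_inducing q chi)) 1 / dirichlet_L (primitive_inducing q chi) 1))"

end

theory Submission
  imports Defs "HOL-Probability.Characteristic_Functions"
begin

text \<open>
  Let \<open>chi\<close> be nonprincipal, induced by the primitive character \<open>\<psi>\<close> of conductor \<open>d\<close>.  The Euler factors
  by which their L-functions differ have no zeros with \<open>Re s > 0\<close>, so \<open>b(chi) = b(\<psi>)\<close>.  The completed
  L-function \<open>\<xi>\<close> of \<open>\<psi>\<close> is entire, of order less than two, and its zeros are the nontrivial zeros of
  the L-function of \<open>\<psi>\<close>.  In place of the Hadamard product, dividing out the zeros in a disc of radius \<open>r\<close>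
  and a Borel-Caratheodory estimate show that \<open>\<xi>'/\<xi>(1) - \<xi>'/\<xi>(0)\<close> is the limit, as \<open>r\<close> grows, of
  the sum of \<open>1/(1 - \<rho>) + 1/\<rho>\<close> over the zeros \<open>\<rho>\<close> in the disc.  Under GRH these terms
  are \<open>1/(1/4 + \<gamma>\<^sup>2)\<close>, and the functional equation gives \<open>\<xi>'/\<xi>(0) = - cnj (\<xi>'/\<xi>(1))\<close>.  Hence
  \<open>b(chi) = 2 Re (\<xi>'/\<xi>(1)) = ln d - \<gamma>\<^sub>0 - ln \<pi> - (1 + chi(-1)) ln 2 + 2 Re (L'/L(1, \<psi>))\<close>.

  With \<open>c = a b\<^sup>-\<^sup>1\<close> one has \<open>|chi(a) - chi(b)|\<^sup>2 = 2 - 2 Re chi(c)\<close>, so that orthogonality evaluates the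
  average of everything but \<open>ln d\<close> and \<open>L'/L\<close>.  For \<open>ln d\<close> one writes \<open>ln\<close> as the divisor sum of the von
  Mangoldt function and counts the characters whose conductor divides a given divisor of \<open>q\<close>.  The
  terms \<open>L'/L\<close> add up to \<open>M\<^sup>*\<close>, which is real because \<open>chi\<close> and \<open>cnj chi\<close> contribute conjugate terms.
\<close>

text \<open>The weight \<open>(cmod (chi b - chi a))\<^sup>2\<close> vanishes for the principal
  character, so only entire L-functions enter the sum. Two facts about them need real work. The
  first is the continuation with its functional equation: Poisson summation for Gaussians gives it
  for theta functions, and an integral over the whole line in logarithmic scale then defines \<xi>
  for all \<open>s\<close> at once. The second is nonvanishing on \<open>Re s = 1\<close>: it gives
  the value of \<open>L'/L\<close> at 1 its meaning and, by reflection, locks the zeros of \<xi>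
  into the open strip of which GRH speaks. The difference of the values at 1 and 0 serves two ends:
  it cancels the linear exponent of a Hadamard product, and under GRH it makes every term positive,
  so that convergence along discs is convergence of the whole sum. The growth bound is exponential
  in a power 3/2 of \<open>|s|\<close>, a convenient exponent above the true order one. After
  division by the zeros in a disc of radius \<open>r\<close>, the logarithm has second derivative of
  order \<open>r powr (-1/2)\<close> on the unit disc, which is why any order below two
  suffices.\<close>

lemma coprime_add_self_int: "coprime (n + int q) (int q) \<longleftrightarrow> coprime n (int q)"
  by (simp only: coprime_iff_gcd_eq_1 gcd_add1)

lemma dirichlet_characterD:
  assumes "dirichlet_character q chi"
  shows "q > 0" "chi (m * n) = chi m * chi n" "chi (n + int q) = chi n"
    "chi n \<noteq> 0 \<longleftrightarrow> coprime n (int q)"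
  using assms unfolding dirichlet_character_def by auto

lemma periodic_add_mult:
  fixes f :: "int \<Rightarrow> 'a"
  assumes "\<And>n. f (n + int q) = f n"
  shows "f (n + k * int q) = f n"
proof (induction k rule: int_induct[where k = 0])
  case (step1 i)
  have "f (n + (i + 1) * int q) = f (n + i * int q + int q)" by (simp add: algebra_simps)
  then show ?case using assms step1 by simp
next
  case (step2 i)
  have "f (n + (i - 1) * int q) = f (n + (i - 1) * int q + int q)" using assms by simp
  also have "\<dots> = f (n + i * int q)" by (simp add: algebra_simps)
  finally show ?case using step2 by simp
qed simp

lemma periodic_cong:
  fixes f :: "int \<Rightarrow> 'a"
  assumes "\<And>n. f (n + int q) = f n" and "[m = n] (mod int q)"
  shows "f m = f n"
proof -
  obtain k where "m = n + k * int q"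
    using assms(2) by (metis cong_iff_lin cong_sym mult.commute)
  then show ?thesis using periodic_add_mult[of f q n k] assms(1) by simp
qed

lemma dirichlet_character_cong:
  assumes "dirichlet_character q chi" "[m = n] (mod int q)"
  shows "chi m = chi n"
  using periodic_cong[of chi q] assms dirichlet_characterD(3) by blast

lemma dirichlet_character_1 [simp]:
  assumes "dirichlet_character q chi"
  shows "chi 1 = 1"
  using dirichlet_characterD(2)[OF assms, of 1 1] dirichlet_characterD(4)[OF assms, of 1] by simp

lemma dirichlet_character_power:
  assumes "dirichlet_character q chi"
  shows "chi (n ^ k) = chi n ^ k"
  by (induction k) (use assms in \<open>auto simp: dirichlet_characterD(2)[OF assms]\<close>)

lemma euler_theorem_int:
  assumes "q > 0" "coprime x (int q)"
  shows "[x ^ totient q = 1] (mod int q)"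
proof -
  have "coprime (nat (x mod int q)) q"
    using assms by (metis coprime_int_iff coprime_mod_left_iff nat_0_le pos_mod_sign of_nat_0_less_iff less_irrefl)
  then have "[nat (x mod int q) ^ totient q = 1] (mod q)" by (rule euler_theorem)
  then have "[int (nat (x mod int q) ^ totient q) = int 1] (mod int q)"
    using cong_int_iff by blast
  then have "[(x mod int q) ^ totient q = 1] (mod int q)" using assms by simp
  then show ?thesis
    by (simp add: cong_def power_mod)
qed

lemma coprime_imp_inverse_int:
  assumes "q > 0" "coprime x (int q)"
  obtains y where "coprime y (int q)" "[x * y = 1] (mod int q)"
proof -
  obtain y where y: "[x * y = 1] (mod int q)"
    using assms cong_solve_coprime_int by blast
  then have "coprime y (int q)"
    by (metis cong_imp_coprime cong_sym coprime_1_left coprime_mult_left_iff)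
  with y show ?thesis using that by blast
qed

lemma norm_dirichlet_character:
  assumes "dirichlet_character q chi" "coprime n (int q)"
  shows "norm (chi n) = 1"
proof -
  have q: "q > 0" using assms dirichlet_characterD by blast
  have "chi n ^ totient q = chi (n ^ totient q)"
    by (simp add: dirichlet_character_power[OF assms(1)])
  also have "\<dots> = chi 1"
    using euler_theorem_int[OF q assms(2)] dirichlet_character_cong[OF assms(1)] by blast
  finally have "chi n ^ totient q = 1" using assms by simp
  then show ?thesis using q by (metis norm_power norm_one power_eq_imp_eq_base norm_ge_zero one_power2
        power_one totient_gt_0_iff zero_le_one)
qed

lemma norm_dirichlet_character_le:
  assumes "dirichlet_character q chi"
  shows "norm (chi n) \<le> 1"
  using norm_dirichlet_character[OF assms, of n] dirichlet_characterD(4)[OF assms, of n]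
  by (cases "coprime n (int q)") auto

lemma dirichlet_character_principal:
  "q > 0 \<Longrightarrow> dirichlet_character q (principal_character q)"
  unfolding dirichlet_character_def principal_character_def
  by (auto simp: coprime_add_self_int)

lemma dirichlet_character_cnj:
  assumes "dirichlet_character q chi"
  shows "dirichlet_character q (\<lambda>n. cnj (chi n))"
  using assms unfolding dirichlet_character_def by auto

lemma dirichlet_character_mult:
  assumes "dirichlet_character q chi" "dirichlet_character q psi"
  shows "dirichlet_character q (\<lambda>n. chi n * psi n)"
  using assms unfolding dirichlet_character_def by auto

lemma dirichlet_character_mult_cnj:
  assumes "dirichlet_character q chi" "coprime n (int q)"
  shows "chi n * cnj (chi n) = 1"
  using norm_dirichlet_character[OF assms] by (simp add: complex_norm_square[symmetric])

lemma dirichlet_character_minus_1: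
  assumes "dirichlet_character q chi"
  shows "chi (-1) = 1 \<or> chi (-1) = -1"
proof -
  have "chi (-1) ^ 2 = 1"
    using dirichlet_character_power[OF assms, of "-1" 2] assms by simp
  then show ?thesis by (simp add: power2_eq_1_iff)
qed

text \<open>A character is determined by its values on one period, and each value is 0 or a root of
  unity of order dividing \<open>totient q\<close>.\<close>

lemma finite_dirichlet_characters [simp]: "finite (dirichlet_characters q)"
proof (cases "q > 0")
  case True
  define A where "A = {0..<int q}"
  define B where "B = insert 0 {z::complex. z ^ totient q = 1}"
  have "finite B" using True unfolding B_def by (auto intro: finite_roots_unity)
  then have fin: "finite (A \<rightarrow>\<^sub>E B)" unfolding A_def by (auto intro: finite_PiE)
  have "(\<lambda>chi. restrict chi A) ` dirichlet_characters q \<subseteq> A \<rightarrow>\<^sub>E B"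
  proof -
    have "chi n \<in> B" if chi: "dirichlet_character q chi" for chi n
    proof (cases "coprime n (int q)")
      case c: True
      have "chi n ^ totient q = chi (n ^ totient q)"
        by (simp add: dirichlet_character_power[OF chi])
      also have "\<dots> = 1"
        using euler_theorem_int[OF True c] dirichlet_character_cong[OF chi] chi by force
      finally show ?thesis by (simp add: B_def)
    next
      case False
      then show ?thesis using dirichlet_characterD(4)[OF chi, of n] by (auto simp: B_def)
    qed
    then show ?thesis by (auto simp: dirichlet_characters_def)
  qed
  moreover have "inj_on (\<lambda>chi. restrict chi A) (dirichlet_characters q)"
  proof (rule inj_onI, rule ext)
    fix chi psi n assume *: "chi \<in> dirichlet_characters q" "psi \<in> dirichlet_characters q"
      "restrict chi A = restrict psi A"
    have "n mod int q \<in> A" using True by (auto simp: A_def)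
    then have "chi (n mod int q) = psi (n mod int q)" using *(3) by (metis restrict_apply')
    then show "chi n = psi n"
      using *(1,2) dirichlet_character_cong[of q chi n "n mod int q"]
        dirichlet_character_cong[of q psi n "n mod int q"] by (simp add: dirichlet_characters_def)
  qed
  ultimately show ?thesis using fin finite_imageD finite_subset by blast
qed (auto simp: dirichlet_characters_def dirichlet_character_def)

subsection \<open>Extending characters from subgroups\<close>

text \<open>A character of a subgroup of the units modulo \<open>q\<close>. In place of a quotient
  group, \<open>H\<close> is the union of its residue classes; inverses come from Euler's theorem,
  since \<open>m ^ (totient q - 1)\<close> inverts \<open>m\<close> modulo \<open>q\<close>.\<close>

definition partial_character :: "nat \<Rightarrow> int set \<Rightarrow> (int \<Rightarrow> complex) \<Rightarrow> bool" where
  "partial_character q H f \<longleftrightarrow>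
     H \<subseteq> {n. coprime n (int q)} \<and> 1 \<in> H \<and>
     (\<forall>m\<in>H. \<forall>n\<in>H. m * n \<in> H \<and> f (m * n) = f m * f n) \<and>
     (\<forall>m\<in>H. \<forall>n. [m = n] (mod int q) \<longrightarrow> n \<in> H \<and> f n = f m) \<and>
     (\<forall>m\<in>H. f m \<noteq> 0)"

lemma partial_characterD:
  assumes "partial_character q H f"
  shows "m \<in> H \<Longrightarrow> coprime m (int q)" "1 \<in> H"
    "m \<in> H \<Longrightarrow> n \<in> H \<Longrightarrow> m * n \<in> H" "m \<in> H \<Longrightarrow> n \<in> H \<Longrightarrow> f (m * n) = f m * f n"
    "m \<in> H \<Longrightarrow> [m = n] (mod int q) \<Longrightarrow> n \<in> H" "m \<in> H \<Longrightarrow> [m = n] (mod int q) \<Longrightarrow> f n = f m"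
    "m \<in> H \<Longrightarrow> f m \<noteq> 0"
  using assms unfolding partial_character_def by blast+

lemma partial_character_power:
  assumes "partial_character q H f" "m \<in> H"
  shows "m ^ k \<in> H" "f (m ^ k) = f m ^ k"
proof -
  have "f 1 = 1"
    using partial_characterD(4)[OF assms(1), of 1 1] partial_characterD(7)[OF assms(1), of 1]
      partial_characterD(2)[OF assms(1)] by simp
  then have "m ^ k \<in> H \<and> f (m ^ k) = f m ^ k"
  proof (induction k)
    case 0
    then show ?case using partial_characterD(2)[OF assms(1)] by simp
  next
    case (Suc k)
    then show ?case using partial_characterD(3,4)[OF assms(1) assms(2), of "m ^ k"] by simp
  qed
  then show "m ^ k \<in> H" "f (m ^ k) = f m ^ k" by auto
qed

text \<open>Here \<open>k\<close> is the order of \<open>x\<close> modulo \<open>H\<close>, and the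
  value at \<open>x\<close> may be any \<open>k\<close>-th root of \<open>f (x ^ k)\<close>. Keeping
  the root \<open>w\<close> as a parameter serves both the extension to all units, where any root
  will do, and separation, where a root other than 1 is wanted.\<close>

lemma partial_character_extend:
  assumes H: "partial_character q H f" and q: "q > 0" and x: "coprime x (int q)"
    and k: "k > 0" "x ^ k \<in> H" "\<And>j. 0 < j \<Longrightarrow> j < k \<Longrightarrow> x ^ j \<notin> H"
    and w: "w ^ k = f (x ^ k)"
  obtains H' f' where "partial_character q H' f'" "H \<subseteq> H'" "x \<in> H'"
    "\<And>h. h \<in> H \<Longrightarrow> f' h = f h" "f' x = w"
proof -
  note HD = partial_characterD[OF H]
  have w0: "w \<noteq> 0" using w HD(7) k by (metis power_0_left not_gr_zero)
  \<comment> \<open>Otherwise the remainder \<open>r\<close> of \<open>j\<close> modulo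
    \<open>k\<close> is a smaller positive exponent with \<open>x ^ r\<close> in \<open>H\<close>.
    The inverse of \<open>P\<close> inside \<open>H\<close> is its power with exponent
    \<open>totient q - 1\<close>.\<close>
  have dvdk: "k dvd j" if "x ^ j \<in> H" for j
  proof (rule ccontr)
    assume nd: "\<not> k dvd j"
    define r where "r = j mod k"
    have r: "0 < r" "r < k" using nd k(1) by (auto simp: r_def mod_greater_zero_iff_not_dvd)
    have "coprime (x ^ (k * (j div k))) (int q)" using x by simp
    then obtain y where y: "[x ^ (k * (j div k)) * y = 1] (mod int q)" "coprime y (int q)"
      using coprime_imp_inverse_int[OF q] by metis
    define P where "P = x ^ (k * (j div k))"
    have "P \<in> H" using partial_character_power(1)[OF H k(2)] by (simp add: P_def power_mult)
    then have P': "P ^ (totient q - 1) \<in> H" by (rule partial_character_power(1)[OF H])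
    have "coprime P (int q)" using x by (simp add: P_def)
    then have "[P ^ totient q = 1] (mod int q)" by (rule euler_theorem_int[OF q])
    moreover have "P ^ totient q = P ^ (totient q - 1) * P"
      using q by (metis Suc_diff_1 power_Suc2 totient_gt_0_iff)
    ultimately have PP: "[P ^ (totient q - 1) * P = 1] (mod int q)" by simp
    have "x ^ j = P * x ^ r" by (simp add: P_def r_def power_add[symmetric])
    then have "[P ^ (totient q - 1) * x ^ j = x ^ r] (mod int q)"
      using cong_mult[OF PP cong_refl[of "x ^ r"]] by (simp add: mult.assoc)
    then have "x ^ r \<in> H" using HD(3)[OF P' that] HD(5) by blast
    then show False using k(3)[of r] r by blast
  qed
  define H' where "H' = {n. \<exists>h\<in>H. \<exists>j::nat. [n = h * x ^ j] (mod int q)}"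
  \<comment> \<open>Well-definedness of \<open>h * x ^ j \<mapsto> f h * w ^ j\<close>: two
    representations of one class differ by \<open>x ^ (i - j)\<close>, which lies in
    \<open>H\<close>; so \<open>i - j\<close> is a multiple of \<open>k\<close>, and
    \<open>w ^ k = f (x ^ k)\<close> applies.\<close>
  have aux: "f h * w ^ i = f h' * w ^ j"
    if "h \<in> H" "h' \<in> H" "[h * x ^ i = h' * x ^ j] (mod int q)" "i \<ge> j" for h h' i j
  proof -
    have "[h * x ^ (i - j) * x ^ j = h' * x ^ j] (mod int q)"
      using that by (simp add: mult.assoc power_add[symmetric])
    then have c1: "[h * x ^ (i - j) = h'] (mod int q)"
      using x by (simp add: cong_mult_rcancel)
    have hh: "h ^ (totient q - 1) \<in> H" using partial_character_power(1)[OF H that(1)] .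
    have "[h ^ totient q = 1] (mod int q)" using euler_theorem_int[OF q HD(1)[OF that(1)]] .
    moreover have "h ^ totient q = h ^ (totient q - 1) * h"
      using q by (metis Suc_diff_1 power_Suc2 totient_gt_0_iff)
    ultimately have PP: "[h ^ (totient q - 1) * h = 1] (mod int q)" by simp
    have "[h ^ (totient q - 1) * h' = h ^ (totient q - 1) * (h * x ^ (i - j))] (mod int q)"
      using c1 by (intro cong_mult cong_refl) (simp add: cong_sym)
    also have "h ^ (totient q - 1) * (h * x ^ (i - j)) = (h ^ (totient q - 1) * h) * x ^ (i - j)"
      by simp
    also have "[\<dots> = 1 * x ^ (i - j)] (mod int q)" by (intro cong_mult cong_refl PP)
    finally have "[h ^ (totient q - 1) * h' = x ^ (i - j)] (mod int q)" by simp
    then have xij: "x ^ (i - j) \<in> H" using HD(3)[OF hh that(2)] HD(5) by blast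
    then obtain m where m: "i - j = k * m" using dvdk by (meson dvdE)
    have "f h' = f (h * x ^ (i - j))" using HD(6)[OF HD(3)[OF that(1) xij] c1] .
    also have "\<dots> = f h * f ((x ^ k) ^ m)" using HD(4)[OF that(1) xij] m by (simp add: power_mult)
    also have "f ((x ^ k) ^ m) = (w ^ k) ^ m" using partial_character_power(2)[OF H k(2)] w by simp
    finally have "f h' * w ^ j = f h * (w ^ (i - j) * w ^ j)" by (simp add: m power_mult)
    also have "w ^ (i - j) * w ^ j = w ^ i" using that by (simp add: power_add[symmetric])
    finally show ?thesis by simp
  qed
  have wd: "f h * w ^ i = f h' * w ^ j"
    if "h \<in> H" "h' \<in> H" "[h * x ^ i = h' * x ^ j] (mod int q)" for h h' i j
    using aux[OF that] aux[OF that(2,1) cong_sym[OF that(3)]] by (cases "i \<ge> j") auto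
  \<comment> \<open>The value is read off from an arbitrary representation; by \<open>wd\<close> all
    of them give the same.\<close>
  define P where "P n v \<longleftrightarrow> (\<exists>h\<in>H. \<exists>j::nat. [n = h * x ^ j] (mod int q) \<and> v = f h * w ^ j)" for n v
  define f' where "f' n = (SOME v. P n v)" for n
  have f': "f' n = f h * w ^ j" if "h \<in> H" "[n = h * x ^ j] (mod int q)" for n h j
  proof -
    have "P n (f h * w ^ j)" using that by (auto simp: P_def)
    then have "P n (f' n)" unfolding f'_def by (rule someI)
    then obtain h' i where *: "h' \<in> H" "[n = h' * x ^ i] (mod int q)" "f' n = f h' * w ^ i"
      by (auto simp: P_def)
    then show ?thesis using wd[OF *(1) that(1) cong_trans[OF cong_sym[OF *(2)] that(2)]] by simp
  qed
  have "partial_character q H' f'"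
    unfolding partial_character_def
  proof (intro conjI ballI allI impI)
    show "H' \<subseteq> {n. coprime n (int q)}"
    proof
      fix n assume "n \<in> H'"
      then obtain h j where "h \<in> H" "[n = h * x ^ j] (mod int q)" by (auto simp: H'_def)
      moreover have "coprime (h * x ^ j) (int q)" using HD(1)[OF \<open>h \<in> H\<close>] x by simp
      ultimately show "n \<in> {n. coprime n (int q)}" using cong_imp_coprime cong_sym by blast
    qed
    show "1 \<in> H'" unfolding H'_def using HD(2) by (auto intro!: bexI[of _ 1] exI[of _ 0])
  next
    fix m n assume "m \<in> H'" "n \<in> H'"
    then obtain h i h' j where *: "h \<in> H" "[m = h * x ^ i] (mod int q)"
      "h' \<in> H" "[n = h' * x ^ j] (mod int q)" by (auto simp: H'_def)
    have c: "[m * n = (h * h') * x ^ (i + j)] (mod int q)"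
      using cong_mult[OF *(2,4)] by (simp add: power_add mult_ac)
    have hh: "h * h' \<in> H" using HD(3) * by blast
    show "m * n \<in> H'" unfolding H'_def using c hh by blast
    show "f' (m * n) = f' m * f' n"
      using f'[OF hh c] f'[OF *(1,2)] f'[OF *(3,4)] HD(4)[OF *(1,3)] by (simp add: power_add)
  next
    fix m n assume "m \<in> H'" "[m = n] (mod int q)"
    then obtain h i where *: "h \<in> H" "[m = h * x ^ i] (mod int q)" by (auto simp: H'_def)
    then have c: "[n = h * x ^ i] (mod int q)" using \<open>[m = n] (mod int q)\<close> by (metis cong_sym cong_trans)
    show "n \<in> H'" unfolding H'_def using c * by blast
    show "f' n = f' m" using f'[OF *] f'[OF *(1) c] by simp
  next
    fix m assume "m \<in> H'"
    then obtain h i where *: "h \<in> H" "[m = h * x ^ i] (mod int q)" by (auto simp: H'_def)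
    then show "f' m \<noteq> 0" using f'[OF *] HD(7) w0 by simp
  qed
  moreover have "H \<subseteq> H'"
  proof
    show "h \<in> H'" if "h \<in> H" for h
      using that unfolding H'_def by (auto intro!: bexI[of _ h] exI[of _ 0])
  qed
  moreover have "x \<in> H'" unfolding H'_def using HD(2) by (auto intro!: bexI[of _ 1] exI[of _ 1])
  moreover have "f' h = f h" if "h \<in> H" for h using f'[OF that, of h 0] by simp
  moreover have "f' x = w"
    using f'[OF HD(2), of x 1] partial_character_power(2)[OF H HD(2), of 0] by simp
  ultimately show ?thesis using that by blast
qed

text \<open>Each adjunction of a unit outside \<open>H\<close> lowers the number of residues not in
  \<open>H\<close>, and the required root always exists in the complex numbers.\<close>

lemma partial_character_extend_all:
  assumes "partial_character q H f" "q > 0"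
  shows "\<exists>f'. partial_character q {n. coprime n (int q)} f' \<and> (\<forall>h\<in>H. f' h = f h)"
  using assms
proof (induction "card ({0..<int q} - H)" arbitrary: H f rule: less_induct)
  case less
  note H = less.prems(1)
  show ?case
  proof (cases "H = {n. coprime n (int q)}")
    case True
    then show ?thesis using less.prems by blast
  next
    case False
    then obtain x where x: "coprime x (int q)" "x \<notin> H"
      using partial_characterD(1)[OF H] by blast
    define k where "k = (LEAST k. k > 0 \<and> x ^ k \<in> H)"
    have "[1 = x ^ totient q] (mod int q)" using euler_theorem_int[OF less.prems(2) x(1)] cong_sym by blast
    then have "x ^ totient q \<in> H" using partial_characterD(5)[OF H partial_characterD(2)[OF H]] by blast
    then have k: "k > 0 \<and> x ^ k \<in> H" unfolding k_def
      using less.prems(2) LeastI[of "\<lambda>k. k > 0 \<and> x ^ k \<in> H" "totient q"] by auto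
    have kmin: "x ^ j \<notin> H" if "0 < j" "j < k" for j
      using that not_less_Least[of j "\<lambda>k. k > 0 \<and> x ^ k \<in> H"] by (auto simp: k_def)
    have "k \<noteq> 0" using k by simp
    then obtain w where "f (x ^ k) = w ^ k" by (rule exists_complex_root[of k "f (x ^ k)"])
    then have w: "w ^ k = f (x ^ k)" by simp
    obtain H' f' where H': "partial_character q H' f'" "H \<subseteq> H'" "x \<in> H'"
      "\<And>h. h \<in> H \<Longrightarrow> f' h = f h"
      by (rule partial_character_extend[OF H less.prems(2) x(1) conjunct1[OF k] conjunct2[OF k] kmin w])
         (assumption | rule that)+
    have c: "[x = x mod int q] (mod int q)" by (simp add: cong_def)
    have "x mod int q \<in> {0..<int q} - H"
      using partial_characterD(5)[OF H, of "x mod int q" x] x less.prems(2) c cong_sym by auto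
    moreover have "x mod int q \<in> H'" using partial_characterD(5)[OF H'(1,3) c] .
    ultimately have "card ({0..<int q} - H') < card ({0..<int q} - H)"
      using H'(2) by (intro psubset_card_mono) auto
    from less.hyps[OF this H'(1) less.prems(2)] show ?thesis using H'(2,4) by fastforce
  qed
qed

text \<open>Start from the trivial character on the class of 1, send \<open>c\<close>, whose order
  is \<open>k > 1\<close>, to a primitive \<open>k\<close>-th root of unity, and extend the result
  to all units.\<close>

lemma dirichlet_character_separates:
  assumes q: "q > 0" and c: "coprime c (int q)" "\<not> [c = 1] (mod int q)"
  shows "\<exists>chi. dirichlet_character q chi \<and> chi c \<noteq> 1"
proof -
  define H where "H = {n. [n = 1] (mod int q)}"
  have H: "partial_character q H (\<lambda>_. 1)"
    unfolding partial_character_def H_def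
  proof (intro conjI ballI allI impI subsetI; (unfold mem_Collect_eq)?)
    show "coprime n (int q)" if "[n = 1] (mod int q)" for n
      using cong_imp_coprime[OF cong_sym[OF that]] by simp
    show "[m * n = 1] (mod int q)" if "[m = 1] (mod int q)" "[n = 1] (mod int q)" for m n
      using cong_mult[OF that] by simp
    show "[n = 1] (mod int q)" if "[m = 1] (mod int q)" "[m = n] (mod int q)" for m n
      using cong_trans[OF cong_sym[OF that(2)] that(1)] .
  qed auto
  define k where "k = (LEAST k. k > 0 \<and> c ^ k \<in> H)"
  have "c ^ totient q \<in> H" using euler_theorem_int[OF q c(1)] by (simp add: H_def)
  then have k: "k > 0 \<and> c ^ k \<in> H" unfolding k_def
    using q LeastI[of "\<lambda>k. k > 0 \<and> c ^ k \<in> H" "totient q"] by auto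
  have kmin: "c ^ j \<notin> H" if "0 < j" "j < k" for j
    using that not_less_Least[of j "\<lambda>k. k > 0 \<and> c ^ k \<in> H"] by (auto simp: k_def)
  have "k \<noteq> 1" using k c by (auto simp: H_def)
  define w where "w = exp (2 * of_real pi * \<i> / of_nat k)"
  have wk: "w ^ k = 1" using complex_root_unity[of k 1] k by (simp add: w_def)
  have "w \<noteq> 1"
    using complex_root_unity_eq_1[of k 1] k \<open>k \<noteq> 1\<close> unfolding w_def by simp
  obtain H' f' where H': "partial_character q H' f'" "H \<subseteq> H'" "c \<in> H'" "f' c = w"
    by (rule partial_character_extend[OF H q c(1) conjunct1[OF k] conjunct2[OF k] kmin])
       (use wk in auto)
  obtain g where g: "partial_character q {n. coprime n (int q)} g" "\<forall>h\<in>H'. g h = f' h"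
    using partial_character_extend_all[OF H'(1) q] by blast
  define chi where "chi n = (if coprime n (int q) then g n else 0)" for n
  have "dirichlet_character q chi"
    unfolding dirichlet_character_def
  proof (intro conjI allI)
    show "q > 0" by (rule q)
    show "chi (m * n) = chi m * chi n" for m n
      using partial_characterD(4)[OF g(1)] by (auto simp: chi_def)
    have "[n = n + int q] (mod int q)" for n by (simp add: cong_def)
    then show "chi (n + int q) = chi n" for n
      using partial_characterD(6)[OF g(1), of n "n + int q"]
      by (simp add: chi_def coprime_add_self_int)
    show "(chi n \<noteq> 0) = coprime n (int q)" for n
      using partial_characterD(7)[OF g(1), of n] by (auto simp: chi_def)
  qed
  moreover have "chi c \<noteq> 1" using g(2) H'(3,4) c \<open>w \<noteq> 1\<close> by (auto simp: chi_def)
  ultimately show ?thesis by blast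
qed

subsection \<open>Orthogonality\<close>

lemma bij_betw_mult_mod:
  assumes "q > 0" "coprime x (int q)"
  shows "bij_betw (\<lambda>n. (x * n) mod int q) {0..<int q} {0..<int q}"
proof -
  have "inj_on (\<lambda>n. (x * n) mod int q) {0..<int q}"
  proof (rule inj_onI)
    fix m n assume *: "m \<in> {0..<int q}" "n \<in> {0..<int q}" "(x * m) mod int q = (x * n) mod int q"
    then have "[x * m = x * n] (mod int q)" by (simp add: cong_def)
    then have "[m = n] (mod int q)" using assms by (simp add: cong_mult_lcancel)
    then have "m mod int q = n mod int q" by (simp only: cong_def)
    then show "m = n" using *(1,2) by (simp add: mod_pos_pos_trivial)
  qed
  moreover have "(\<lambda>n. (x * n) mod int q) ` {0..<int q} \<subseteq> {0..<int q}" using assms by auto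
  ultimately show ?thesis
    by (simp add: bij_betw_def endo_inj_surj)
qed

lemma sum_periodic_mult:
  fixes f :: "int \<Rightarrow> 'a :: comm_monoid_add"
  assumes "q > 0" "coprime x (int q)" "\<And>n. f (n + int q) = f n"
  shows "(\<Sum>n\<in>{0..<int q}. f (x * n)) = (\<Sum>n\<in>{0..<int q}. f n)"
proof -
  have "(\<Sum>n\<in>{0..<int q}. f (x * n)) = (\<Sum>n\<in>{0..<int q}. f ((x * n) mod int q))"
    by (intro sum.cong refl periodic_cong[of f q, OF assms(3)]) (simp add: cong_def)
  also have "\<dots> = (\<Sum>n\<in>{0..<int q}. f n)"
    by (rule sum.reindex_bij_betw[OF bij_betw_mult_mod[OF assms(1,2)]])
  finally show ?thesis .
qed

lemma card_coprime_residues: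
  assumes "q > 0"
  shows "card {n\<in>{0..<int q}. coprime n (int q)} = totient q"
proof -
  \<comment> \<open>\<open>totatives q\<close> lives in 1 to \<open>q\<close> and the residues in 0
    to \<open>q - 1\<close>. The two differ only in the name of the class of 0, which is a unit just
    for \<open>q = 1\<close>.\<close>
  have "bij_betw (\<lambda>n. int (n mod q)) (totatives q) {n\<in>{0..<int q}. coprime n (int q)}"
  proof (rule bij_betw_byWitness[where f' = "\<lambda>n. if n = 0 then q else nat n"])
    show "\<forall>a\<in>totatives q. (if int (a mod q) = 0 then q else nat (int (a mod q))) = a"
    proof (rule ballI)
      fix a assume "a \<in> totatives q"
      then have "0 < a" "a < q \<or> a = q" by (auto simp: totatives_def)
      then show "(if int (a mod q) = 0 then q else nat (int (a mod q))) = a" by auto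
    qed
    show "\<forall>a'\<in>{n \<in> {0..<int q}. coprime n (int q)}. int ((if a' = 0 then q else nat a') mod q) = a'"
      by auto
    show "(\<lambda>n. int (n mod q)) ` totatives q \<subseteq> {n \<in> {0..<int q}. coprime n (int q)}"
      using assms by (auto simp: totatives_def)
    show "(\<lambda>n. if n = 0 then q else nat n) ` {n \<in> {0..<int q}. coprime n (int q)} \<subseteq> totatives q"
    proof safe
      fix n assume n: "n \<in> {0..<int q}" "coprime n (int q)"
      then obtain k where k: "n = int k" using zero_le_imp_eq_int by auto
      show "(if n = 0 then q else nat n) \<in> totatives q"
        using n assms unfolding k by (auto simp: totatives_def)
    qed
  qed
  then show ?thesis unfolding totient_def by (metis bij_betw_same_card)
qed

text \<open>For a nonprincipal character, multiplication by a unit \<open>x\<close> with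
  \<open>chi x \<noteq> 1\<close> permutes the residues and multiplies the sum by
  \<open>chi x\<close>.\<close>

lemma sum_dirichlet_character_residues:
  assumes "dirichlet_character q chi"
  shows "(\<Sum>n\<in>{0..<int q}. chi n) = (if chi = principal_character q then of_nat (totient q) else 0)"
proof (cases "chi = principal_character q")
  case True
  have "(\<Sum>n\<in>{0..<int q}. chi n) = (\<Sum>n\<in>{n\<in>{0..<int q}. coprime n (int q)}. 1)"
    unfolding True by (intro sum.mono_neutral_cong_right) (auto simp: principal_character_def)
  then show ?thesis using True card_coprime_residues dirichlet_characterD(1)[OF assms] by simp
next
  case False
  have q: "q > 0" using dirichlet_characterD(1)[OF assms] .
  obtain x where x: "chi x \<noteq> principal_character q x" using False by blast
  then have x: "coprime x (int q)" "chi x \<noteq> 1"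
    using dirichlet_characterD(4)[OF assms, of x] by (auto simp: principal_character_def split: if_splits)
  have "(\<Sum>n\<in>{0..<int q}. chi n) = (\<Sum>n\<in>{0..<int q}. chi (x * n))"
    using sum_periodic_mult[OF q x(1), of chi] dirichlet_characterD(3)[OF assms] by simp
  also have "\<dots> = chi x * (\<Sum>n\<in>{0..<int q}. chi n)"
    by (simp add: dirichlet_characterD(2)[OF assms] sum_distrib_left)
  finally have "(1 - chi x) * (\<Sum>n\<in>{0..<int q}. chi n) = 0" by (simp add: algebra_simps)
  then show ?thesis using x False by simp
qed

text \<open>The dual argument: multiplication by a character \<open>psi\<close> with
  \<open>psi c \<noteq> 1\<close> permutes the characters and multiplies the sum by
  \<open>psi c\<close>.\<close>

lemma sum_characters_eq_0:
  assumes "q > 0" "coprime c (int q)" "\<not> [c = 1] (mod int q)"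
  shows "(\<Sum>chi\<in>dirichlet_characters q. chi c) = 0"
proof -
  obtain psi where psi: "dirichlet_character q psi" "psi c \<noteq> 1"
    using dirichlet_character_separates[OF assms] by blast
  \<comment> \<open>\<open>cnj (psi n)\<close> inverts \<open>psi n\<close> only at units, but
    elsewhere \<open>chi n\<close> vanishes.\<close>
  have eq: "chi n * cnj (psi n) * psi n = chi n" if "dirichlet_character q chi" for chi n
    using dirichlet_character_mult_cnj[OF psi(1), of n] dirichlet_characterD(4)[OF that, of n]
    by (cases "chi n = 0") (auto simp: mult_ac)
  have eq2: "chi n * psi n * cnj (psi n) = chi n" if "dirichlet_character q chi" for chi n
  proof -
    have "chi n * psi n * cnj (psi n) = chi n * cnj (psi n) * psi n" by simp
    then show ?thesis using eq[OF that, of n] by simp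
  qed
  have "bij_betw (\<lambda>chi n. chi n * psi n) (dirichlet_characters q) (dirichlet_characters q)"
  proof (rule bij_betw_byWitness[where f' = "\<lambda>chi n. chi n * cnj (psi n)"])
    show "\<forall>chi\<in>dirichlet_characters q. (\<lambda>n. chi n * psi n * cnj (psi n)) = chi"
      using eq2 by (auto simp: dirichlet_characters_def fun_eq_iff)
    show "\<forall>chi\<in>dirichlet_characters q. (\<lambda>n. chi n * cnj (psi n) * psi n) = chi"
      using eq by (auto simp: dirichlet_characters_def fun_eq_iff)
    show "(\<lambda>chi n. chi n * psi n) ` dirichlet_characters q \<subseteq> dirichlet_characters q"
      using dirichlet_character_mult[OF _ psi(1)] by (auto simp: dirichlet_characters_def)
    show "(\<lambda>chi n. chi n * cnj (psi n)) ` dirichlet_characters q \<subseteq> dirichlet_characters q"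
      using dirichlet_character_mult[OF _ dirichlet_character_cnj[OF psi(1)]]
      by (auto simp: dirichlet_characters_def)
  qed
  then have "(\<Sum>chi\<in>dirichlet_characters q. chi c) = (\<Sum>chi\<in>dirichlet_characters q. chi c * psi c)"
    by (rule sum.reindex_bij_betw[symmetric])
  also have "\<dots> = psi c * (\<Sum>chi\<in>dirichlet_characters q. chi c)"
    by (simp add: sum_distrib_left mult.commute)
  finally have "(1 - psi c) * (\<Sum>chi\<in>dirichlet_characters q. chi c) = 0" by (simp add: algebra_simps)
  then show ?thesis using psi by simp
qed

text \<open>Double counting of \<open>chi n\<close> over all characters and residues: in one order
  only the principal character survives, in the other only the class of 1.\<close>

lemma card_dirichlet_characters:
  assumes "q > 0"
  shows "card (dirichlet_characters q) = totient q"
proof -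
  have prin: "principal_character q \<in> dirichlet_characters q"
    using dirichlet_character_principal[OF assms] by (simp add: dirichlet_characters_def)
  have "complex_of_nat (totient q) =
      (\<Sum>chi\<in>dirichlet_characters q. if chi = principal_character q then of_nat (totient q) else 0)"
    using prin by simp
  also have "\<dots> = (\<Sum>chi\<in>dirichlet_characters q. \<Sum>n\<in>{0..<int q}. chi n)"
    by (intro sum.cong refl, subst sum_dirichlet_character_residues) (auto simp: dirichlet_characters_def)
  also have "\<dots> = (\<Sum>n\<in>{0..<int q}. \<Sum>chi\<in>dirichlet_characters q. chi n)" by (rule sum.swap)
  \<comment> \<open>For \<open>q = 1\<close> the class of 1 is represented by 0, hence
    \<open>1 mod int q\<close>.\<close>
  also have "\<dots> = (\<Sum>n\<in>{0..<int q}. if n = 1 mod int q then of_nat (card (dirichlet_characters q)) else 0)"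
  proof (intro sum.cong refl)
    fix n assume n: "n \<in> {0..<int q}"
    show "(\<Sum>chi\<in>dirichlet_characters q. chi n) = (if n = 1 mod int q then of_nat (card (dirichlet_characters q)) else 0)"
    proof (cases "[n = 1] (mod int q)")
      case True
      then have "(\<Sum>chi\<in>dirichlet_characters q. chi n) = (\<Sum>chi\<in>dirichlet_characters q. 1)"
        by (intro sum.cong refl)
           (metis dirichlet_characters_def mem_Collect_eq dirichlet_character_cong dirichlet_character_1)
      then show ?thesis using True n by (simp add: cong_def)
    next
      case False
      then have ne: "n \<noteq> 1 mod int q" by (auto simp: cong_def)
      show ?thesis
      proof (cases "coprime n (int q)")
        case True
        then show ?thesis using sum_characters_eq_0[OF assms True False] ne by simp
      next
        case F: False
        have "(\<Sum>chi\<in>dirichlet_characters q. chi n) = 0"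
          using F dirichlet_characterD(4) by (intro sum.neutral) (auto simp: dirichlet_characters_def)
        then show ?thesis using ne by simp
      qed
    qed
  qed
  also have "\<dots> = of_nat (card (dirichlet_characters q))"
    using assms by (simp add: pos_mod_bound)
  finally show ?thesis using of_nat_eq_iff by metis
qed

lemma sum_characters:
  assumes "q > 0" "coprime c (int q)"
  shows "(\<Sum>chi\<in>dirichlet_characters q. chi c) = (if [c = 1] (mod int q) then of_nat (totient q) else 0)"
proof (cases "[c = 1] (mod int q)")
  case True
  then have "(\<Sum>chi\<in>dirichlet_characters q. chi c) = (\<Sum>chi\<in>dirichlet_characters q. 1)"
    by (intro sum.cong refl)
       (metis dirichlet_characters_def mem_Collect_eq dirichlet_character_cong dirichlet_character_1)
  then show ?thesis using True card_dirichlet_characters[OF assms(1)] by simp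
qed (use sum_characters_eq_0 assms in auto)

subsection \<open>Conductors\<close>

text \<open>Add to \<open>m\<close> the product of \<open>l\<close> and the primes of
  \<open>q\<close> that do not divide \<open>m\<close>. Every prime of \<open>q\<close> then divides
  exactly one of the two summands, because a prime dividing \<open>m\<close> divides neither
  \<open>l\<close> nor any element of \<open>P\<close>.\<close>

lemma exists_coprime_cong:
  assumes q: "q > 0" and m: "coprime m (int l)"
  shows "\<exists>m'. [m' = m] (mod int l) \<and> coprime m' (int q)"
proof -
  define P where "P = {p\<in>prime_factors (int q). \<not> p dvd m}"
  define m' where "m' = m + int l * \<Prod>P"
  have "coprime m' (int q)"
  proof (rule ccontr)
    assume "\<not> coprime m' (int q)"
    then have "\<not> is_unit (gcd m' (int q))" by (simp add: coprime_iff_gcd_eq_1)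
    then obtain p where p: "p dvd gcd m' (int q)" "prime p"
      using prime_divisor_exists[of "gcd m' (int q)"] q by auto
    then have pm': "p dvd m'" and pq: "p dvd int q" by auto
    show False
    proof (cases "p dvd m")
      case True
      then have "p dvd int l * \<Prod>P" using pm' by (simp add: m'_def dvd_add_right_iff)
      moreover have "\<not> p dvd int l"
        using True m p(2) by (meson coprime_common_divisor not_prime_unit)
      ultimately have "p dvd \<Prod>P" using p(2) by (simp add: prime_dvd_mult_iff)
      then obtain r where r: "r \<in> P" "p dvd r"
        using prime_dvd_prod_iff[of P p "\<lambda>x. x"] p(2) by (auto simp: P_def)
      then have "p = r" using p(2) by (auto simp: P_def intro: primes_dvd_imp_eq)
      then show False using r True by (simp add: P_def)
    next
      case False
      then have "p \<in> P" using pq p(2) q by (auto simp: P_def in_prime_factors_iff)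
      then have "p dvd \<Prod>P" by (intro dvd_prodI) (auto simp: P_def)
      then have "p dvd m" using pm' unfolding m'_def by (metis dvd_add_left_iff dvd_mult)
      then show False using False by simp
    qed
  qed
  moreover have "[m' = m] (mod int l)" by (simp add: m'_def cong_def)
  ultimately show ?thesis by blast
qed

lemma inducesD:
  assumes "induces d psi q chi"
  shows "dirichlet_character d psi" "dirichlet_character q chi" "d dvd q"
    "coprime n (int q) \<Longrightarrow> chi n = psi n"
  using assms unfolding induces_def by auto

lemma coprime_dvd_int: "coprime n (int q) \<Longrightarrow> d dvd q \<Longrightarrow> coprime n (int d)"
  by (meson coprime_divisors dvd_refl int_dvd_int_iff)

lemma cong_dvd_int: "[m = n] (mod int q) \<Longrightarrow> d dvd q \<Longrightarrow> [m = n] (mod int d)"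
  by (meson cong_dvd_modulus int_dvd_int_iff)

lemma induces_cong:
  assumes "induces d psi q chi" "[m = n] (mod int d)" "coprime m (int q)" "coprime n (int q)"
  shows "chi m = chi n"
  using inducesD(4)[OF assms(1)] dirichlet_character_cong[OF inducesD(1)[OF assms(1)] assms(2)] assms(3,4)
  by simp

text \<open>A character that is trivial on the units congruent to 1 modulo \<open>d\<close> depends
  only on the class modulo \<open>d\<close>; its value at a unit modulo \<open>d\<close> is that of
  \<open>chi\<close> at any lift coprime to \<open>q\<close>.\<close>

lemma exists_induces:
  assumes chi: "dirichlet_character q chi" and d: "d dvd q"
    and ker: "\<And>n. coprime n (int q) \<Longrightarrow> [n = 1] (mod int d) \<Longrightarrow> chi n = 1"
  shows "\<exists>psi. induces d psi q chi"
proof -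
  have q: "q > 0" using dirichlet_characterD(1)[OF chi] .
  then have d0: "d > 0" using d by (auto intro: Nat.gr0I)
  have eq: "chi m = chi n"
    if mn: "[m = n] (mod int d)" "coprime m (int q)" "coprime n (int q)" for m n
  proof -
    obtain y where y: "coprime y (int q)" "[n * y = 1] (mod int q)"
      using coprime_imp_inverse_int[OF q mn(3)] .
    have "[m * y = n * y] (mod int d)" using mn(1) by (rule cong_scalar_right)
    also have "[n * y = 1] (mod int d)" using cong_dvd_int[OF y(2) d] .
    finally have "chi (m * y) = 1" using ker[of "m * y"] mn y by simp
    moreover have "chi (n * y) = 1" using dirichlet_character_cong[OF chi y(2)] chi by simp
    ultimately have "chi m * chi y = chi n * chi y" using dirichlet_characterD(2)[OF chi] by simp
    moreover have "chi y \<noteq> 0" using dirichlet_characterD(4)[OF chi] y by blast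
    ultimately show ?thesis by simp
  qed
  define l where "l n = (SOME m. [m = n] (mod int d) \<and> coprime m (int q))" for n
  have l: "[l n = n] (mod int d)" "coprime (l n) (int q)" if "coprime n (int d)" for n
    using someI_ex[OF exists_coprime_cong[OF q that]] unfolding l_def by auto
  define psi where "psi n = (if coprime n (int d) then chi (l n) else 0)" for n
  have psi: "psi n = chi m" if "[m = n] (mod int d)" "coprime m (int q)" for m n
  proof -
    have n: "coprime n (int d)" using cong_imp_coprime[OF that(1)] coprime_dvd_int[OF that(2) d] by blast
    then show ?thesis using eq[OF _ l(2) that(2), of n] l(1)[OF n] that(1)
      by (simp add: psi_def) (metis cong_sym cong_trans)
  qed
  have "dirichlet_character d psi"
    unfolding dirichlet_character_def
  proof (intro conjI allI)
    show "d > 0" by (rule d0)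
    show "psi (n + int d) = psi n" for n
    proof (cases "coprime n (int d)")
      case True
      then have "[l n = n + int d] (mod int d)" using l(1)[OF True] by (simp add: cong_def)
      then show ?thesis using psi[OF _ l(2)[OF True]] l(1)[OF True] by simp
    next
      case False
      then show ?thesis by (simp add: psi_def coprime_add_self_int)
    qed
    show "(psi n \<noteq> 0) = coprime n (int d)" for n
      using l(2)[of n] dirichlet_characterD(4)[OF chi] by (auto simp: psi_def)
    show "psi (m * n) = psi m * psi n" for m n
    proof (cases "coprime m (int d) \<and> coprime n (int d)")
      case True
      have "[l m * l n = m * n] (mod int d)" using True l(1) by (intro cong_mult) auto
      then have "psi (m * n) = chi (l m * l n)" using True l(2) by (intro psi) auto
      then show ?thesis using True dirichlet_characterD(2)[OF chi] by (simp add: psi_def)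
    qed (auto simp: psi_def)
  qed
  then have "induces d psi q chi" unfolding induces_def using psi[OF cong_refl] chi d by auto
  then show ?thesis by blast
qed

lemma induces_unique:
  assumes "induces d psi q chi" "induces d psi' q chi"
  shows "psi = psi'"
proof
  fix n
  note 1 = inducesD[OF assms(1)] and 2 = inducesD[OF assms(2)]
  show "psi n = psi' n"
  proof (cases "coprime n (int d)")
    case True
    then obtain m where m: "[m = n] (mod int d)" "coprime m (int q)"
      using exists_coprime_cong dirichlet_characterD(1)[OF 1(2)] by blast
    then show ?thesis
      using 1(4)[OF m(2)] 2(4)[OF m(2)] dirichlet_character_cong[OF 1(1) m(1)]
        dirichlet_character_cong[OF 2(1) m(1)] by simp
  next
    case False
    then show ?thesis using dirichlet_characterD(4)[OF 1(1)] dirichlet_characterD(4)[OF 2(1)] by metis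
  qed
qed

lemma induces_refl: "dirichlet_character q chi \<Longrightarrow> induces q chi q chi"
  unfolding induces_def by auto

lemma induces_trans:
  assumes "induces e xi d psi" "induces d psi q chi"
  shows "induces e xi q chi"
  unfolding induces_def
proof (intro conjI allI impI)
  show "dirichlet_character e xi" "dirichlet_character q chi" using assms inducesD by blast+
  show "e dvd q" by (rule dvd_trans[OF inducesD(3)[OF assms(1)] inducesD(3)[OF assms(2)]])
  show "chi n = xi n" if "coprime n (int q)" for n
    using that inducesD(4)[OF assms(1)] inducesD(4)[OF assms(2)]
      coprime_dvd_int[OF that inducesD(3)[OF assms(2)]] by simp
qed

lemma induces_intermediate:
  assumes "induces e xi q chi" "induces d psi q chi" "e dvd d"
  shows "induces e xi d psi"
  unfolding induces_def
proof (intro conjI allI impI)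
  note 1 = inducesD[OF assms(1)] and 2 = inducesD[OF assms(2)]
  show "dirichlet_character e xi" "dirichlet_character d psi" "e dvd d" using 1 2 assms by blast+
  fix n assume "coprime n (int d)"
  then obtain m where m: "[m = n] (mod int d)" "coprime m (int q)"
    using exists_coprime_cong dirichlet_characterD(1)[OF 1(2)] by blast
  then show "psi n = xi n"
    using 1(4)[OF m(2)] 2(4)[OF m(2)] dirichlet_character_cong[OF 2(1) m(1)]
      dirichlet_character_cong[OF 1(1) cong_dvd_int[OF m(1) assms(3)]] by simp
qed

text \<open>If \<open>n\<close> is 1 modulo the gcd, Bezout yields an \<open>m\<close> that is 1
  modulo \<open>d1\<close> and \<open>n\<close> modulo \<open>d2\<close>, and its class can be
  represented by a unit modulo \<open>q\<close>. There the two inducing moduli give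
  \<open>chi\<close> the values 1 and \<open>chi n\<close>.\<close>

lemma induces_gcd:
  assumes "induces d1 psi1 q chi" "induces d2 psi2 q chi"
  shows "\<exists>psi. induces (gcd d1 d2) psi q chi"
proof (rule exists_induces)
  note 1 = inducesD[OF assms(1)] and 2 = inducesD[OF assms(2)]
  show "dirichlet_character q chi" "gcd d1 d2 dvd q" using 1 by (auto intro: dvd_trans)
  have q: "q > 0" using dirichlet_characterD(1)[OF 1(2)] .
  fix n assume n: "coprime n (int q)" "[n = 1] (mod int (gcd d1 d2))"
  obtain k where k: "n - 1 = int (gcd d1 d2) * k" using n(2) by (auto simp: cong_iff_dvd_diff)
  obtain u v where uv: "u * int d1 + v * int d2 = gcd (int d1) (int d2)" using bezout_int by blast
  define m where "m = 1 + k * u * int d1"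
  have "n = 1 + k * (u * int d1 + v * int d2)" using k uv by (simp add: algebra_simps)
  then have mn: "n = m + k * v * int d2" by (simp add: m_def algebra_simps)
  have c1: "[m = 1] (mod int d1)" by (simp add: m_def cong_def)
  have c2: "[m = n] (mod int d2)" unfolding mn by (simp add: cong_def)
  have "coprime m (int d1)" using cong_imp_coprime[OF cong_sym[OF c1]] by simp
  moreover have "coprime m (int d2)"
    using cong_imp_coprime[OF cong_sym[OF c2]] coprime_dvd_int[OF n(1) 2(3)] by simp
  ultimately have "coprime m (int (d1 * d2))" by simp
  then obtain m' where m': "[m' = m] (mod int (d1 * d2))" "coprime m' (int q)"
    using exists_coprime_cong[OF q] by blast
  have "[m' = 1] (mod int d1)" using cong_trans[OF cong_dvd_int[OF m'(1)] c1] by simp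
  then have "chi m' = chi 1" using induces_cong[OF assms(1) _ m'(2)] by simp
  moreover have "[m' = n] (mod int d2)" using cong_trans[OF cong_dvd_int[OF m'(1)] c2] by simp
  then have "chi m' = chi n" using induces_cong[OF assms(2) _ m'(2) n(1)] by simp
  ultimately show "chi n = 1" using 1(2) by simp
qed

text \<open>The least inducing modulus in size; by \<open>induces_gcd\<close> it is also the least
  for divisibility.\<close>

definition conductor :: "nat \<Rightarrow> (int \<Rightarrow> complex) \<Rightarrow> nat" where
  "conductor q chi = (LEAST d. \<exists>psi. induces d psi q chi)"

lemma conductor_induces:
  assumes "dirichlet_character q chi"
  shows "\<exists>psi. induces (conductor q chi) psi q chi"
  unfolding conductor_def
  by (rule LeastI_ex) (use induces_refl[OF assms] in blast)

lemma conductor_le: "induces d psi q chi \<Longrightarrow> conductor q chi \<le> d"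
  unfolding conductor_def by (rule Least_le) blast

text \<open>This trades a condition on the conductor for the existence of an inducing character
  modulo \<open>m\<close>, and such characters can be counted.\<close>

lemma conductor_dvd_iff:
  assumes chi: "dirichlet_character q chi" and m: "m dvd q"
  shows "conductor q chi dvd m \<longleftrightarrow> (\<exists>psi. induces m psi q chi)"
proof
  obtain psi where psi: "induces (conductor q chi) psi q chi" using conductor_induces[OF chi] by blast
  note D = inducesD[OF psi]
  assume dvd: "conductor q chi dvd m"
  show "\<exists>psi. induces m psi q chi"
  proof (rule exists_induces[OF chi m])
    fix n assume n: "coprime n (int q)" "[n = 1] (mod int m)"
    then show "chi n = 1"
      using induces_cong[OF psi cong_dvd_int[OF n(2) dvd] n(1)] chi by simp
  qed
next
  assume "\<exists>psi. induces m psi q chi"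
  then obtain psi where psi: "induces m psi q chi" by blast
  obtain psi' where psi': "induces (conductor q chi) psi' q chi" using conductor_induces[OF chi] by blast
  obtain xi where xi: "induces (gcd (conductor q chi) m) xi q chi"
    using induces_gcd[OF psi' psi] by blast
  have "conductor q chi > 0" using dirichlet_characterD(1)[OF inducesD(1)[OF psi']] .
  then have "gcd (conductor q chi) m = conductor q chi"
    using conductor_le[OF xi] by (intro antisym) (auto simp: gcd_le1_nat)
  then show "conductor q chi dvd m" by (metis gcd_dvd2)
qed

lemma conductor_props:
  assumes "dirichlet_character q chi"
  shows "conductor q chi > 0" "conductor q chi dvd q"
proof -
  obtain psi' where psi': "induces (conductor q chi) psi' q chi" using conductor_induces[OF assms] by blast
  show "conductor q chi > 0" "conductor q chi dvd q"
    using dirichlet_characterD(1) inducesD[OF psi'] by blast+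
qed

lemma primitive_induces_conductor:
  assumes "primitive_character d psi" "induces d psi q chi"
  shows "d = conductor q chi"
proof -
  have chi: "dirichlet_character q chi" using assms inducesD by blast
  obtain psi' where psi': "induces (conductor q chi) psi' q chi" using conductor_induces[OF chi] by blast
  have "conductor q chi dvd d" using conductor_dvd_iff[OF chi inducesD(3)[OF assms(2)]] assms by blast
  then have "induces (conductor q chi) psi' d psi" using induces_intermediate psi' assms by blast
  then show ?thesis using assms(1) unfolding primitive_character_def by metis
qed

lemma conductor_primitive:
  assumes psi: "induces (conductor q chi) psi q chi"
  shows "primitive_character (conductor q chi) psi"
  unfolding primitive_character_def
proof (intro conjI allI impI)
  show "dirichlet_character (conductor q chi) psi" using psi inducesD by blast
  fix e xi assume e: "induces e xi (conductor q chi) psi"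
  then have "conductor q chi \<le> e" using conductor_le induces_trans psi by blast
  moreover have "e \<le> conductor q chi"
    using dvd_imp_le[OF inducesD(3)[OF e]] dirichlet_characterD(1)[OF inducesD(2)[OF e]] .
  ultimately show "e = conductor q chi" by simp
qed

lemma primitive_inducing_eqI:
  assumes "primitive_character d psi" "induces d psi q chi"
  shows "primitive_inducing q chi = psi"
  unfolding primitive_inducing_def
proof (rule the_equality)
  show "\<exists>d. primitive_character d psi \<and> induces d psi q chi" using assms by blast
  fix psi' assume "\<exists>d. primitive_character d psi' \<and> induces d psi' q chi"
  then obtain d' where d': "primitive_character d' psi'" "induces d' psi' q chi" by blast
  then have "d = d'" using primitive_induces_conductor assms by metis
  then show "psi' = psi" using induces_unique assms d' by blast
qed

lemma primitive_inducing:
  assumes "dirichlet_character q chi"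
  shows "primitive_character (conductor q chi) (primitive_inducing q chi)"
    and "induces (conductor q chi) (primitive_inducing q chi) q chi"
proof -
  obtain psi where psi: "induces (conductor q chi) psi q chi" using conductor_induces[OF assms] by blast
  have "primitive_inducing q chi = psi"
    using primitive_inducing_eqI[OF conductor_primitive[OF psi] psi] .
  then show "primitive_character (conductor q chi) (primitive_inducing q chi)"
    "induces (conductor q chi) (primitive_inducing q chi) q chi"
    using psi conductor_primitive by auto
qed

lemma dirichlet_character_mod_1:
  assumes "dirichlet_character (Suc 0) chi"
  shows "chi n = 1"
  using dirichlet_character_cong[OF assms, of n 1] assms by (simp add: cong_def)

lemma conductor_gt_1:
  assumes "dirichlet_character q chi" "chi \<noteq> principal_character q"
  shows "conductor q chi > 1"
proof (rule ccontr)
  assume "\<not> conductor q chi > 1"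
  then have c: "conductor q chi = Suc 0" using conductor_props[OF assms(1)] by simp
  obtain psi where psi: "induces (Suc 0) psi q chi" using conductor_induces[OF assms(1)] unfolding c by blast
  have "chi n = principal_character q n" for n
    using inducesD(4)[OF psi, of n] dirichlet_character_mod_1[OF inducesD(1)[OF psi], of n]
      dirichlet_characterD(4)[OF assms(1), of n]
    by (auto simp: principal_character_def)
  then show False using assms(2) by blast
qed

text \<open>The contrapositive of \<open>exists_induces\<close>. It supplies the multiplier that
  forces Gauss sums to vanish at integers not coprime to \<open>q\<close>.\<close>

lemma primitive_character_kernel:
  assumes "primitive_character q chi" "d dvd q" "d \<noteq> q"
  obtains n where "coprime n (int q)" "[n = 1] (mod int d)" "chi n \<noteq> 1"
proof -
  have "dirichlet_character q chi" using assms(1) unfolding primitive_character_def by blast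
  then have "\<exists>psi. induces d psi q chi"
    if "\<And>n. coprime n (int q) \<Longrightarrow> [n = 1] (mod int d) \<Longrightarrow> chi n = 1"
    using exists_induces[OF _ assms(2)] that by blast
  then show ?thesis using assms that unfolding primitive_character_def by blast
qed

lemma induces_cnj:
  assumes "induces d psi q chi"
  shows "induces d (\<lambda>n. cnj (psi n)) q (\<lambda>n. cnj (chi n))"
  using assms unfolding induces_def by (auto intro: dirichlet_character_cnj)

lemma primitive_character_cnj:
  assumes "primitive_character d psi"
  shows "primitive_character d (\<lambda>n. cnj (psi n))"
  unfolding primitive_character_def
proof (intro conjI allI impI)
  show "dirichlet_character d (\<lambda>n. cnj (psi n))"
    using assms dirichlet_character_cnj unfolding primitive_character_def by blast
  fix e xi assume "induces e xi d (\<lambda>n. cnj (psi n))"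
  from induces_cnj[OF this] have "induces e (\<lambda>n. cnj (xi n)) d psi" by simp
  then show "e = d" using assms unfolding primitive_character_def by blast
qed

lemma primitive_inducing_cnj:
  assumes "dirichlet_character q chi"
  shows "primitive_inducing q (\<lambda>n. cnj (chi n)) = (\<lambda>n. cnj (primitive_inducing q chi n))"
  using primitive_inducing_eqI[OF primitive_character_cnj induces_cnj] primitive_inducing[OF assms] by blast

text \<open>These characters are the lifts of all the characters modulo \<open>m\<close>, so the sum
  is orthogonality modulo \<open>m\<close>.\<close>

lemma sum_characters_conductor_dvd:
  assumes q: "q > 0" and m: "m dvd q" and c: "coprime c (int q)"
  shows "(\<Sum>chi\<in>{chi\<in>dirichlet_characters q. conductor q chi dvd m}. chi c) =
           (if [c = 1] (mod int m) then of_nat (totient m) else 0)"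
proof -
  define lift where "lift psi n = (if coprime n (int q) then psi n else 0)" for psi :: "int \<Rightarrow> complex" and n
  have m0: "m > 0" using q m by (auto intro: Nat.gr0I)
  have lift: "induces m psi q (lift psi)" if "dirichlet_character m psi" for psi
    unfolding induces_def dirichlet_character_def[of q]
  proof (intro conjI allI impI)
    have "psi (n + int q) = psi n" for n
      using m by (intro dirichlet_character_cong[OF that]) (auto simp: cong_def elim!: dvdE)
    then show "lift psi (n + int q) = lift psi n" for n by (simp add: lift_def coprime_add_self_int)
    show "(lift psi n \<noteq> 0) = coprime n (int q)" for n
      using dirichlet_characterD(4)[OF that, of n] coprime_dvd_int[OF _ m, of n] by (auto simp: lift_def)
    show "lift psi (k * n) = lift psi k * lift psi n" for k n
      using dirichlet_characterD(2)[OF that] by (auto simp: lift_def)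
  qed (use that q m in \<open>auto simp: lift_def\<close>)
  have "bij_betw lift (dirichlet_characters m) {chi\<in>dirichlet_characters q. conductor q chi dvd m}"
    unfolding bij_betw_def
  proof (intro conjI subset_antisym subsetI)
    show "inj_on lift (dirichlet_characters m)"
    proof (rule inj_onI)
      fix psi psi' assume *: "psi \<in> dirichlet_characters m" "psi' \<in> dirichlet_characters m" "lift psi = lift psi'"
      show "psi = psi'"
        using induces_unique[of m psi q "lift psi" psi'] lift[of psi] lift[of psi'] *
        by (simp add: dirichlet_characters_def)
    qed
    fix chi
    show "chi \<in> {chi\<in>dirichlet_characters q. conductor q chi dvd m}" if chi_in: "chi \<in> lift ` dirichlet_characters m"
    proof -
      obtain psi where "chi = lift psi" "dirichlet_character m psi"
        using chi_in unfolding dirichlet_characters_def by blast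
      then have i: "induces m psi q chi" using lift by blast
      then show ?thesis using conductor_dvd_iff[OF inducesD(2)[OF i] m] inducesD(2)[OF i]
        by (auto simp: dirichlet_characters_def)
    qed
    show "chi \<in> lift ` dirichlet_characters m" if chi_in: "chi \<in> {chi\<in>dirichlet_characters q. conductor q chi dvd m}"
    proof -
      have chi: "dirichlet_character q chi" using chi_in by (auto simp: dirichlet_characters_def)
      then obtain psi where psi: "induces m psi q chi"
        using conductor_dvd_iff[OF chi m] chi_in by blast
      have "chi = lift psi"
      proof
        fix n show "chi n = lift psi n"
          using inducesD(4)[OF psi, of n] dirichlet_characterD(4)[OF chi, of n]
          by (auto simp: lift_def)
      qed
      then show ?thesis using inducesD(1)[OF psi] by (auto simp: dirichlet_characters_def)
    qed
  qed
  then have "(\<Sum>chi\<in>{chi\<in>dirichlet_characters q. conductor q chi dvd m}. chi c) =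
      (\<Sum>psi\<in>dirichlet_characters m. lift psi c)"
    by (rule sum.reindex_bij_betw[symmetric])
  also have "\<dots> = (\<Sum>psi\<in>dirichlet_characters m. psi c)" using c by (simp add: lift_def)
  also have "\<dots> = (if [c = 1] (mod int m) then of_nat (totient m) else 0)"
    using sum_characters[OF m0 coprime_dvd_int[OF c m]] .
  finally show ?thesis .
qed

subsection \<open>The average of the logarithm of the conductor\<close>

lemma sum_totient_prime_powers:
  assumes "prime p"
  shows "(\<Sum>j\<le>k. totient (p ^ j)) = p ^ k"
proof (induction k)
  case (Suc k)
  then show ?case using assms prime_gt_0_nat[OF assms]
    by (simp add: totient_prime_power_Suc del: power_Suc) (simp add: algebra_simps)
qed simp

text \<open>Both sides vanish unless \<open>e = p ^ a\<close>. Write \<open>q = p ^ r * m\<close>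
  with \<open>p\<close> not dividing \<open>m\<close>: only \<open>d = p ^ i\<close> with
  \<open>a \<le> i \<le> r\<close> counts, the totients of \<open>p ^ (r - i)\<close> add up to
  \<open>p ^ (r - a)\<close>, and
  \<open>totient q = p ^ (r - a) * totient m * totient e\<close>.\<close>

lemma sum_mangoldt_totient:
  assumes q: "q > 0" and e: "e dvd q" "e > 1"
  shows "(\<Sum>d | d dvd q \<and> e dvd d. mangoldt d * real (totient (q div d))) =
           real (totient q) * mangoldt e / real (totient e)"
proof (cases "primepow e")
  case False
  have "mangoldt d = (0::real)" if "d dvd q" "e dvd d" for d
  proof (rule ccontr)
    assume "mangoldt d \<noteq> (0::real)"
    then have "primepow d" by (auto simp: mangoldt_def split: if_splits)
    then obtain p k where pk: "prime p" "k > 0" "d = p ^ k" by (auto simp: primepow_def)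
    have "e dvd p ^ k" using that pk by simp
    then obtain j where j: "e = p ^ j" using divides_primepow_nat[OF pk(1)] by blast
    then have "j > 0" using e by (cases j) auto
    then show False using False j pk by simp
  qed
  then show ?thesis using False by (simp add: mangoldt_def)
next
  case True
  then obtain p a where pa: "prime p" "a > 0" "e = p ^ a" by (auto simp: primepow_def)
  define r where "r = multiplicity p q"
  have "q \<noteq> 0" "\<not> is_unit p" using q pa(1) by auto
  then obtain m where m: "q = p ^ r * m" "\<not> p dvd m"
    unfolding r_def by (rule multiplicity_decompose')
  have ar: "a \<le> r" using e(1) pa q unfolding r_def
    by (metis multiplicity_geI not_prime_unit not_gr_zero)
  have p1: "p > 1" using pa(1) prime_gt_1_nat by blast
  have cop: "coprime (p ^ j) m" for j using m(2) pa(1) by (simp add: prime_imp_coprime)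
  have set: "{d. d dvd q \<and> e dvd d \<and> primepow d} = (\<lambda>i. p ^ i) ` {a..r}"
  proof (intro subset_antisym subsetI)
    fix d assume "d \<in> {d. d dvd q \<and> e dvd d \<and> primepow d}"
    then have d: "d dvd q" "e dvd d" "primepow d" by auto
    obtain p' k where p': "prime p'" "k > 0" "d = p' ^ k" using d(3) by (auto simp: primepow_def)
    have "p dvd d" using d(2) pa dvd_trans[of p e d] by (simp add: dvd_power)
    then have "p dvd p'" using p' pa(1) prime_dvd_power by blast
    then have pp: "p' = p" using primes_dvd_imp_eq[OF pa(1) p'(1)] by simp
    have "a \<le> k" using d(2) p1 unfolding p'(3) pp pa(3) by (simp add: power_dvd_imp_le)
    moreover have "k \<le> r" unfolding r_def using d(1) pa q unfolding p'(3) pp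
      by (metis multiplicity_geI not_prime_unit not_gr_zero)
    ultimately show "d \<in> (\<lambda>i. p ^ i) ` {a..r}" using p'(3) pp by auto
  next
    fix d assume "d \<in> (\<lambda>i. p ^ i) ` {a..r}"
    then obtain i where i: "d = p ^ i" "a \<le> i" "i \<le> r" by auto
    have "p ^ i dvd q" unfolding m(1) using le_imp_power_dvd[OF i(3), of p] by simp
    then show "d \<in> {d. d dvd q \<and> e dvd d \<and> primepow d}"
      using i pa le_imp_power_dvd[OF i(2), of p] by auto
  qed
  have inj: "inj_on (\<lambda>i. p ^ i) {a..r}" using p1 by (auto intro!: inj_onI)
  have fin: "finite {d. d dvd q \<and> e dvd d}" using q by auto
  have "(\<Sum>d | d dvd q \<and> e dvd d. mangoldt d * real (totient (q div d))) =
      (\<Sum>d | d dvd q \<and> e dvd d \<and> primepow d. mangoldt d * real (totient (q div d)))"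
    using fin by (intro sum.mono_neutral_right) (auto simp: mangoldt_def)
  also have "\<dots> = (\<Sum>i\<in>{a..r}. mangoldt (p ^ i) * real (totient (q div p ^ i)))"
    unfolding set by (subst sum.reindex[OF inj]) simp
  also have "\<dots> = (\<Sum>i\<in>{a..r}. ln (real p) * real (totient m) * real (totient (p ^ (r - i))))"
  proof (intro sum.cong refl)
    fix i assume i: "i \<in> {a..r}"
    then have "q = p ^ i * (p ^ (r - i) * m)" using m(1) by (simp add: power_add[symmetric] mult.assoc[symmetric])
    then have "q div p ^ i = p ^ (r - i) * m" using p1 by simp
    then have "totient (q div p ^ i) = totient (p ^ (r - i)) * totient m"
      using totient_mult_coprime[OF cop] by simp
    moreover have "mangoldt (p ^ i) = ln (real p)" using i pa by (simp add: mangoldt_primepow)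
    ultimately show "mangoldt (p ^ i) * real (totient (q div p ^ i)) =
        ln (real p) * real (totient m) * real (totient (p ^ (r - i)))" by simp
  qed
  also have "\<dots> = ln (real p) * real (totient m) * (\<Sum>i\<in>{a..r}. real (totient (p ^ (r - i))))"
    by (simp add: sum_distrib_left)
  also have "(\<Sum>i\<in>{a..r}. real (totient (p ^ (r - i)))) = (\<Sum>j\<le>r - a. real (totient (p ^ j)))"
    by (rule sum.reindex_bij_witness[where i = "\<lambda>j. r - j" and j = "\<lambda>i. r - i"]) (use ar in auto)
  also have "\<dots> = real (p ^ (r - a))" using sum_totient_prime_powers[OF pa(1), of "r - a"]
    by (metis of_nat_sum)
  finally have lhs: "(\<Sum>d | d dvd q \<and> e dvd d. mangoldt d * real (totient (q div d))) =
      ln (real p) * real (totient m) * real (p ^ (r - a))" .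
  have r0: "r > 0" using ar pa by simp
  have "totient q = totient (p ^ r) * totient m" using totient_mult_coprime[OF cop] m(1) by simp
  also have "totient (p ^ r) = p ^ (r - 1) * (p - 1)" using totient_prime_power[OF pa(1) r0] .
  also have "p ^ (r - 1) = p ^ (r - a) * p ^ (a - 1)" using ar pa by (simp add: power_add[symmetric])
  finally have "totient q = p ^ (r - a) * totient m * (p ^ (a - 1) * (p - 1))" by simp
  also have "p ^ (a - 1) * (p - 1) = totient e" using totient_prime_power[OF pa(1,2)] pa(3) by simp
  finally have "real (totient q) = real (p ^ (r - a)) * real (totient m) * real (totient e)"
    by (metis of_nat_mult)
  moreover have "real (totient e) \<noteq> 0" using e by simp
  moreover have "mangoldt e = ln (real p)" using pa by (simp add: mangoldt_primepow)
  ultimately show ?thesis using lhs by simp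
qed

text \<open>A prime power is divisible by exactly one prime, so the sum splits over the primes of
  \<open>q\<close> into instances of the previous lemma with \<open>e = p\<close>.\<close>

lemma sum_mangoldt_totient_all:
  assumes q: "q > 0"
  shows "(\<Sum>d | d dvd q. mangoldt d * real (totient (q div d))) =
           real (totient q) * (\<Sum>p\<in>prime_factors q. ln (real p) / (real p - 1))"
proof -
  have "(\<Sum>d | d dvd q. mangoldt d * real (totient (q div d))) =
     (\<Sum>d | d dvd q. \<Sum>p\<in>prime_factors q. if p dvd d then mangoldt d * real (totient (q div d)) else 0)"
  proof (intro sum.cong refl)
    fix d assume "d \<in> {d. d dvd q}"
    then have d: "d dvd q" by simp
    show "mangoldt d * real (totient (q div d)) =
        (\<Sum>p\<in>prime_factors q. if p dvd d then mangoldt d * real (totient (q div d)) else 0)"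
    proof (cases "primepow d")
      case True
      then obtain p k where pk: "prime p" "k > 0" "d = p ^ k" by (auto simp: primepow_def)
      have "p dvd d" using pk by (simp add: dvd_power)
      then have pq: "p \<in> prime_factors q" using dvd_trans[OF _ d] pk(1) q by (auto simp: in_prime_factors_iff)
      have "p' dvd d \<longleftrightarrow> p' = p" if "p' \<in> prime_factors q" for p'
        using that pk by (auto simp: in_prime_factors_iff prime_dvd_power_iff primes_dvd_imp_eq)
      then have "(\<Sum>p\<in>prime_factors q. if p dvd d then mangoldt d * real (totient (q div d)) else 0) =
          (\<Sum>p'\<in>prime_factors q. if p' = p then mangoldt d * real (totient (q div d)) else 0)"
        by (intro sum.cong) auto
      then show ?thesis using pq by simp
    next
      case False
      then have "mangoldt d = (0::real)" by (simp add: mangoldt_def)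
      then show ?thesis by (simp cong: if_cong)
    qed
  qed
  also have "\<dots> = (\<Sum>p\<in>prime_factors q. \<Sum>d | d dvd q. if p dvd d then mangoldt d * real (totient (q div d)) else 0)"
    by (rule sum.swap)
  also have "\<dots> = (\<Sum>p\<in>prime_factors q. real (totient q) * (ln (real p) / (real p - 1)))"
  proof (intro sum.cong refl)
    fix p assume "p \<in> prime_factors q"
    then have p: "prime p" "p dvd q" by (auto simp: in_prime_factors_iff)
    have "(\<Sum>d | d dvd q. if p dvd d then mangoldt d * real (totient (q div d)) else 0) =
        (\<Sum>d | d dvd q \<and> p dvd d. mangoldt d * real (totient (q div d)))"
      using q by (intro sum.mono_neutral_cong_right) auto
    also have "\<dots> = real (totient q) * mangoldt p / real (totient p)"
      using sum_mangoldt_totient[OF q p(2) prime_gt_1_nat[OF p(1)]] .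
    also have "\<dots> = real (totient q) * (ln (real p) / (real p - 1))"
      using p prime_gt_1_nat[OF p(1)] by (simp add: totient_prime of_nat_diff)
    finally show "(\<Sum>d | d dvd q. if p dvd d then mangoldt d * real (totient (q div d)) else 0) =
        real (totient q) * (ln (real p) / (real p - 1))" .
  qed
  finally show ?thesis by (simp add: sum_distrib_left)
qed

text \<open>For the conductor \<open>k\<close>, \<open>ln (q / k)\<close> is the sum of
  \<open>mangoldt d\<close> over the divisors of \<open>q / k\<close>, that is, over those
  \<open>d\<close> for which \<open>k\<close> divides \<open>q / d\<close>. In this form the
  conductor enters only through a divisibility condition, as in
  \<open>sum_characters_conductor_dvd\<close>.\<close>

lemma ln_conductor:
  assumes chi: "dirichlet_character q chi"
  shows "ln (real (conductor q chi)) =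
           ln (real q) - (\<Sum>d | d dvd q. if conductor q chi dvd q div d then mangoldt d else 0)"
proof -
  define k where "k = conductor q chi"
  have q: "q > 0" using dirichlet_characterD(1)[OF chi] .
  have k: "k > 0" "k dvd q" using conductor_props[OF chi] by (auto simp: k_def)
  then obtain j where j: "q = k * j" by blast
  then have j0: "j > 0" using q by (auto intro: Nat.gr0I)
  have iff: "d dvd q \<and> k dvd q div d \<longleftrightarrow> d dvd j" for d
  proof
    assume "d dvd q \<and> k dvd q div d"
    then obtain i where i: "q div d = k * i" and d: "d dvd q" by blast
    have "q = d * (k * i)" using i d by (metis dvd_mult_div_cancel)
    then have "j = d * i" using j k by simp
    then show "d dvd j" by simp
  next
    assume "d dvd j"
    then obtain i where i: "j = d * i" by blast
    then have "d > 0" using j0 by (auto intro: Nat.gr0I)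
    moreover have "q = d * (k * i)" using i j by simp
    ultimately show "d dvd q \<and> k dvd q div d" by simp
  qed
  have "(\<Sum>d | d dvd q. if k dvd q div d then mangoldt d else (0::real)) = (\<Sum>d | d dvd j. mangoldt d)"
    using q iff by (intro sum.mono_neutral_cong_right) auto
  also have "\<dots> = ln (real j)" using mangoldt_sum[of j, where ?'a = real] j0 by simp
  finally show ?thesis using j k j0 unfolding k_def[symmetric] by (simp add: ln_mult)
qed

text \<open>After interchanging the sums, \<open>d\<close> contributes
  \<open>mangoldt d * totient (q div d)\<close> exactly when \<open>c\<close> is 1 modulo
  \<open>q div d\<close>. This means that \<open>q / gcd(q, c - 1)\<close>, called \<open>e\<close>,
  divides \<open>d\<close>; the two cases of the result are \<open>e = 1\<close> and
  \<open>e > 1\<close>.\<close>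

lemma sum_characters_ln_conductor:
  assumes q: "q > 0" and c: "coprime c (int q)"
  shows "(\<Sum>chi\<in>dirichlet_characters q. chi c * of_real (ln (real (conductor q chi)))) =
    of_real (if [c = 1] (mod int q)
      then real (totient q) * (ln (real q) - (\<Sum>p\<in>prime_factors q. ln (real p) / (real p - 1)))
      else - (real (totient q) * mangoldt (q div nat (gcd (int q) (c - 1))) /
             real (totient (q div nat (gcd (int q) (c - 1))))))"
proof -
  define g where "g = nat (gcd (int q) (c - 1))"
  define e where "e = q div g"
  have g: "int g = gcd (int q) (c - 1)" by (simp add: g_def)
  then have gq: "g dvd q" by (metis gcd_dvd1 int_dvd_int_iff)
  have qe: "q = g * e" using gq by (simp add: e_def)
  have iff: "[c = 1] (mod int (q div d)) \<longleftrightarrow> e dvd d" if d: "d dvd q" for d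
  proof -
    obtain k where k: "q = d * k" using d by blast
    then have dk: "d > 0" "k > 0" using q by (auto intro: Nat.gr0I)
    then have "q div d = k" using k by simp
    then have "[c = 1] (mod int (q div d)) \<longleftrightarrow> int k dvd c - 1" by (simp add: cong_iff_dvd_diff)
    also have "\<dots> \<longleftrightarrow> int k dvd int g" unfolding g using k by simp
    also have "\<dots> \<longleftrightarrow> k dvd g" by simp
    also have "\<dots> \<longleftrightarrow> e dvd d"
    proof
      assume "k dvd g"
      then obtain j where "g = k * j" by blast
      then have "d = j * e" using k qe dk by simp
      then show "e dvd d" by simp
    next
      assume "e dvd d"
      then obtain j where j: "d = e * j" by blast
      have "e > 0" using q qe by (auto intro: Nat.gr0I)
      then have "g = k * j" using k qe j by simp
      then show "k dvd g" by simp
    qed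
    finally show ?thesis .
  qed
  let ?X = "dirichlet_characters q"
  have "(\<Sum>chi\<in>?X. chi c * of_real (ln (real (conductor q chi)))) =
     (\<Sum>chi\<in>?X. chi c * of_real (ln (real q)) -
        (\<Sum>d | d dvd q. if conductor q chi dvd q div d then of_real (mangoldt d) * chi c else 0))"
    by (intro sum.cong refl, subst ln_conductor)
       (auto simp: dirichlet_characters_def algebra_simps sum_distrib_left sum_distrib_right if_distrib cong: if_cong
        intro!: sum.cong)
  also have "\<dots> = of_real (ln (real q)) * (\<Sum>chi\<in>?X. chi c) -
       (\<Sum>d | d dvd q. of_real (mangoldt d) * (\<Sum>chi\<in>{chi\<in>?X. conductor q chi dvd q div d}. chi c))"
  proof -
    have "(\<Sum>chi\<in>?X. \<Sum>d | d dvd q. if conductor q chi dvd q div d then of_real (mangoldt d) * chi c else 0) =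
      (\<Sum>d | d dvd q. \<Sum>chi\<in>?X. if conductor q chi dvd q div d then of_real (mangoldt d) * chi c else 0)"
      by (rule sum.swap)
    also have "\<dots> = (\<Sum>d | d dvd q. of_real (mangoldt d) * (\<Sum>chi\<in>{chi\<in>?X. conductor q chi dvd q div d}. chi c))"
      by (intro sum.cong refl) (simp add: sum.inter_filter sum_distrib_left if_distrib cong: if_cong)
    finally show ?thesis by (simp add: sum_subtractf sum_distrib_left mult.commute)
  qed
  also have "(\<Sum>d | d dvd q. of_real (mangoldt d) * (\<Sum>chi\<in>{chi\<in>?X. conductor q chi dvd q div d}. chi c)) =
      (\<Sum>d | d dvd q. of_real (if e dvd d then mangoldt d * real (totient (q div d)) else 0))"
  proof (intro sum.cong refl)
    fix d assume "d \<in> {d. d dvd q}"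
    then have d: "d dvd q" by simp
    then have "q div d dvd q" by (metis dvd_mult_div_cancel dvd_triv_right)
    then show "of_real (mangoldt d) * (\<Sum>chi\<in>{chi\<in>?X. conductor q chi dvd q div d}. chi c) =
        complex_of_real (if e dvd d then mangoldt d * real (totient (q div d)) else 0)"
      using sum_characters_conductor_dvd[OF q _ c] iff[OF d] by simp
  qed
  also have "\<dots> = of_real (\<Sum>d | d dvd q. if e dvd d then mangoldt d * real (totient (q div d)) else 0)"
    by simp
  also have "(\<Sum>d | d dvd q. if e dvd d then mangoldt d * real (totient (q div d)) else 0) =
      (\<Sum>d | d dvd q \<and> e dvd d. mangoldt d * real (totient (q div d)))"
    using q by (intro sum.mono_neutral_cong_right) auto
  finally have main: "(\<Sum>chi\<in>?X. chi c * of_real (ln (real (conductor q chi)))) =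
    of_real (ln (real q)) * (\<Sum>chi\<in>?X. chi c) -
    of_real (\<Sum>d | d dvd q \<and> e dvd d. mangoldt d * real (totient (q div d)))" .
  have e1: "[c = 1] (mod int q) \<longleftrightarrow> e = 1" using iff[of 1] q by simp
  show ?thesis
  proof (cases "[c = 1] (mod int q)")
    case True
    then have "e = 1" using e1 by simp
    then show ?thesis
      using main sum_characters[OF q c] sum_mangoldt_totient_all[OF q] True
      by (simp add: algebra_simps)
  next
    case False
    then have "e > 1" using e1 q qe by (cases "e = 0") auto
    moreover have "e dvd q" using qe by simp
    ultimately have s: "(\<Sum>d | d dvd q \<and> e dvd d. mangoldt d * real (totient (q div d))) =
        real (totient q) * mangoldt e / real (totient e)"
      using sum_mangoldt_totient[OF q] by blast
    show ?thesis unfolding main s using sum_characters[OF q c] False by (simp add: e_def g_def)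
  qed
qed

subsection \<open>Dirichlet series\<close>

text \<open>The sum may start at 0: there \<open>0 powr s = 0\<close>, and division by zero gives
  0.\<close>

definition dser :: "(nat \<Rightarrow> complex) \<Rightarrow> complex \<Rightarrow> complex" where
  "dser c s = (\<Sum>n. c n / of_nat n powr s)"

text \<open>Absolute convergence at every real exponent above 1, a condition that survives
  multiplication of the coefficients by \<open>ln n\<close>.\<close>

definition dser_abs :: "(nat \<Rightarrow> complex) \<Rightarrow> bool" where
  "dser_abs c \<longleftrightarrow> (\<forall>r>1. summable (\<lambda>n. norm (c n) / real n powr r))"

lemma norm_dser_term: "norm (c / of_nat n powr s) = norm c / real n powr Re s"
  by (simp add: norm_divide norm_powr_real_powr)

lemma dser_abs_summable:
  assumes "dser_abs c" "Re s > 1"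
  shows "summable (\<lambda>n. norm (c n / of_nat n powr s))"
  using assms unfolding dser_abs_def norm_dser_term by blast

lemma dser_sums:
  assumes "dser_abs c" "Re s > 1"
  shows "(\<lambda>n. c n / of_nat n powr s) sums dser c s"
  unfolding dser_def using summable_norm_cancel[OF dser_abs_summable[OF assms]] by (rule summable_sums)

lemma dser_abs_comparison:
  assumes "dser_abs b" "\<And>n. norm (c n) \<le> K * norm (b n)"
  shows "dser_abs c"
  unfolding dser_abs_def
proof (intro allI impI)
  fix r :: real assume "r > 1"
  then have "summable (\<lambda>n. K * (norm (b n) / real n powr r))"
    using assms(1) unfolding dser_abs_def by (intro summable_mult) blast
  then show "summable (\<lambda>n. norm (c n) / real n powr r)"
  proof (rule summable_comparison_test'[where N = 0])
    show "norm (norm (c n) / real n powr r) \<le> K * (norm (b n) / real n powr r)" for n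
      using divide_right_mono[OF assms(2)[of n], of "real n powr r"] by simp
  qed
qed

lemma dser_abs_bounded:
  assumes "\<And>n. norm (c n) \<le> 1"
  shows "dser_abs c"
proof (rule dser_abs_comparison)
  have "summable (\<lambda>n. real n powr - r)" if "r > 1" for r using that by (subst summable_real_powr_iff) auto
  then show "dser_abs (\<lambda>_. 1)" unfolding dser_abs_def by (simp add: powr_minus divide_inverse)
  show "norm (c n) \<le> 1 * norm (1::complex)" for n using assms by simp
qed

text \<open>Half of the room above 1 pays for the logarithm: \<open>ln n \<le> n powr e / e\<close>
  with \<open>e = (r - 1) / 2\<close>.\<close>

lemma dser_abs_ln:
  assumes "dser_abs c"
  shows "dser_abs (\<lambda>n. c n * of_real (ln (real n)))"
  unfolding dser_abs_def
proof (intro allI impI)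
  fix r :: real assume r: "r > 1"
  define e where "e = (r - 1) / 2"
  have e: "e > 0" "r - e > 1" using r by (auto simp: e_def field_simps)
  have "summable (\<lambda>n. 1 / e * (norm (c n) / real n powr (r - e)))"
    using assms e unfolding dser_abs_def by (intro summable_mult) blast
  then show "summable (\<lambda>n. norm (c n * of_real (ln (real n))) / real n powr r)"
  proof (rule summable_comparison_test'[where N = 1])
    fix n :: nat assume n: "n \<ge> 1"
    have "ln (real n) \<le> real n powr e / e" using n e by (intro ln_powr_bound) auto
    then have "norm (c n) * ln (real n) \<le> norm (c n) * (real n powr e / e)" by (intro mult_left_mono) auto
    then have "norm (c n) * ln (real n) / real n powr r \<le> norm (c n) * (real n powr e / e) / real n powr r"
      by (intro divide_right_mono) auto
    also have "\<dots> = 1 / e * (norm (c n) / real n powr (r - e))"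
      using n by (simp add: powr_diff)
    finally show "norm (norm (c n * of_real (ln (real n))) / real n powr r) \<le> 1 / e * (norm (c n) / real n powr (r - e))"
      using n by (simp add: norm_mult)
  qed
qed

lemma has_field_derivative_dser:
  assumes c: "dser_abs c" and s: "Re s > 1"
  shows "(dser c has_field_derivative - dser (\<lambda>n. c n * of_real (ln (real n))) s) (at s)"
proof -
  define S where "S = {s. Re s > 1}"
  have S: "open S" unfolding S_def by (rule open_halfspace_Re_gt)
  define f where "f n s = c n / of_nat n powr s" for n s
  define f' where "f' n s = - (c n * of_real (ln (real n)) / of_nat n powr s)" for n s
  have "\<exists>g g'. \<forall>x\<in>S. ((\<lambda>n. f n x) sums g x) \<and> ((\<lambda>n. f' n x) sums g' x) \<and> (g has_field_derivative g' x) (at x)"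
  proof (rule series_and_derivative_comparison_complex[OF S])
    show "(f n has_field_derivative f' n x) (at x)" for n x
    proof (cases "n = 0")
      case True
      then show ?thesis unfolding f_def[abs_def] f'_def by simp
    next
      case False
      then have L: "Ln (of_nat n) = of_real (ln (real n))" by (simp add: Ln_of_nat)
      from False have eq: "f n = (\<lambda>s. c n * exp (- (s * of_real (ln (real n)))))"
        by (auto simp: f_def powr_def L exp_minus divide_inverse fun_eq_iff)
      show ?thesis unfolding eq
        by (auto intro!: derivative_eq_intros simp: f'_def powr_def L exp_minus divide_inverse False mult_ac)
    qed
    fix x assume x: "x \<in> S"
    \<comment> \<open>Points within \<open>d\<close> of \<open>x\<close> have real part at least
      \<open>1 + d\<close>, so one majorant serves the whole ball.\<close>
    define d where "d = (Re x - 1) / 2"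
    have d: "d > 0" using x by (simp add: d_def S_def)
    define h where "h n = norm (c n) / real n powr (1 + d)" for n
    have "summable h" using c d unfolding dser_abs_def h_def by simp
    then have "summable (\<lambda>n. complex_of_real (h n))" by (simp add: summable_of_real)
    moreover have "range (\<lambda>n. complex_of_real (h n)) \<subseteq> \<real>\<^sub>\<ge>\<^sub>0" by (auto simp: h_def)
    moreover have "norm (f n y) \<le> norm (complex_of_real (h n))" if "n \<ge> 1" "y \<in> ball x d \<inter> S" for n y
    proof -
      have "\<bar>Re (x - y)\<bar> < d" using that abs_Re_le_cmod[of "x - y"] by (auto simp: dist_norm)
      then have "Re x - Re y < d" by simp
      then have "1 + d \<le> Re y" by (simp add: d_def field_simps)
      then have "real n powr (1 + d) \<le> real n powr Re y" using that by (intro powr_mono) auto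
      then have "norm (c n) / real n powr Re y \<le> h n" unfolding h_def using that(1)
        by (intro divide_left_mono) auto
      moreover have "norm (complex_of_real (h n)) = h n" by (simp only: norm_of_real) (simp add: h_def)
      ultimately show ?thesis unfolding f_def norm_dser_term by linarith
    qed
    ultimately show "\<exists>d h. 0 < d \<and> summable h \<and> range h \<subseteq> \<real>\<^sub>\<ge>\<^sub>0 \<and>
        (\<forall>\<^sub>F n in sequentially. \<forall>y\<in>ball x d \<inter> S. cmod (f n y) \<le> cmod (h n))"
      using d eventually_sequentiallyI[of 1 "\<lambda>n. \<forall>y\<in>ball x d \<inter> S. cmod (f n y) \<le> cmod (complex_of_real (h n))"] by blast
  qed
  then obtain g g' where g: "\<And>x. x \<in> S \<Longrightarrow> (\<lambda>n. f n x) sums g x" "\<And>x. x \<in> S \<Longrightarrow> (\<lambda>n. f' n x) sums g' x"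
    "\<And>x. x \<in> S \<Longrightarrow> (g has_field_derivative g' x) (at x)" by blast
  have sS: "s \<in> S" using s by (simp add: S_def)
  have "(dser c has_field_derivative g' s) (at s)"
  proof (rule has_field_derivative_transform_within_open[OF g(3)[OF sS] S sS])
    show "g x = dser c x" if "x \<in> S" for x
      using sums_unique[OF g(1)[OF that]] by (simp add: dser_def f_def)
  qed
  also have "g' s = - dser (\<lambda>n. c n * of_real (ln (real n))) s"
  proof -
    have "(\<lambda>n. f' n s) sums (- dser (\<lambda>n. c n * of_real (ln (real n))) s)"
      unfolding f'_def by (intro sums_minus dser_sums dser_abs_ln c s)
    then show ?thesis using g(2)[OF sS] sums_unique2 by blast
  qed
  finally show ?thesis .
qed

lemma dser_holomorphic: "dser_abs c \<Longrightarrow> dser c holomorphic_on {s. Re s > 1}"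
  using has_field_derivative_dser unfolding holomorphic_on_def field_differentiable_def
  by (blast intro: has_field_derivative_at_within)

lemma higher_deriv_dser:
  assumes "dser_abs c" "Re s > 1"
  shows "(deriv ^^ k) (dser c) s = (-1) ^ k * dser (\<lambda>n. c n * of_real (ln (real n)) ^ k) s"
    and "dser_abs (\<lambda>n. c n * of_real (ln (real n)) ^ k)"
proof -
  have abs: "dser_abs (\<lambda>n. c n * of_real (ln (real n)) ^ k)" for k
  proof (induction k)
    case (Suc k)
    from dser_abs_ln[OF this] show ?case by (simp add: mult_ac)
  qed (use assms in simp)
  then show "dser_abs (\<lambda>n. c n * of_real (ln (real n)) ^ k)" .
  show "(deriv ^^ k) (dser c) s = (-1) ^ k * dser (\<lambda>n. c n * of_real (ln (real n)) ^ k) s"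
    using assms(2)
  proof (induction k arbitrary: s)
    case (Suc k)
    have "\<forall>\<^sub>F z in nhds s. (deriv ^^ k) (dser c) z = (-1) ^ k * dser (\<lambda>n. c n * of_real (ln (real n)) ^ k) z"
      using eventually_nhds_in_open[OF open_halfspace_Re_gt, of s 1] Suc.prems
      by (auto elim!: eventually_mono intro: Suc.IH)
    then have "(deriv ^^ Suc k) (dser c) s = deriv (\<lambda>z. (-1) ^ k * dser (\<lambda>n. c n * of_real (ln (real n)) ^ k) z) s"
      by (simp add: deriv_cong_ev)
    also have "\<dots> = (-1) ^ k * (- dser (\<lambda>n. c n * of_real (ln (real n)) ^ k * of_real (ln (real n))) s)"
      by (intro DERIV_imp_deriv DERIV_cmult has_field_derivative_dser abs Suc.prems)
    finally show ?case by (simp add: mult_ac)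
  qed simp
qed

lemma dser_nonneg:
  assumes "dser_abs c" "r > 1" "\<And>n. c n \<in> \<real>\<^sub>\<ge>\<^sub>0"
  shows "dser c (of_real r) \<in> \<real>\<^sub>\<ge>\<^sub>0"
proof -
  have t: "c n / of_nat n powr of_real r = of_real (Re (c n) / real n powr r)" for n
  proof -
    have "of_nat n powr complex_of_real r = of_real (real n powr r)"
      using powr_of_real[of "real n" r] by simp
    then show ?thesis using assms(3)[of n] by (simp add: complex_nonneg_Reals_iff complex_eq_iff)
  qed
  have "summable (\<lambda>n. complex_of_real (Re (c n) / real n powr r))"
    using sums_summable[OF dser_sums[OF assms(1), of "of_real r"]] assms(2) unfolding t by simp
  then have sm: "summable (\<lambda>n. Re (c n) / real n powr r)" by (rule summable_of_real_iff[THEN iffD1])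
  have "dser c (of_real r) = of_real (\<Sum>n. Re (c n) / real n powr r)"
    unfolding dser_def t by (rule suminf_of_real[OF sm, symmetric])
  moreover have "(\<Sum>n. Re (c n) / real n powr r) \<ge> 0"
    using assms(3) by (intro suminf_nonneg sm) (auto simp: complex_nonneg_Reals_iff)
  ultimately show ?thesis by simp
qed

text \<open>The product is an absolutely convergent double sum over positive integers, regrouped by
  the product of the indices.\<close>

lemma dser_mult:
  assumes c: "dser_abs c" and b: "dser_abs b" and s: "Re s > 1"
    and e: "\<And>n. n > 0 \<Longrightarrow> e n = (\<Sum>d | d dvd n. c d * b (n div d))" and e': "dser_abs e"
  shows "dser c s * dser b s = dser e s"
proof -
  \<comment> \<open>Index 0 is left out: its terms vanish, and its set of divisors is
    infinite.\<close>
  define P where "P = {0::nat<..}"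
  define f where "f c n = c n / of_nat n powr s" for c :: "nat \<Rightarrow> complex" and n :: nat
  have hs: "(f c has_sum dser c s) P" and ab: "(\<lambda>n. norm (f c n)) summable_on P" if "dser_abs c" for c
  proof -
    have "(f c has_sum dser c s) UNIV"
      unfolding f_def by (rule norm_summable_imp_has_sum[OF dser_abs_summable[OF that s] dser_sums[OF that s]])
    then show "(f c has_sum dser c s) P"
      by (rule has_sum_cong_neutral[THEN iffD1, rotated -1]) (auto simp: P_def f_def)
    have "(\<lambda>n. norm (f c n)) summable_on UNIV"
      using dser_abs_summable[OF that s] unfolding f_def by (intro norm_summable_imp_summable_on) simp
    then show "(\<lambda>n. norm (f c n)) summable_on P" by (rule summable_on_subset_banach) simp
  qed
  define F where "F p = f c (fst p) * f b (snd p)" for p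
  have "(\<lambda>p. norm (F p)) summable_on (P \<times> P)"
  proof (rule Infinite_Sum.abs_summable_on_Sigma_iff[THEN iffD2, OF conjI])
    show "\<forall>x\<in>P. (\<lambda>y. norm (F (x, y))) summable_on P"
      unfolding F_def using ab[OF b] by (auto simp: norm_mult intro!: summable_on_cmult_right)
    have "(\<lambda>x. norm (f c x) * (\<Sum>\<^sub>\<infinity>y\<in>P. norm (f b y))) summable_on P"
      by (intro summable_on_cmult_left ab[OF c])
    then show "(\<lambda>x. norm (\<Sum>\<^sub>\<infinity>y\<in>P. norm (F (x, y)))) summable_on P"
      by (simp add: F_def norm_mult infsum_cmult_right' infsum_nonneg abs_mult)
  qed
  then have FP: "F summable_on (P \<times> P)" by (rule abs_summable_summable)
  have "(\<Sum>\<^sub>\<infinity>p\<in>P \<times> P. F p) = (\<Sum>\<^sub>\<infinity>x\<in>P. \<Sum>\<^sub>\<infinity>y\<in>P. F (x, y))"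
    using infsum_Sigma'_banach[of "\<lambda>x y. F (x, y)" P "\<lambda>_. P"] FP by simp
  also have "\<dots> = (\<Sum>\<^sub>\<infinity>x\<in>P. f c x * dser b s)"
    unfolding F_def using infsumI[OF hs[OF b]] by (simp add: infsum_cmult_right')
  also have "\<dots> = dser c s * dser b s"
    using infsumI[OF hs[OF c]] by (simp add: infsum_cmult_left')
  finally have 1: "(\<Sum>\<^sub>\<infinity>p\<in>P \<times> P. F p) = dser c s * dser b s" .
  define Q where "Q = Sigma P (\<lambda>n. {d. d dvd n})"
  define h where "h p = (fst p * snd p, fst p)" for p :: "nat \<times> nat"
  have bij: "bij_betw h (P \<times> P) Q"
    by (rule bij_betw_byWitness[where f' = "\<lambda>(n, d). (d, n div d)"])
       (auto simp: h_def P_def Q_def elim!: dvdE)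
  define G where "G n d = f c d * f b (n div d)" for n d
  have Fh: "F p = (case h p of (n, d) \<Rightarrow> G n d)" if "p \<in> P \<times> P" for p
    using that by (auto simp: F_def h_def G_def P_def)
  have "(\<Sum>\<^sub>\<infinity>p\<in>P \<times> P. F p) = (\<Sum>\<^sub>\<infinity>p\<in>P \<times> P. case h p of (n, d) \<Rightarrow> G n d)"
    using Fh by (rule infsum_cong)
  also have "\<dots> = (\<Sum>\<^sub>\<infinity>(n, d)\<in>Q. G n d)" by (rule infsum_reindex_bij_betw[OF bij])
  also have "\<dots> = (\<Sum>\<^sub>\<infinity>n\<in>P. \<Sum>\<^sub>\<infinity>d\<in>{d. d dvd n}. G n d)"
    unfolding Q_def
  proof (rule infsum_Sigma'_banach[symmetric])
    have "(\<lambda>p. case h p of (n, d) \<Rightarrow> G n d) summable_on (P \<times> P)"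
      using FP Fh summable_on_cong by metis
    then show "(\<lambda>(n, d). G n d) summable_on Sigma P (\<lambda>n. {d. d dvd n})"
      using summable_on_reindex_bij_betw[OF bij, of "\<lambda>(n, d). G n d"] by (simp add: Q_def)
  qed
  also have "\<dots> = (\<Sum>\<^sub>\<infinity>n\<in>P. f e n)"
  proof (rule infsum_cong)
    fix n assume "n \<in> P"
    then have n: "n > 0" by (simp add: P_def)
    have "G n d = (c d * b (n div d)) / of_nat n powr s" if dn: "d dvd n" for d
    proof -
      obtain m where m: "n = d * m" using dn by blast
      then have "of_nat n powr s = of_nat d powr s * complex_of_nat m powr s"
        by (simp add: powr_times_real)
      moreover have "n div d = m" using m n by simp
      ultimately show ?thesis by (simp add: G_def f_def)
    qed
    then have "(\<Sum>\<^sub>\<infinity>d\<in>{d. d dvd n}. G n d) = (\<Sum>d | d dvd n. (c d * b (n div d)) / of_nat n powr s)"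
      using n by (subst infsum_finite) (auto intro!: sum.cong)
    also have "\<dots> = f e n" using e[OF n] by (simp add: f_def sum_divide_distrib)
    finally show "(\<Sum>\<^sub>\<infinity>d\<in>{d. d dvd n}. G n d) = f e n" .
  qed
  also have "\<dots> = dser e s" using infsumI[OF hs[OF e']] .
  finally show ?thesis using 1 by simp
qed

subsection \<open>Completely multiplicative coefficients\<close>

text \<open>The common pattern of characters, their twists by imaginary powers of \<open>n\<close>,
  and the conjugates of these; logarithmic derivative and nonvanishing are proved for all of them at
  once.\<close>

definition cmultiplicative :: "(nat \<Rightarrow> complex) \<Rightarrow> bool" where
  "cmultiplicative c \<longleftrightarrow> c 1 = 1 \<and> (\<forall>m n. c (m * n) = c m * c n) \<and> (\<forall>n. norm (c n) \<le> 1)"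

lemma cmultiplicativeD:
  assumes "cmultiplicative c"
  shows "c (Suc 0) = 1" "c (m * n) = c m * c n" "norm (c n) \<le> 1" "dser_abs c"
  using assms dser_abs_bounded[of c] unfolding cmultiplicative_def by auto

lemma dser_abs_mangoldt:
  assumes "\<And>n. norm (c n) \<le> 1"
  shows "dser_abs (\<lambda>n. c n * mangoldt n)"
proof (rule dser_abs_comparison[OF dser_abs_ln[OF dser_abs_bounded[of "\<lambda>_. 1"]]])
  fix n
  have "norm (c n) * mangoldt n \<le> 1 * mangoldt n" using assms by (intro mult_right_mono mangoldt_nonneg)
  moreover have "mangoldt n \<le> \<bar>ln (real n)\<bar>"
    using mangoldt_le[of n] by (cases "n = 0") auto
  ultimately show "norm (c n * mangoldt n) \<le> 1 * norm (1 * complex_of_real (ln (real n)))"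
    by (simp add: norm_mult)
qed simp

text \<open>By complete multiplicativity \<open>c n\<close> factors out of the convolution of
  \<open>c d * mangoldt d\<close> with \<open>c\<close>, and the divisor sum that remains is
  \<open>ln n\<close>.\<close>

lemma has_field_derivative_dser_cmultiplicative:
  assumes c: "cmultiplicative c" and s: "Re s > 1"
  shows "(dser c has_field_derivative - (dser c s * dser (\<lambda>n. c n * mangoldt n) s)) (at s)"
proof -
  note D = cmultiplicativeD[OF c]
  have "dser (\<lambda>n. c n * mangoldt n) s * dser c s = dser (\<lambda>n. c n * of_real (ln (real n))) s"
  proof (rule dser_mult[OF dser_abs_mangoldt[OF D(3)] D(4) s _ dser_abs_ln[OF D(4)]])
    fix n :: nat assume n: "n > 0"
    have "(\<Sum>d | d dvd n. c d * mangoldt d * c (n div d)) = (\<Sum>d | d dvd n. c n * mangoldt d)"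
    proof (intro sum.cong refl)
      fix d assume "d \<in> {d. d dvd n}"
      then have "c n = c d * c (n div d)" using D(2)[of d "n div d"] by simp
      then show "c d * mangoldt d * c (n div d) = c n * mangoldt d" by (simp add: mult_ac)
    qed
    also have "\<dots> = c n * of_real (ln (real n))"
      using mangoldt_sum[of n, where ?'a = complex] n by (simp add: sum_distrib_left[symmetric])
    finally show "c n * of_real (ln (real n)) = (\<Sum>d | d dvd n. c d * mangoldt d * c (n div d))" by simp
  qed
  then show ?thesis using has_field_derivative_dser[OF D(4) s] by (simp add: mult.commute)
qed

text \<open>The terms beyond the first have total size at most 1/2. This is the base point for the
  next lemma.\<close>

lemma dser_cmultiplicative_3_nonzero:
  assumes c: "cmultiplicative c"
  shows "dser c 3 \<noteq> 0"
proof
  note D = cmultiplicativeD[OF c]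
  define f where "f n = c n / of_nat n powr 3" for n
  assume z: "dser c 3 = 0"
  have f: "f sums 0" using dser_sums[OF D(4), of 3] z by (simp add: f_def[abs_def])
  have f01: "f 0 = 0" "f (Suc 0) = 1" using D(1) by (auto simp: f_def)
  have f2: "(\<lambda>n. f (n + 2)) sums (-1)"
    using f sums_iff_shift[of f 2 "-1"] f01 by (simp add: numeral_2_eq_2)
  \<comment> \<open>The majorant is \<open>1 / (2 * (n + 1) * (n + 2))\<close>, which telescopes to
    1/2 and dominates \<open>1 / (n + 2) ^ 3\<close>.\<close>
  have tel: "(\<lambda>n. 1/2 * (1 / (real n + 1) - 1 / (real (Suc n) + 1))) sums (1/2 * (1 / (real 0 + 1) - 0))"
    by (intro sums_mult telescope_sums') real_asymp
  have nf: "norm (f (n + 2)) \<le> 1/2 * (1 / (real n + 1) - 1 / (real (Suc n) + 1))" for n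
  proof -
    define x where "x = real n"
    have x: "x \<ge> 0" by (simp add: x_def)
    have "norm (f (n + 2)) \<le> 1 / (x + 2) ^ 3"
      unfolding f_def norm_dser_term using D(3)[of "n + 2"] powr_realpow[of "x + 2" 3] x
      by (simp add: divide_right_mono x_def add.commute)
    also have "\<dots> \<le> 1 / (2 * ((x + 1) * (x + 2)))"
    proof (rule divide_left_mono)
      have "2 * (x + 1) \<le> (x + 2) ^ 2" using x by (simp add: power2_eq_square algebra_simps)
      then have "2 * (x + 1) * (x + 2) \<le> (x + 2) ^ 2 * (x + 2)" using x by (intro mult_right_mono) auto
      moreover have "2 * ((x + 1) * (x + 2)) = 2 * (x + 1) * (x + 2)" by (simp only: mult.assoc)
      moreover have "(x + 2) ^ 3 = (x + 2) ^ 2 * (x + 2)" by (simp add: power3_eq_cube power2_eq_square)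
      ultimately show "2 * ((x + 1) * (x + 2)) \<le> (x + 2) ^ 3" by (simp only:)
    qed (use x in auto)
    also have "\<dots> = 1/2 * (1 / (real n + 1) - 1 / (real (Suc n) + 1))"
      using x by (simp add: x_def[symmetric] field_simps)
    finally show ?thesis .
  qed
  have sm: "summable (\<lambda>n. norm (f (n + 2)))"
    using nf by (intro summable_comparison_test'[OF sums_summable[OF tel], of 0]) auto
  have "norm (\<Sum>n. f (n + 2)) \<le> (\<Sum>n. norm (f (n + 2)))" by (rule summable_norm[OF sm])
  also have "\<dots> \<le> (\<Sum>n. 1/2 * (1 / (real n + 1) - 1 / (real (Suc n) + 1)))"
    by (rule suminf_le[OF nf sm sums_summable[OF tel]])
  also have "\<dots> = 1/2" using sums_unique[OF tel] by simp
  finally have "norm (\<Sum>n. f (n + 2)) \<le> 1/2" .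
  moreover have "(\<Sum>n. f (n + 2)) = -1" using sums_unique[OF f2] by (rule sym)
  ultimately show False by simp
qed

text \<open>In place of an Euler product: if \<open>G\<close> is a primitive of the series of
  \<open>c n * mangoldt n\<close>, then \<open>dser c s * exp (G s)\<close> has derivative zero on a
  convex set. It is a constant, nonzero by its value at 3.\<close>

lemma dser_cmultiplicative_nonzero:
  assumes c: "cmultiplicative c" and s: "Re s > 1"
  shows "dser c s \<noteq> 0"
proof -
  note D = cmultiplicativeD[OF c]
  define S where "S = {s. Re s > 1}"
  have S: "open S" "convex S" unfolding S_def by (auto intro: open_halfspace_Re_gt convex_halfspace_Re_gt)
  define H where "H = dser (\<lambda>n. c n * mangoldt n)"
  have "H holomorphic_on S" unfolding H_def S_def by (rule dser_holomorphic[OF dser_abs_mangoldt[OF D(3)]])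
  then obtain G where G: "\<And>x. x \<in> S \<Longrightarrow> (G has_field_derivative H x) (at x within S)"
    using holomorphic_convex_primitive'[OF S(2,1), of H] by blast
  have "((\<lambda>s. dser c s * exp (G s)) has_field_derivative 0) (at x within S)" if x: "x \<in> S" for x
  proof -
    have 1: "(dser c has_field_derivative - (dser c x * H x)) (at x within S)"
      using has_field_derivative_dser_cmultiplicative[OF c, of x] x
      by (auto simp: S_def H_def intro: has_field_derivative_at_within)
    have 2: "((\<lambda>s. exp (G s)) has_field_derivative exp (G x) * H x) (at x within S)"
      by (rule DERIV_chain2[OF DERIV_exp G[OF x]])
    show ?thesis using DERIV_mult[OF 1 2] by (simp add: mult_ac)
  qed
  then obtain k where k: "\<And>x. x \<in> S \<Longrightarrow> dser c x * exp (G x) = k"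
    using has_field_derivative_zero_constant[OF S(2), of "\<lambda>s. dser c s * exp (G s)"] by blast
  have "3 \<in> S" by (simp add: S_def)
  then have "k \<noteq> 0" using k[of 3] dser_cmultiplicative_3_nonzero[OF c] by auto
  then show ?thesis using k[of s] s by (auto simp: S_def)
qed

text \<open>By complete multiplicativity the multiples of \<open>p\<close> contribute
  \<open>c p / p powr s\<close> times the whole series.\<close>

lemma dser_remove_prime:
  assumes c: "cmultiplicative c" and p: "prime p" and s: "Re s > 1"
  shows "dser (\<lambda>n. if p dvd n then 0 else c n) s = (1 - c p / of_nat p powr s) * dser c s"
    and "cmultiplicative (\<lambda>n. if p dvd n then 0 else c n)"
proof -
  note D = cmultiplicativeD[OF c]
  show cm: "cmultiplicative (\<lambda>n. if p dvd n then 0 else c n)"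
    using c p unfolding cmultiplicative_def by (auto simp: prime_dvd_mult_iff)
  define f where "f n = c n / of_nat n powr s" for n
  have f: "f sums dser c s" unfolding f_def by (rule dser_sums[OF D(4) s])
  have p0: "p > 0" using p prime_gt_0_nat by blast
  have "f (p * m) = c p / of_nat p powr s * f m" for m
    by (simp add: f_def D(2) powr_times_real)
  then have "(\<lambda>m. f (p * m)) sums (c p / of_nat p powr s * dser c s)"
    using sums_mult[OF f, of "c p / of_nat p powr s"] by simp
  then have "(\<lambda>m. (if p dvd p * m then f (p * m) else 0)) sums (c p / of_nat p powr s * dser c s)" by simp
  then have "(\<lambda>n. if p dvd n then f n else 0) sums (c p / of_nat p powr s * dser c s)"
  proof (subst (asm) sums_mono_reindex[where g = "\<lambda>m. p * m"])
    show "strict_mono ((*) p)" using p0 by (simp add: strict_mono_def)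
    show "(if p dvd n then f n else 0) = 0" if "n \<notin> range ((*) p)" for n using that by (auto simp: dvd_def)
  qed
  from sums_diff[OF f this]
  have "(\<lambda>n. (if p dvd n then 0 else c n) / of_nat n powr s) sums (dser c s - c p / of_nat p powr s * dser c s)"
    by (rule sums_cong[THEN iffD1, rotated]) (auto simp: f_def)
  then show "dser (\<lambda>n. if p dvd n then 0 else c n) s = (1 - c p / of_nat p powr s) * dser c s"
    unfolding dser_def by (simp add: sums_iff algebra_simps)
qed

lemma dser_remove_primes:
  assumes "finite A" and "cmultiplicative c" and s: "Re s > 1" and "\<And>p. p \<in> A \<Longrightarrow> prime p"
  shows "dser (\<lambda>n. if \<exists>p\<in>A. p dvd n then 0 else c n) s = (\<Prod>p\<in>A. 1 - c p / of_nat p powr s) * dser c s \<and>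
         cmultiplicative (\<lambda>n. if \<exists>p\<in>A. p dvd n then 0 else c n)"
  using assms(1,4)
proof (induction A rule: finite_induct)
  case empty
  then show ?case using assms(2) by simp
next
  case (insert p A)
  define b where "b n = (if \<exists>p\<in>A. p dvd n then 0 else c n)" for n
  have IH: "dser b s = (\<Prod>p\<in>A. 1 - c p / of_nat p powr s) * dser c s" "cmultiplicative b"
    using insert by (auto simp: b_def[abs_def])
  have p: "prime p" using insert by auto
  have "\<not> r dvd p" if "r \<in> A" for r
    using primes_dvd_imp_eq[of r p] insert that p by auto
  then have "b p = c p" by (auto simp: b_def)
  moreover have "(\<lambda>n. if p dvd n then 0 else b n) = (\<lambda>n. if \<exists>p\<in>insert p A. p dvd n then 0 else c n)"
    by (auto simp: b_def fun_eq_iff)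
  ultimately show ?case
    using dser_remove_prime[OF IH(2) p s] IH(1) insert by (simp add: mult.assoc)
qed

subsection \<open>The pole of the zeta function\<close>

text \<open>With \<open>N = Suc n\<close>, this is \<open>s - 1\<close> times the difference between
  \<open>N powr (- s)\<close> and the integral of \<open>x powr (- s)\<close> from \<open>N\<close>
  to \<open>N + 1\<close>; the factor clears the denominator of that integral.\<close>

definition zeta_term :: "nat \<Rightarrow> complex \<Rightarrow> complex" where
  "zeta_term n s = (s - 1) * of_nat (Suc n) powr (- s) - of_nat (Suc n) powr (1 - s) + of_nat (Suc (Suc n)) powr (1 - s)"

text \<open>The function \<open>(s - 1) \<zeta>(s)\<close>, continued to \<open>Re s > 0\<close>.\<close>

definition zeta_reg :: "complex \<Rightarrow> complex" where
  "zeta_reg s = 1 + (\<Sum>n. zeta_term n s)"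

lemma has_field_derivative_powr_of_real:
  assumes "x > 0"
  shows "((\<lambda>x. complex_of_real x powr s) has_vector_derivative s * of_real x powr (s - 1)) (at x)"
proof -
  have "((\<lambda>z. z powr s) has_field_derivative s * of_real x powr (s - 1)) (at (complex_of_real x))"
    using assms by (intro has_field_derivative_powr) (auto simp: complex_nonpos_Reals_iff)
  then show ?thesis by (rule has_vector_derivative_real_field)
qed

lemma vector_derivative_bound:
  fixes f :: "real \<Rightarrow> complex"
  assumes "convex S" "\<And>y. y \<in> S \<Longrightarrow> (f has_vector_derivative f' y) (at y within S)"
    "\<And>y. y \<in> S \<Longrightarrow> norm (f' y) \<le> B" "u \<in> S" "v \<in> S"
  shows "norm (f u - f v) \<le> B * norm (u - v)"
proof (rule differentiable_bound[OF assms(1)])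
  show "(f has_derivative (\<lambda>h. h *\<^sub>R f' y)) (at y within S)" if "y \<in> S" for y
    using assms(2)[OF that] by (simp add: has_vector_derivative_def)
  show "onorm (\<lambda>h. h *\<^sub>R f' y) \<le> B" if "y \<in> S" for y
    using assms(3)[OF that] by (intro onorm_le) (simp add: mult.commute[of B] mult_left_mono)
qed (use assms in auto)

lemma norm_powr_diff_le:
  assumes x: "1 \<le> n" "n \<le> x" and s: "Re s > 0"
  shows "norm (complex_of_real x powr (- s) - of_real n powr (- s)) \<le> norm s * n powr (- Re s - 1) * (x - n)"
proof -
  have "norm (complex_of_real x powr (- s) - of_real n powr (- s)) \<le> (norm s * n powr (- Re s - 1)) * norm (x - n)"
  proof (rule vector_derivative_bound[where S = "{n..x}"])
    fix y assume y: "y \<in> {n..x}"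
    show "((\<lambda>x. complex_of_real x powr (- s)) has_vector_derivative - s * of_real y powr (- s - 1)) (at y within {n..x})"
      using has_field_derivative_powr_of_real[of y "- s"] y x by (auto intro: has_vector_derivative_at_within)
    have "norm (complex_of_real y powr (- s - 1)) = y powr (- Re s - 1)"
      using y x by (subst norm_powr_real_powr) auto
    also have "\<dots> \<le> n powr (- Re s - 1)" using y x s by (intro powr_mono2') auto
    finally show "norm (- s * complex_of_real y powr (- s - 1)) \<le> norm s * n powr (- Re s - 1)"
      by (simp add: norm_mult mult_left_mono)
  qed (use x in auto)
  then show ?thesis using x by simp
qed

text \<open>The term is an increment of \<open>G\<close>, whose derivative vanishes at the left end
  \<open>a\<close>. This gains a further factor of order \<open>1 / a\<close>, and with it
  convergence for \<open>Re s > 0\<close>.\<close>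

lemma norm_zeta_term_le:
  assumes s: "Re s > 0"
  shows "norm (zeta_term n s) \<le> norm (s - 1) * norm s * real (Suc n) powr (- Re s - 1)"
proof -
  define a where "a = real (Suc n)"
  define G where "G x = complex_of_real x powr (1 - s) + (s - 1) * of_real a powr (- s) * of_real x" for x
  have a: "a \<ge> 1" by (simp add: a_def)
  have "norm (G (a + 1) - G a) \<le> (norm (s - 1) * (norm s * a powr (- Re s - 1))) * norm (a + 1 - a)"
  proof (rule vector_derivative_bound[where S = "{a..a + 1}"])
    fix y assume y: "y \<in> {a..a + 1}"
    have "((\<lambda>x. complex_of_real x powr (1 - s)) has_vector_derivative (1 - s) * of_real y powr (1 - s - 1)) (at y within {a..a + 1})"
      using has_field_derivative_powr_of_real[of y "1 - s"] y a by (auto intro: has_vector_derivative_at_within)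
    then have "(G has_vector_derivative (1 - s) * of_real y powr (1 - s - 1) + (s - 1) * of_real a powr (- s) * 1) (at y within {a..a + 1})"
      unfolding G_def by (intro has_vector_derivative_add has_vector_derivative_mult_right)
        (auto intro!: derivative_eq_intros has_vector_derivative_of_real)
    also have "(1 - s) * of_real y powr (1 - s - 1) + (s - 1) * of_real a powr (- s) * 1 =
        (1 - s) * (of_real y powr (- s) - of_real a powr (- s))" by (simp add: algebra_simps)
    finally show "(G has_vector_derivative (1 - s) * (of_real y powr (- s) - of_real a powr (- s))) (at y within {a..a + 1})" .
    have "norm (complex_of_real y powr (- s) - of_real a powr (- s)) \<le> norm s * a powr (- Re s - 1) * (y - a)"
      using y a s by (intro norm_powr_diff_le) auto
    also have "\<dots> \<le> norm s * a powr (- Re s - 1) * 1" using y by (intro mult_left_mono) auto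
    finally show "norm ((1 - s) * (complex_of_real y powr (- s) - of_real a powr (- s))) \<le> norm (s - 1) * (norm s * a powr (- Re s - 1))"
      by (simp add: norm_mult norm_minus_commute mult_left_mono)
  qed auto
  moreover have "G (a + 1) - G a = zeta_term n s"
    by (simp add: G_def zeta_term_def a_def algebra_simps)
  ultimately show ?thesis by (simp add: a_def mult.assoc)
qed

lemma zeta_reg_holomorphic: "zeta_reg holomorphic_on {s. Re s > 0}"
  and zeta_term_sums: "Re s > 0 \<Longrightarrow> (\<lambda>n. zeta_term n s) sums (zeta_reg s - 1)"
proof -
  define S where "S = {s::complex. Re s > 0}"
  have S: "open S" unfolding S_def by (rule open_halfspace_Re_gt)
  obtain g where g: "\<forall>x\<in>S. (\<lambda>n. zeta_term n x) sums g x \<and> g field_differentiable (at x)"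
  proof (rule series_differentiable_comparison_complex[OF S])
    show "zeta_term n field_differentiable at x" for n x
    proof -
      have "zeta_term n holomorphic_on UNIV" unfolding zeta_term_def[abs_def]
        by (intro holomorphic_intros)
      then show ?thesis using holomorphic_on_imp_differentiable_at by blast
    qed
    fix x assume "x \<in> S"
    then have x: "Re x > 0" by (simp add: S_def)
    define d where "d = Re x / 2"
    have d: "d > 0" using x by (simp add: d_def)
    define M where "M = (norm x + d + 1) * (norm x + d)"
    define h where "h n = M * real (Suc n) powr (- d - 1)" for n
    have M: "M \<ge> 0" using d by (simp add: M_def)
    have "summable (\<lambda>n. real n powr (- d - 1))" using d by (subst summable_real_powr_iff) auto
    then have "summable (\<lambda>n. real (Suc n) powr (- d - 1))" by (subst summable_Suc_iff)
    then have "summable h" unfolding h_def by (rule summable_mult)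
    then have "summable (\<lambda>n. complex_of_real (h n))" by (simp add: summable_of_real)
    moreover have "range (\<lambda>n. complex_of_real (h n)) \<subseteq> \<real>\<^sub>\<ge>\<^sub>0" using M by (auto simp: h_def)
    moreover have "norm (zeta_term n y) \<le> norm (complex_of_real (h n))" if "y \<in> ball x d \<inter> S" for n y
    proof -
      have y: "norm (y - x) < d" "Re y > 0" using that by (auto simp: dist_norm norm_minus_commute S_def)
      have "\<bar>Re (y - x)\<bar> < d" using y abs_Re_le_cmod[of "y - x"] by linarith
      then have "- Re (y - x) < d" by linarith
      then have "d \<le> Re y" by (simp add: d_def)
      have ny: "norm y \<le> norm x + d" using norm_triangle_ineq2[of y x] y by linarith
      have "norm (y - 1) \<le> norm y + 1" using norm_triangle_ineq4[of y 1] by simp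
      then have "norm (y - 1) * norm y \<le> M" unfolding M_def using ny d by (intro mult_mono) auto
      then have "norm (y - 1) * norm y * real (Suc n) powr (- Re y - 1) \<le> M * real (Suc n) powr (- d - 1)"
        using \<open>d \<le> Re y\<close> M by (intro mult_mono powr_mono) auto
      moreover have "norm (complex_of_real (h n)) = h n" using M by (simp only: norm_of_real) (simp add: h_def)
      ultimately show ?thesis using norm_zeta_term_le[OF y(2), of n] unfolding h_def by linarith
    qed
    ultimately show "\<exists>d h. 0 < d \<and> summable h \<and> range h \<subseteq> \<real>\<^sub>\<ge>\<^sub>0 \<and>
        (\<forall>\<^sub>F n in sequentially. \<forall>y\<in>ball x d \<inter> S. cmod (zeta_term n y) \<le> cmod (h n))"
      using d by (intro exI[of _ d] exI[of _ "\<lambda>n. complex_of_real (h n)"]) (intro conjI always_eventually allI ballI; simp only:)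
  qed
  have geq: "zeta_reg s = 1 + g s" if "s \<in> S" for s
    using g sums_unique[of "\<lambda>n. zeta_term n s" "g s"] that by (simp add: zeta_reg_def)
  have "(\<lambda>s. 1 + g s) holomorphic_on S"
    using g by (intro holomorphic_intros) (auto simp: holomorphic_on_def intro: field_differentiable_at_within)
  then show "zeta_reg holomorphic_on {s. Re s > 0}"
    unfolding S_def[symmetric] by (rule holomorphic_transform) (use geq in auto)
  show "(\<lambda>n. zeta_term n s) sums (zeta_reg s - 1)" if "Re s > 0"
    using g geq[of s] that by (simp add: S_def)
qed

text \<open>For \<open>Re s > 1\<close> the last two powers in \<open>zeta_term\<close> telescope to
  -1, which the summand 1 of \<open>zeta_reg\<close> offsets.\<close>

lemma zeta_reg_eq:
  assumes s: "Re s > 1"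
  shows "zeta_reg s = (s - 1) * dser (\<lambda>_. 1) s"
proof -
  have "dser_abs (\<lambda>_. 1)" by (rule dser_abs_bounded) simp
  from dser_sums[OF this s] have "(\<lambda>n. 1 / of_nat (Suc n) powr s) sums dser (\<lambda>_. 1) s"
    by (subst sums_Suc_iff) simp
  then have 1: "(\<lambda>n. (s - 1) * of_nat (Suc n) powr (- s)) sums ((s - 1) * dser (\<lambda>_. 1) s)"
    by (intro sums_mult) (simp add: powr_minus divide_inverse del: of_nat_Suc)
  have "(\<lambda>n. norm (of_nat (Suc n) powr (1 - s))) \<longlonglongrightarrow> 0"
  proof -
    have "(\<lambda>n. real (Suc n) powr (1 - Re s)) \<longlonglongrightarrow> 0" using s by real_asymp
    moreover have "norm (of_nat (Suc n) powr (1 - s)) = real (Suc n) powr (1 - Re s)" for n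
      by (subst norm_powr_real_powr) auto
    ultimately show ?thesis by simp
  qed
  then have "(\<lambda>n. of_nat (Suc n) powr (1 - s)) \<longlonglongrightarrow> 0" by (rule tendsto_norm_zero_cancel)
  from telescope_sums[OF this] have 2: "(\<lambda>n. of_nat (Suc (Suc n)) powr (1 - s) - of_nat (Suc n) powr (1 - s)) sums (0 - 1)"
    by simp
  from sums_add[OF 1 2] have "(\<lambda>n. zeta_term n s) sums ((s - 1) * dser (\<lambda>_. 1) s - 1)"
    by (simp add: zeta_term_def algebra_simps)
  moreover have "(\<lambda>n. zeta_term n s) sums (zeta_reg s - 1)" using zeta_term_sums[of s] s by simp
  ultimately show ?thesis using sums_unique2 by fastforce
qed

text \<open>The bound is uniform down to 0, the boundary point at which the nonvanishing argument
  reaches its contradiction. By the mean value theorem each term is at most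
  \<open>N powr (- x) - (N + 1) powr (- x)\<close> with \<open>N = Suc n\<close>, and these
  decreases add up to 1.\<close>

lemma norm_zeta_reg_le:
  assumes x: "0 < x" "x < 1"
  shows "norm (zeta_reg (of_real x)) \<le> 2"
proof -
  define t where "t n = (x - 1) * real (Suc n) powr (- x) - real (Suc n) powr (1 - x) + real (Suc (Suc n)) powr (1 - x)" for n
  have t: "zeta_term n (of_real x) = of_real (t n)" for n
  proof -
    have "of_nat m powr complex_of_real y = of_real (real m powr y)" for m y
      using powr_of_real[of "real m" y] by simp
    from this[of _ "- x"] this[of _ "1 - x"] show ?thesis unfolding zeta_term_def t_def
      by (simp del: of_nat_Suc)
  qed
  have tb: "norm (t n) \<le> real (Suc n) powr (- x) - real (Suc (Suc n)) powr (- x)" for n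
  proof -
    define a where "a = real (Suc n)"
    have a: "a \<ge> 1" by (simp add: a_def)
    have "\<exists>z. a < z \<and> z < a + 1 \<and> (a + 1) powr (1 - x) - a powr (1 - x) = (a + 1 - a) * ((1 - x) * z powr (1 - x - 1))"
      using a by (intro MVT2 has_real_derivative_powr) auto
    then obtain z where z: "a < z" "z < a + 1" "(a + 1) powr (1 - x) - a powr (1 - x) = (1 - x) * z powr (- x)" by auto
    have "t n = (1 - x) * (z powr (- x) - a powr (- x))"
      using z(3) by (simp add: t_def a_def algebra_simps)
    moreover have "z powr (- x) \<le> a powr (- x)" "(a + 1) powr (- x) \<le> z powr (- x)" using a x z by (auto intro!: powr_mono2')
    ultimately have "norm (t n) = (1 - x) * (a powr (- x) - z powr (- x))"
      using x by (simp add: abs_mult)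
    also have "\<dots> \<le> 1 * (a powr (- x) - (a + 1) powr (- x))"
      using x \<open>z powr (- x) \<le> a powr (- x)\<close> \<open>(a + 1) powr (- x) \<le> z powr (- x)\<close> by (intro mult_mono) auto
    finally show ?thesis by (simp add: a_def add.commute)
  qed
  have "(\<lambda>n. real (Suc n) powr (- x)) \<longlonglongrightarrow> 0" using x by real_asymp
  from telescope_sums'[OF this] have tel: "(\<lambda>n. real (Suc n) powr (- x) - real (Suc (Suc n)) powr (- x)) sums 1" by simp
  have sm: "summable (\<lambda>n. norm (t n))"
    using tb by (intro summable_comparison_test'[OF sums_summable[OF tel], of 0]) auto
  have sm': "summable t" using sm by (rule summable_norm_cancel)
  have "norm (\<Sum>n. t n) \<le> (\<Sum>n. norm (t n))" by (rule summable_norm[OF sm])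
  also have "\<dots> \<le> (\<Sum>n. real (Suc n) powr (- x) - real (Suc (Suc n)) powr (- x))"
    by (rule suminf_le[OF tb sm sums_summable[OF tel]])
  also have "\<dots> = 1" using sums_unique[OF tel] by simp
  finally have "norm (\<Sum>n. t n) \<le> 1" .
  moreover have "(\<Sum>n. zeta_term n (of_real x)) = of_real (\<Sum>n. t n)"
    unfolding t by (rule suminf_of_real[OF sm', symmetric])
  ultimately have "norm (\<Sum>n. zeta_term n (of_real x)) \<le> 1" by simp
  then show ?thesis unfolding zeta_reg_def by (metis norm_one norm_triangle_mono one_add_one order_refl)
qed

subsection \<open>Non-vanishing on the line of absolute convergence\<close>

text \<open>If \<open>F' = - F H\<close> with a Dirichlet series \<open>H\<close> with nonnegative coefficients, then the
  derivatives of \<open>F\<close> at \<open>2\<close> alternate in sign, so that \<open>F\<close> decreases along the part of the real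
  axis to the left of \<open>2\<close> to which it extends holomorphically.\<close>

lemma completely_monotone_lower_bound:
  assumes F: "F holomorphic_on ball 2 2" and h: "dser_abs h" "\<And>n. h n \<in> \<real>\<^sub>\<ge>\<^sub>0"
    and deriv: "\<And>s. s \<in> ball 2 1 \<Longrightarrow> (F has_field_derivative - (F s * dser h s)) (at s)"
    and F2: "F 2 = of_real c" "c \<ge> 0" and x: "0 < x" "x \<le> 2"
  shows "c \<le> Re (F (of_real x))"
proof -
  have holF: "F holomorphic_on ball 2 1" by (rule holomorphic_on_subset[OF F]) auto
  have ball: "Re s > 1" if "s \<in> ball 2 1" for s :: complex
    using that abs_Re_le_cmod[of "2 - s"] by (auto simp: dist_norm)
  have holH: "dser h holomorphic_on ball 2 1"
    by (rule holomorphic_on_subset[OF dser_holomorphic[OF h(1)]]) (use ball in auto)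
  \<comment> \<open>Each differentiation multiplies the coefficients by \<open>- ln n\<close>, so
    the derivatives at 2 alternate in sign.\<close>
  have derH: "\<exists>r\<ge>0. (deriv ^^ k) (dser h) 2 = (-1) ^ k * of_real r" for k
  proof -
    have "dser (\<lambda>n. h n * of_real (ln (real n)) ^ k) (of_real 2) \<in> \<real>\<^sub>\<ge>\<^sub>0"
    proof (rule dser_nonneg)
      show "dser_abs (\<lambda>n. h n * of_real (ln (real n)) ^ k)" using higher_deriv_dser(2)[OF h(1), of 2] by simp
      show "h n * of_real (ln (real n)) ^ k \<in> \<real>\<^sub>\<ge>\<^sub>0" for n
      proof -
        have "ln (real n) \<ge> 0" by (cases "n = 0") auto
        then have "complex_of_real (ln (real n)) ^ k \<in> \<real>\<^sub>\<ge>\<^sub>0" by (simp flip: of_real_power)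
        then show ?thesis using h(2) nonneg_Reals_mult_I by blast
      qed
    qed simp
    then obtain r where "r \<ge> 0" "dser (\<lambda>n. h n * of_real (ln (real n)) ^ k) 2 = of_real r"
      by (auto elim: nonneg_Reals_cases)
    then show ?thesis using higher_deriv_dser(1)[OF h(1), of 2 k] by auto
  qed
  \<comment> \<open>Leibniz' rule for \<open>F' = - F H\<close>: the signs belonging to the orders
    \<open>i\<close> and \<open>m - i\<close> multiply to that of order \<open>m\<close>, and the
    minus sign accounts for order \<open>m + 1\<close>.\<close>
  have "\<exists>r\<ge>0. (deriv ^^ k) F 2 = (-1) ^ k * of_real r" for k
  proof (induction k rule: less_induct)
    case (less k)
    show ?case
    proof (cases k)
      case 0
      then show ?thesis using F2 by auto
    next
      case (Suc m)
      have "(deriv ^^ Suc m) F 2 = (deriv ^^ m) (deriv F) 2" by (simp only: funpow_Suc_right o_apply)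
      also have "\<dots> = (deriv ^^ m) (\<lambda>s. (- F s) * dser h s) 2"
      proof (rule higher_deriv_transform_within_open)
        show "deriv F holomorphic_on ball 2 1" using holF by (simp add: holomorphic_deriv)
        show "(\<lambda>s. - F s * dser h s) holomorphic_on ball 2 1" by (intro holomorphic_intros holF holH)
        show "deriv F s = - F s * dser h s" if "s \<in> ball 2 1" for s using DERIV_imp_deriv[OF deriv[OF that]] by simp
      qed auto
      also have "\<dots> = (\<Sum>i = 0..m. of_nat (m choose i) * (deriv ^^ i) (\<lambda>s. - F s) 2 * (deriv ^^ (m - i)) (dser h) 2)"
        by (rule higher_deriv_mult[OF _ holH]) (auto intro!: holomorphic_intros holF)
      also have "\<dots> = (\<Sum>i = 0..m. - (of_nat (m choose i) * (deriv ^^ i) F 2 * (deriv ^^ (m - i)) (dser h) 2))"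
        by (intro sum.cong refl, subst higher_deriv_uminus[OF holF]) auto
      finally have eq: "(deriv ^^ Suc m) F 2 = (\<Sum>i = 0..m. - (of_nat (m choose i) * (deriv ^^ i) F 2 * (deriv ^^ (m - i)) (dser h) 2))" .
      have "\<exists>r\<ge>0. - (of_nat (m choose i) * (deriv ^^ i) F 2 * (deriv ^^ (m - i)) (dser h) 2) = (-1) ^ Suc m * of_real r"
        if i: "i \<in> {0..m}" for i
      proof -
        obtain a where a: "a \<ge> 0" "(deriv ^^ i) F 2 = (-1) ^ i * of_real a" using less[of i] i Suc by auto
        obtain b where b: "b \<ge> 0" "(deriv ^^ (m - i)) (dser h) 2 = (-1) ^ (m - i) * of_real b" using derH by blast
        have "(-1) ^ i * (-1) ^ (m - i) = (-1 :: complex) ^ m" using i by (simp add: power_add[symmetric])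
        then have "- (of_nat (m choose i) * (deriv ^^ i) F 2 * (deriv ^^ (m - i)) (dser h) 2) =
            (-1) ^ Suc m * of_real (real (m choose i) * a * b)"
          unfolding a b by (simp add: mult_ac)
        then show ?thesis using a(1) b(1) by (intro exI[of _ "real (m choose i) * a * b"]) auto
      qed
      then obtain r where r: "\<And>i. i \<in> {0..m} \<Longrightarrow> r i \<ge> 0"
        "\<And>i. i \<in> {0..m} \<Longrightarrow> - (of_nat (m choose i) * (deriv ^^ i) F 2 * (deriv ^^ (m - i)) (dser h) 2) = (-1) ^ Suc m * of_real (r i)"
        by metis
      have "(deriv ^^ Suc m) F 2 = (-1) ^ Suc m * of_real (\<Sum>i = 0..m. r i)"
        unfolding eq by (simp add: r(2) sum_distrib_left)
      moreover have "(\<Sum>i = 0..m. r i) \<ge> 0" using r(1) by (rule sum_nonneg)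
      ultimately show ?thesis unfolding Suc by blast
    qed
  qed
  then obtain b where b: "\<And>k. b k \<ge> 0" "\<And>k. (deriv ^^ k) F 2 = (-1) ^ k * of_real (b k)" by metis
  have "norm (2 - complex_of_real x) = \<bar>2 - x\<bar>" by (metis norm_of_real of_real_diff of_real_numeral)
  then have "of_real x \<in> ball (2::complex) 2" using x by (simp add: dist_norm)
  from holomorphic_power_series[OF F this]
  have "(\<lambda>k. Re ((deriv ^^ k) F 2 / fact k * (of_real x - 2) ^ k)) sums Re (F (of_real x))" by (rule sums_Re)
  moreover have "Re ((deriv ^^ k) F 2 / fact k * (of_real x - 2) ^ k) = b k / fact k * (2 - x) ^ k" for k
  proof -
    have "(-1) ^ k * (complex_of_real x - 2) ^ k = of_real ((2 - x) ^ k)"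
      by (simp add: power_mult_distrib[symmetric])
    then have "(deriv ^^ k) F 2 / fact k * (of_real x - 2) ^ k = of_real (b k / fact k * (2 - x) ^ k)"
      unfolding b(2) by (simp add: mult_ac)
    then show ?thesis by (simp only: Re_complex_of_real)
  qed
  ultimately have "(\<lambda>k. b k / fact k * (2 - x) ^ k) sums Re (F (of_real x))" by simp
  \<comment> \<open>For \<open>x \<le> 2\<close> every term of the Taylor series about 2 is
    nonnegative, so the constant term is a lower bound.\<close>
  then have "(\<Sum>k\<in>{0}. b k / fact k * (2 - x) ^ k) \<le> Re (F (of_real x))"
    unfolding sums_iff using b(1) x sum_le_suminf[of "\<lambda>k. b k / fact k * (2 - x) ^ k" "{0}"] by auto
  moreover have "b 0 = c" using b(2)[of 0] F2 by (metis funpow_0 mult_1 of_real_eq_iff power_0)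
  ultimately show ?thesis by simp
qed

section \<open>Twisted, conjugated and imprimitive Dirichlet series\<close>

lemma cmultiplicative_character:
  assumes chi: "dirichlet_character q chi"
  shows "cmultiplicative (\<lambda>n. chi (int n))"
  using chi dirichlet_characterD(2)[OF chi] norm_dirichlet_character_le[OF chi]
  unfolding cmultiplicative_def by simp

lemma cmultiplicative_twist:
  assumes "cmultiplicative c"
  shows "cmultiplicative (\<lambda>n. c n / of_nat n powr (\<i> * of_real t))"
  unfolding cmultiplicative_def
proof (intro conjI allI)
  note D = cmultiplicativeD[OF assms]
  show "c 1 / of_nat 1 powr (\<i> * of_real t) = 1" using D(1) by simp
  show "c (m * n) / of_nat (m * n) powr (\<i> * of_real t) =
      c m / of_nat m powr (\<i> * of_real t) * (c n / of_nat n powr (\<i> * of_real t))" for m n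
    by (simp add: D(2) powr_times_real)
  show "norm (c n / of_nat n powr (\<i> * of_real t)) \<le> 1" for n
    using D(3)[of n] unfolding norm_dser_term by (cases "n = 0") auto
qed

lemma dser_twist: "dser (\<lambda>n. c n / of_nat n powr w) s = dser c (s + w)"
  unfolding dser_def by (rule arg_cong[where f = suminf]) (auto simp: powr_add fun_eq_iff)

lemma dser_cnj:
  assumes c: "dser_abs c" and s: "Re s > 1"
  shows "dser (\<lambda>n. cnj (c n)) s = cnj (dser c (cnj s))"
proof -
  have eq: "cnj (c n / of_nat n powr (cnj s)) = cnj (c n) / of_nat n powr s" for n
    by (cases "n = 0") (simp_all add: powr_def exp_cnj Ln_of_nat)
  have "(\<lambda>n. c n / of_nat n powr (cnj s)) sums dser c (cnj s)"
    by (rule dser_sums) (use c s in auto)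
  then have "(\<lambda>n. cnj (c n / of_nat n powr (cnj s))) sums cnj (dser c (cnj s))"
    by (subst sums_cnj)
  then show ?thesis unfolding eq by (simp add: dser_def sums_iff)
qed

lemma dser_add:
  assumes "dser_abs a" "dser_abs b" "Re s > 1"
  shows "dser (\<lambda>n. a n + b n) s = dser a s + dser b s"
proof -
  have "(\<lambda>n. a n / of_nat n powr s + b n / of_nat n powr s) sums (dser a s + dser b s)"
    by (intro sums_add dser_sums assms)
  then have "(\<lambda>n. (a n + b n) / of_nat n powr s) sums (dser a s + dser b s)"
    by (simp add: add_divide_distrib)
  then show ?thesis by (simp add: dser_def sums_iff)
qed

lemma dser_abs_add:
  assumes "dser_abs a" "dser_abs b"
  shows "dser_abs (\<lambda>n. a n + b n)"
  unfolding dser_abs_def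
proof (intro allI impI)
  fix r :: real assume r: "r > 1"
  then have "summable (\<lambda>n. norm (a n) / real n powr r + norm (b n) / real n powr r)"
    using assms unfolding dser_abs_def by (intro summable_add) auto
  then show "summable (\<lambda>n. norm (a n + b n) / real n powr r)"
  proof (rule summable_comparison_test'[where N = 0])
    show "norm (norm (a n + b n) / real n powr r) \<le> norm (a n) / real n powr r + norm (b n) / real n powr r" for n
      by (simp add: add_divide_distrib[symmetric] divide_right_mono norm_triangle_ineq)
  qed
qed

lemma coprime_int_prime_factors:
  assumes "q > 0"
  shows "coprime (int n) (int q) \<longleftrightarrow> \<not> (\<exists>p\<in>prime_factors q. p dvd n)"
proof -
  have "coprime n q \<longleftrightarrow> \<not> (\<exists>p. prime p \<and> p dvd n \<and> p dvd q)"
  proof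
    assume "coprime n q"
    then show "\<not> (\<exists>p. prime p \<and> p dvd n \<and> p dvd q)"
      by (meson coprime_common_divisor not_prime_unit)
  next
    assume *: "\<not> (\<exists>p. prime p \<and> p dvd n \<and> p dvd q)"
    show "coprime n q"
    proof (rule ccontr)
      assume "\<not> coprime n q"
      then have "gcd n q \<noteq> 1" by (metis coprime_iff_gcd_eq_1)
      then obtain p where "prime p" "p dvd gcd n q" using prime_factor_nat by blast
      then show False using * by auto
    qed
  qed
  then show ?thesis using assms by (auto simp: in_prime_factors_iff)
qed

definition euler_factors :: "nat \<Rightarrow> (nat \<Rightarrow> complex) \<Rightarrow> complex \<Rightarrow> complex" where
  "euler_factors q c s = (\<Prod>p\<in>prime_factors q. 1 - c p / of_nat p powr s)"

lemma euler_factors_holomorphic: "euler_factors q c holomorphic_on A"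
proof -
  have "p \<noteq> 0" if "p \<in> prime_factors q" for p using that by (auto intro: Nat.gr0I)
  then show ?thesis unfolding euler_factors_def[abs_def] by (intro holomorphic_intros) auto
qed

lemma euler_factors_nonzero:
  assumes "\<And>n. norm (c n) \<le> 1" "Re s > 0"
  shows "euler_factors q c s \<noteq> 0"
  unfolding euler_factors_def
proof (subst prod_zero_iff)
  have "1 - c p / of_nat p powr s \<noteq> 0" if "p \<in> prime_factors q" for p
  proof -
    have p: "p > 1" using that prime_gt_1_nat by (auto simp: in_prime_factors_iff)
    have "norm (c p / of_nat p powr s) = norm (c p) / real p powr Re s" by (rule norm_dser_term)
    also have "\<dots> \<le> 1 / real p powr Re s" using assms(1) by (intro divide_right_mono) auto
    also have "\<dots> < 1" using p assms(2) by (simp add: gr_one_powr)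
    finally show ?thesis by auto
  qed
  then show "\<not> (\<exists>p\<in>prime_factors q. 1 - c p / of_nat p powr s = 0)" by blast
qed simp

text \<open>A zero at \<open>1 + i t\<close> would cancel the poles of \<open>F(s) = L(s, chi\<^sub>0)\<^sup>2 L(s + i t, chi) L(s - i t, cnj chi)\<close>.
  By monotonicity \<open>F\<close> would then be at least \<open>F(2) > 0\<close> on \<open>(0, 2]\<close>, whereas the Euler factors of
  \<open>L(s, chi\<^sub>0)\<close> vanish at \<open>0\<close>.\<close>

theorem L_nonzero_Re_1:
  assumes chi: "dirichlet_character q chi" and q: "q > 1"
    and L: "L holomorphic_on UNIV" "\<And>s. Re s > 1 \<Longrightarrow> L s = dser (\<lambda>n. chi (int n)) s"
  shows "L (1 + \<i> * of_real t) \<noteq> 0"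
proof
  assume zero: "L (1 + \<i> * of_real t) = 0"
  define c where "c n = chi (int n)" for n
  define c0 where "c0 n = principal_character q (int n)" for n
  define cp where "cp n = c n / of_nat n powr (\<i> * of_real t)" for n
  have cm0: "cmultiplicative c0" unfolding c0_def[abs_def]
    using q by (intro cmultiplicative_character[of q] dirichlet_character_principal) auto
  have cmc: "cmultiplicative c" unfolding c_def[abs_def] by (rule cmultiplicative_character[OF chi])
  have cmp: "cmultiplicative cp" unfolding cp_def[abs_def] by (rule cmultiplicative_twist[OF cmc])
  have cmm: "cmultiplicative (\<lambda>n. cnj (cp n))" using cmp unfolding cmultiplicative_def by simp
  note D0 = cmultiplicativeD[OF cm0] and Dp = cmultiplicativeD[OF cmp] and Dm = cmultiplicativeD[OF cmm]
  define E where "E = euler_factors q (\<lambda>_. 1)"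
  have E: "dser c0 s = E s * dser (\<lambda>_. 1) s" if "Re s > 1" for s
  proof -
    have "c0 = (\<lambda>n. if \<exists>p\<in>prime_factors q. p dvd n then 0 else 1)"
      using coprime_int_prime_factors[of q] q by (auto simp: c0_def fun_eq_iff principal_character_def)
    moreover have "cmultiplicative (\<lambda>_. 1)" by (simp add: cmultiplicative_def)
    moreover have "prime p" if "p \<in> prime_factors q" for p using that by (simp add: in_prime_factors_iff)
    ultimately show ?thesis
      using dser_remove_primes[of "prime_factors q" "\<lambda>_. 1" s] that by (simp add: E_def euler_factors_def)
  qed
  have holE: "E holomorphic_on A" for A unfolding E_def by (rule euler_factors_holomorphic)
  \<comment> \<open>At 0 every Euler factor is \<open>1 - 1\<close>, and \<open>q > 1\<close> has a
    prime divisor.\<close>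
  have E0: "E 0 = 0"
  proof -
    obtain p where p: "p \<in> prime_factors q" using q by (metis prime_factor_nat in_prime_factors_iff less_irrefl not_less0)
    then have "p \<noteq> 0" by (auto intro: Nat.gr0I)
    then show ?thesis unfolding E_def euler_factors_def using p by (intro prod_zero) auto
  qed
  define Lp where "Lp s = L (s + \<i> * of_real t)" for s
  define Lm where "Lm = cnj \<circ> Lp \<circ> cnj"
  have holLp: "Lp holomorphic_on UNIV" unfolding Lp_def[abs_def]
    by (rule holomorphic_on_compose_gen[OF _ L(1), unfolded o_def]) (auto intro!: holomorphic_intros)
  have Lp: "Lp s = dser cp s" if "Re s > 1" for s
    unfolding cp_def dser_twist Lp_def c_def using that by (intro L(2)) auto
  have Lm: "Lm s = dser (\<lambda>n. cnj (cp n)) s" if "Re s > 1" for s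
    using dser_cnj[OF Dp(4) that] Lp[of "cnj s"] that by (simp add: Lm_def)
  \<comment> \<open>The assumed zero at 1 is divided out of \<open>Lp\<close>; \<open>gm\<close>
    does the same for the conjugate function.\<close>
  define g where "g s = (if s = 1 then deriv Lp 1 else (Lp s - Lp 1) / (s - 1))" for s
  define gm where "gm = cnj \<circ> g \<circ> cnj"
  have holg: "g holomorphic_on UNIV" unfolding g_def by (rule pole_lemma_open[OF holLp]) simp
  have holgm: "gm holomorphic_on UNIV" unfolding gm_def
    by (rule holomorphic_on_compose_cnj_cnj) (auto intro: holomorphic_on_subset[OF holg])
  have Lp1: "Lp 1 = 0" using zero by (simp add: Lp_def)
  have g: "Lp s = (s - 1) * g s" for s using Lp1 by (simp add: g_def)
  have gm: "Lm s = (s - 1) * gm s" for s unfolding Lm_def gm_def o_def g by simp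
  \<comment> \<open>The square of \<open>zeta_reg\<close>, which is \<open>s - 1\<close> times the
    zeta function, provides the two factors \<open>s - 1\<close> taken out of \<open>Lp\<close> and
    \<open>Lm\<close>. So \<open>F\<close> is the product \<open>F1\<close> of four Dirichlet series
    where these converge, and still holomorphic up to the boundary point 0.\<close>
  define F where "F s = (zeta_reg s * E s)\<^sup>2 * (g s * gm s)" for s
  have ball: "Re s > 0" if "s \<in> ball 2 2" for s :: complex
    using that abs_Re_le_cmod[of "2 - s"] by (auto simp: dist_norm)
  have ball1: "Re s > 1" if "s \<in> ball 2 1" for s :: complex
    using that abs_Re_le_cmod[of "2 - s"] by (auto simp: dist_norm)
  have holF: "F holomorphic_on ball 2 2" unfolding F_def
    by (intro holomorphic_intros holE holomorphic_on_subset[OF zeta_reg_holomorphic]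
        holomorphic_on_subset[OF holg] holomorphic_on_subset[OF holgm]) (use ball in auto)
  define F1 where "F1 s = (dser c0 s)\<^sup>2 * (dser cp s * dser (\<lambda>n. cnj (cp n)) s)" for s
  have FF1: "F s = F1 s" if "Re s > 1" for s
  proof -
    have "F s = ((s - 1) * dser c0 s)\<^sup>2 * (g s * gm s)"
      unfolding F_def using zeta_reg_eq[OF that] E[OF that] by (simp add: mult_ac)
    also have "\<dots> = (dser c0 s)\<^sup>2 * (((s - 1) * g s) * ((s - 1) * gm s))" by (simp add: power2_eq_square)
    also have "\<dots> = F1 s" unfolding F1_def g[symmetric] gm[symmetric] Lp[OF that] Lm[OF that] ..
    finally show ?thesis .
  qed
  \<comment> \<open>These are the coefficients of \<open>- F1' / F1\<close>. They equal
    \<open>2 * (r + Re (cp n)) * mangoldt n\<close> with \<open>r\<close> the value of the principal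
    character, and \<open>norm (cp n) \<le> r\<close> makes them nonnegative.\<close>
  define h where "h n = (c0 n * mangoldt n + c0 n * mangoldt n) + (cp n * mangoldt n + cnj (cp n) * mangoldt n)" for n
  note ab = dser_abs_mangoldt[OF D0(3)] dser_abs_mangoldt[OF Dp(3)] dser_abs_mangoldt[OF Dm(3)]
  have habs: "dser_abs h" unfolding h_def by (intro dser_abs_add ab)
  have hnonneg: "h n \<in> \<real>\<^sub>\<ge>\<^sub>0" for n
  proof -
    define r where "r = (if coprime (int n) (int q) then 1 else 0 :: real)"
    have c0: "c0 n = of_real r" by (simp add: c0_def r_def principal_character_def)
    have "norm (cp n) \<le> r"
      using Dp(3)[of n] dirichlet_characterD(4)[OF chi, of "int n"] by (auto simp: r_def cp_def c_def)
    then have "- r \<le> Re (cp n)" using abs_Re_le_cmod[of "cp n"] by linarith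
    moreover have "h n = of_real (2 * (r + Re (cp n)) * mangoldt n)"
    proof -
      have "h n = (2 * of_real r + (cp n + cnj (cp n))) * of_real (mangoldt n)"
        by (simp add: h_def c0 algebra_simps)
      also have "\<dots> = of_real (2 * (r + Re (cp n)) * mangoldt n)"
        by (simp add: complex_add_cnj algebra_simps)
      finally show ?thesis .
    qed
    moreover have "mangoldt n \<ge> (0::real)" by (rule mangoldt_nonneg)
    ultimately show ?thesis by (simp only: nonneg_Reals_of_real_iff) simp
  qed
  have dF1: "(F1 has_field_derivative - (F1 s * dser h s)) (at s)" if s: "Re s > 1" for s
  proof -
    note d = has_field_derivative_dser_cmultiplicative[OF _ s]
    have H: "dser h s = (dser (\<lambda>n. c0 n * mangoldt n) s + dser (\<lambda>n. c0 n * mangoldt n) s) +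
        (dser (\<lambda>n. cp n * mangoldt n) s + dser (\<lambda>n. cnj (cp n) * mangoldt n) s)"
      unfolding h_def
      by (simp only: dser_add[OF dser_abs_add[OF ab(1,1)] dser_abs_add[OF ab(2,3)] s]
          dser_add[OF ab(1) ab(1) s] dser_add[OF ab(2) ab(3) s])
    show ?thesis unfolding F1_def H
      by (rule derivative_eq_intros d cm0 cmp cmm refl)+ (simp add: power2_eq_square algebra_simps)
  qed
  have dF: "(F has_field_derivative - (F s * dser h s)) (at s)" if s: "s \<in> ball 2 1" for s
    unfolding FF1[OF ball1[OF s]]
    by (rule has_field_derivative_transform_within_open[OF dF1[OF ball1[OF s]] open_ball s])
       (use FF1 ball1 in auto)
  define r where "r = Re (dser c0 2)"
  have r: "dser c0 2 = of_real r"
  proof -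
    have "(\<lambda>n. cnj (c0 n)) = c0" by (auto simp: c0_def principal_character_def)
    then have "cnj (dser c0 2) = dser c0 2" using dser_cnj[OF D0(4), of 2] by simp
    then show ?thesis by (simp add: r_def complex_eq_iff)
  qed
  define C where "C = r\<^sup>2 * (norm (dser cp 2))\<^sup>2"
  have F2: "F 2 = of_real C"
  proof -
    have "dser (\<lambda>n. cnj (cp n)) 2 = cnj (dser cp 2)" using dser_cnj[OF Dp(4), of 2] by simp
    then have "F1 2 = (of_real r)\<^sup>2 * (dser cp 2 * cnj (dser cp 2))" by (simp add: F1_def r)
    then show ?thesis using FF1[of 2] complex_norm_square[of "dser cp 2"] by (simp add: C_def)
  qed
  have "r \<noteq> 0" using dser_cmultiplicative_nonzero[OF cm0, of 2] r by auto
  moreover have "dser cp 2 \<noteq> 0" using dser_cmultiplicative_nonzero[OF cmp, of 2] by simp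
  ultimately have C: "C > 0" by (simp add: C_def)
  have "compact ((\<lambda>s. norm (g s * gm s)) ` cball 0 1)"
    by (intro compact_continuous_image continuous_intros holomorphic_on_imp_continuous_on compact_cball
        holomorphic_on_subset[OF holg] holomorphic_on_subset[OF holgm]) auto
  then have "bounded ((\<lambda>s. norm (g s * gm s)) ` cball 0 1)" by (rule compact_imp_bounded)
  then obtain K where "\<forall>y\<in>(\<lambda>s. norm (g s * gm s)) ` cball 0 1. norm y \<le> K" unfolding bounded_iff by blast
  then have K: "norm (g s * gm s) \<le> K" if "s \<in> cball 0 1" for s using that by force
  have le: "C \<le> 4 * K * (norm (E (of_real x)))\<^sup>2" if x: "0 < x" "x < 1" for x
  proof -
    have "C \<le> Re (F (of_real x))"
      by (rule completely_monotone_lower_bound[OF holF habs hnonneg dF F2]) (use C x in auto)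
    also have "\<dots> \<le> norm (F (of_real x))" by (rule complex_Re_le_cmod)
    also have "\<dots> = (norm (zeta_reg (of_real x)))\<^sup>2 * (norm (E (of_real x)))\<^sup>2 * norm (g (of_real x) * gm (of_real x))"
      by (simp add: F_def norm_mult norm_power power_mult_distrib)
    also have "\<dots> \<le> 2\<^sup>2 * (norm (E (of_real x)))\<^sup>2 * K"
      using norm_zeta_reg_le[OF x] x by (intro mult_mono power_mono K) auto
    finally show ?thesis by (simp add: mult_ac)
  qed
  \<comment> \<open>As \<open>x\<close> decreases to 0, the upper bound tends to 0 along with
    \<open>E\<close>, while the lower bound \<open>C\<close> is a fixed positive number.\<close>
  have "((\<lambda>x. 4 * K * (norm (E (of_real x)))\<^sup>2) \<longlongrightarrow> 4 * K * (norm (E (of_real 0)))\<^sup>2) (at_right 0)"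
  proof -
    have "continuous_on UNIV E" using holE by (rule holomorphic_on_imp_continuous_on)
    then have "continuous_on UNIV (\<lambda>x::real. E (of_real x))"
      by (rule continuous_on_compose2) (auto intro!: continuous_intros)
    then have "((\<lambda>x::real. E (of_real x)) \<longlongrightarrow> E (of_real 0)) (at_right 0)"
      by (metis continuous_on_def UNIV_I tendsto_within_subset subset_UNIV)
    then show ?thesis by (intro tendsto_intros)
  qed
  moreover have "\<forall>\<^sub>F x in at_right 0. C \<le> 4 * K * (norm (E (of_real x)))\<^sup>2"
    by (rule eventually_mono[OF eventually_at_right_real[of 0 1]]) (auto intro: le)
  ultimately have "C \<le> 4 * K * (norm (E (of_real 0)))\<^sup>2"
    by (rule tendsto_lowerbound) simp
  then show False using E0 C by simp
qed

subsection \<open>Poisson summation\<close>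

abbreviation expi :: "real \<Rightarrow> complex" where
  "expi x \<equiv> cis (2 * pi * x)"

text \<open>The kernels \<open>cos\<^sup>2\<^sup>n (\<pi> x)\<close> are trigonometric polynomials which concentrate at the origin.\<close>

lemma fourier_coefficients_zero_imp_zero:
  fixes D :: "real \<Rightarrow> complex"
  assumes cont: "continuous_on {-1/2..1/2} D"
    and zero: "\<And>k::int. integral {-1/2..1/2} (\<lambda>x. D x * expi (k * x)) = 0"
  shows "D 0 = 0"
proof (rule ccontr)
  assume nz: "D 0 \<noteq> 0"
  define c where "c = norm (D 0)"
  have c: "c > 0" using nz by (simp add: c_def)
  define I where "I n k = integral {-1/2..1/2} (\<lambda>x. D x * of_real (cos (pi * x) ^ (2 * n)) * expi (real_of_int k * x))"
    for n :: nat and k :: int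
  have I0: "I n k = 0" for n k
  proof (induction n arbitrary: k)
    case 0
    show ?case using zero[of k] by (simp add: I_def)
  next
    case (Suc n)
    let ?g = "\<lambda>j x. D x * of_real (cos (pi * x) ^ (2 * n)) * expi (real_of_int j * x)"
    have int: "?g j integrable_on {-1/2..1/2}" for j
      by (intro integrable_continuous_real continuous_intros cont)
    \<comment> \<open>Hence the integral for \<open>n + 1\<close> at frequency \<open>k\<close> is a
      combination of those for \<open>n\<close> at \<open>k\<close>, \<open>k + 1\<close> and
      \<open>k - 1\<close>, and all of them vanish by induction.\<close>
    have cos2: "complex_of_real (cos (pi * x) ^ 2) = (2 + expi x + expi (- x)) / 4" for x
    proof -
      have "cos (2 * (pi * x)) = 2 * cos (pi * x) ^ 2 - 1" by (rule cos_double_cos)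
      then have "cos (pi * x) ^ 2 = (2 + 2 * cos (2 * pi * x)) / 4" by (simp add: mult.assoc)
      then show ?thesis by (simp add: complex_eq_iff)
    qed
    have "D x * of_real (cos (pi * x) ^ (2 * Suc n)) * expi (real_of_int k * x) =
        1/2 * ?g k x + (1/4 * ?g (k + 1) x + 1/4 * ?g (k - 1) x)" for x
    proof -
      have e1: "expi (real_of_int (k + 1) * x) = expi (real_of_int k * x) * expi x"
        by (simp add: cis_mult algebra_simps)
      have e2: "expi (real_of_int (k - 1) * x) = expi (real_of_int k * x) * expi (- x)"
        by (simp add: cis_mult algebra_simps)
      have "cos (pi * x) ^ (2 * Suc n) = cos (pi * x) ^ (2 * n) * cos (pi * x) ^ 2"
        by (simp add: power_add[symmetric])
      then have "D x * of_real (cos (pi * x) ^ (2 * Suc n)) * expi (real_of_int k * x) =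
         D x * of_real (cos (pi * x) ^ (2 * n)) * of_real (cos (pi * x) ^ 2) * expi (real_of_int k * x)"
        by (simp only: of_real_mult mult.assoc)
      also have "\<dots> = 1/2 * ?g k x + (1/4 * ?g (k + 1) x + 1/4 * ?g (k - 1) x)"
        unfolding cos2 e1 e2 by (simp add: field_simps)
      finally show ?thesis .
    qed
    then have "I (Suc n) k = integral {-1/2..1/2} (\<lambda>x. 1/2 * ?g k x + (1/4 * ?g (k + 1) x + 1/4 * ?g (k - 1) x))"
      unfolding I_def by presburger
    also have "\<dots> = 1/2 * I n k + (1/4 * I n (k + 1) + 1/4 * I n (k - 1))"
      unfolding I_def by (subst integral_add integral_mult_right; (intro integrable_add integrable_on_mult_right int)?)+ simp
    finally show ?case using Suc by simp
  qed
  define W where "W n = integral {-1/2..1/2} (\<lambda>x::real. cos (pi * x) ^ (2 * n))" for n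
  have intW: "(\<lambda>x::real. cos (pi * x) ^ (2 * n)) integrable_on {a..b}" for n a b
    by (intro integrable_continuous_real continuous_intros)
  have "bounded (D ` {-1/2..1/2})"
    by (intro compact_imp_bounded compact_continuous_image cont compact_Icc)
  then obtain M where "\<forall>y\<in>D ` {-1/2..1/2}. norm y \<le> M" unfolding bounded_iff by blast
  then have M: "norm (D x) \<le> M" if "x \<in> {-1/2..1/2}" for x using that by blast
  have zero_in: "0 \<in> {-1/2..1/2::real}" by simp
  obtain d where d: "d > 0" "\<And>x. x \<in> {-1/2..1/2} \<Longrightarrow> \<bar>x\<bar> < d \<Longrightarrow> norm (D x - D 0) < c / 2"
  proof -
    have "\<exists>d>0. \<forall>x\<in>{-1/2..1/2}. dist x 0 < d \<longrightarrow> dist (D x) (D 0) < c / 2"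
      using cont half_gt_zero[OF c] unfolding continuous_on_iff by (metis zero_in)
    then show ?thesis using that by (auto simp: dist_norm)
  qed
  define e where "e = min (d / 2) (1 / 4)"
  have e: "0 < e" "e \<le> 1/4" "e < d" using d by (auto simp: e_def)
  \<comment> \<open>Outside \<open>|x| < e\<close> the kernel is at most \<open>s ^ n\<close>, and
    for \<open>|x| \<le> e / 2\<close> it is at least \<open>s' ^ n\<close>. Because
    \<open>s < s'\<close>, its total mass \<open>W n\<close> outweighs the tail
    exponentially.\<close>
  define s where "s = cos (pi * e) ^ 2"
  define s' where "s' = cos (pi * (e / 2)) ^ 2"
  have cose: "0 < cos (pi * e)" using e by (intro cos_gt_zero) (auto simp: field_simps)
  have coslt: "cos (pi * e) < cos (pi * (e / 2))"
    using e by (intro cos_monotone_0_pi) (auto simp: field_simps)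
  have s: "0 < s" "s < s'" using cose coslt unfolding s_def s'_def by (auto intro!: power_strict_mono)
  have M0: "M \<ge> 0" using order_trans[OF norm_ge_zero M[OF zero_in]] .
  have pointwise: "norm (D x - D 0) * cos (pi * x) ^ (2 * n) \<le> c / 2 * cos (pi * x) ^ (2 * n) + (M + c) * s ^ n"
    if x: "x \<in> {-1/2..1/2}" for x n
  proof (cases "\<bar>x\<bar> < e")
    case True
    then have "norm (D x - D 0) \<le> c / 2" using d(2)[OF x] e by auto
    then have "norm (D x - D 0) * cos (pi * x) ^ (2 * n) \<le> c / 2 * cos (pi * x) ^ (2 * n)"
      by (intro mult_right_mono) (auto simp: power_mult)
    moreover have "(M + c) * s ^ n \<ge> 0" using M0 c s by auto
    ultimately show ?thesis by linarith
  next
    case False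
    have "norm (D x - D 0) \<le> norm (D x) + norm (D 0)" by (rule norm_triangle_ineq4)
    then have 1: "norm (D x - D 0) \<le> M + c" using M[OF x] by (simp add: c_def)
    have "cos (pi * x) = cos (pi * \<bar>x\<bar>)" by (cases "x \<ge> 0") auto
    moreover have "cos (pi * \<bar>x\<bar>) \<le> cos (pi * e)" using False e x
      by (intro cos_monotone_0_pi_le) (auto simp: field_simps)
    moreover have "cos (pi * \<bar>x\<bar>) \<ge> 0"
    proof (rule cos_ge_zero)
      have "0 \<le> pi * \<bar>x\<bar>" by simp
      then show "- (pi / 2) \<le> pi * \<bar>x\<bar>" using pi_ge_zero by linarith
      show "pi * \<bar>x\<bar> \<le> pi / 2" using x by (auto simp: field_simps abs_if)
    qed
    ultimately have "cos (pi * x) ^ 2 \<le> s" unfolding s_def by (intro power_mono) auto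
    then have "cos (pi * x) ^ (2 * n) \<le> s ^ n" unfolding power_mult by (intro power_mono) auto
    then have "norm (D x - D 0) * cos (pi * x) ^ (2 * n) \<le> (M + c) * s ^ n"
      using 1 M0 c by (intro mult_mono) (auto simp: power_mult)
    moreover have "c / 2 * cos (pi * x) ^ (2 * n) \<ge> 0" using c by (simp add: power_mult)
    ultimately show ?thesis by linarith
  qed
  \<comment> \<open>The integral of \<open>D\<close> against the kernel is 0, so that of
    \<open>D - D 0\<close> has norm \<open>c * W n\<close>. By continuity the part near 0 accounts
    for at most half of this, and the tail must make up the rest.\<close>
  have W_le: "c / 2 * W n \<le> (M + c) * s ^ n" for n
  proof -
    let ?w = "\<lambda>x::real. cos (pi * x) ^ (2 * n)"
    have i1: "(\<lambda>x. D x * of_real (?w x)) integrable_on {-1/2..1/2}"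
      by (intro integrable_continuous_real continuous_intros cont)
    have i2: "(\<lambda>x. D 0 * of_real (?w x)) integrable_on {-1/2..1/2}"
      by (intro integrable_continuous_real continuous_intros)
    have "integral {-1/2..1/2} (\<lambda>x. D 0 * of_real (?w x)) = D 0 * of_real (W n)"
    proof -
      have "((\<lambda>x. complex_of_real (?w x)) has_integral of_real (W n)) {-1/2..1/2}"
        unfolding W_def by (intro has_integral_of_real integrable_integral intW)
      then show ?thesis by (intro integral_unique has_integral_mult_right)
    qed
    moreover have "integral {-1/2..1/2} (\<lambda>x. D x * of_real (?w x)) = 0"
      using I0[of n 0] by (simp add: I_def)
    ultimately have "integral {-1/2..1/2} (\<lambda>x. D x * of_real (?w x) - D 0 * of_real (?w x)) = - (D 0 * of_real (W n))"
      using i1 i2 by (subst integral_diff) auto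
    moreover have "norm (integral {-1/2..1/2} (\<lambda>x. D x * of_real (?w x) - D 0 * of_real (?w x))) \<le>
        integral {-1/2..1/2} (\<lambda>x. c / 2 * ?w x + (M + c) * s ^ n)"
    proof (rule integral_norm_bound_integral)
      show "(\<lambda>x. D x * of_real (?w x) - D 0 * of_real (?w x)) integrable_on {-1/2..1/2}"
        using i1 i2 by (rule integrable_diff)
      show "(\<lambda>x. c / 2 * ?w x + (M + c) * s ^ n) integrable_on {-1/2..1/2}"
        by (intro integrable_continuous_real continuous_intros)
      show "norm (D x * of_real (?w x) - D 0 * of_real (?w x)) \<le> c / 2 * ?w x + (M + c) * s ^ n"
        if "x \<in> {-1/2..1/2}" for x
      proof -
        have "D x * of_real (?w x) - D 0 * of_real (?w x) = (D x - D 0) * of_real (?w x)"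
          by (simp add: algebra_simps)
        then have "norm (D x * of_real (?w x) - D 0 * of_real (?w x)) = norm (D x - D 0) * ?w x"
          by (simp only: norm_mult norm_of_real) (simp add: power_mult)
        then show ?thesis using pointwise[OF that, of n] by simp
      qed
    qed
    moreover have "integral {-1/2..1/2} (\<lambda>x. c / 2 * ?w x + (M + c) * s ^ n) = c / 2 * W n + (M + c) * s ^ n"
      unfolding W_def by (subst integral_add) (auto intro!: intW integrable_on_mult_right)
    moreover have "norm (- (D 0 * of_real (W n))) = c * \<bar>W n\<bar>" by (simp add: norm_mult c_def)
    ultimately have "c * \<bar>W n\<bar> \<le> c / 2 * W n + (M + c) * s ^ n" by simp
    moreover have "c * W n \<le> c * \<bar>W n\<bar>" using c by (intro mult_left_mono) auto
    ultimately show ?thesis by (simp add: field_simps)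
  qed
  have W_ge: "e * s' ^ n \<le> W n" for n
  proof -
    have "integral {-(e/2)..e/2} (\<lambda>x. s' ^ n) \<le> integral {-(e/2)..e/2} (\<lambda>x::real. cos (pi * x) ^ (2 * n))"
    proof (rule integral_le)
      fix x assume x: "x \<in> {-(e/2)..e/2}"
      have "cos (pi * x) = cos (pi * \<bar>x\<bar>)" by (cases "x \<ge> 0") auto
      moreover have "cos (pi * \<bar>x\<bar>) \<ge> cos (pi * (e / 2))" using e x
        by (intro cos_monotone_0_pi_le) (auto simp: field_simps abs_if)
      moreover have "cos (pi * (e / 2)) \<ge> 0" using cose coslt by simp
      ultimately have "cos (pi * x) ^ 2 \<ge> s'" unfolding s'_def by (intro power_mono) auto
      then show "s' ^ n \<le> cos (pi * x) ^ (2 * n)" unfolding power_mult using s by (intro power_mono) auto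
    qed (auto intro: intW)
    also have "\<dots> \<le> W n" unfolding W_def using e by (intro integral_subset_le intW) (auto simp: power_mult)
    finally show ?thesis using e by simp
  qed
  define t where "t = s / s'"
  have t: "0 < t" "t < 1" using s by (auto simp: t_def)
  have "(\<lambda>n. (M + c) * t ^ n) \<longlonglongrightarrow> (M + c) * 0"
    using t by (intro tendsto_intros LIMSEQ_realpow_zero) auto
  moreover have "c / 2 * e \<le> (M + c) * t ^ n" for n
  proof -
    have "c / 2 * (e * s' ^ n) \<le> c / 2 * W n" using W_ge c by (intro mult_left_mono) auto
    also have "\<dots> \<le> (M + c) * s ^ n" by (rule W_le)
    finally show ?thesis using s unfolding t_def by (simp add: field_simps)
  qed
  ultimately have "c / 2 * e \<le> (M + c) * 0"
    by (intro LIMSEQ_le_const) auto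
  then show False using c e by (auto simp: mult_le_0_iff)
qed

lemma sum_symmetric_int:
  fixes F :: "int \<Rightarrow> 'a :: comm_monoid_add"
  shows "(\<Sum>n\<in>{-int (Suc N)..int (Suc N)}. F n) = (\<Sum>n\<in>{-int N..int N}. F n) + (F (int (Suc N)) + F (- int (Suc N)))"
proof -
  have "{-int (Suc N)..int (Suc N)} = insert (int (Suc N)) (insert (- int (Suc N)) {-int N..int N})" by auto
  then show ?thesis by (simp add: add_ac)
qed

lemma integral_combine_shifts:
  fixes G :: "real \<Rightarrow> complex"
  assumes "continuous_on UNIV G"
  shows "(\<Sum>n\<in>{-int N..int N}. integral {-1/2..1/2} (\<lambda>x. G (x + n))) = integral {-1/2 - real N..1/2 + real N} G"
proof (induction N)
  case 0
  show ?case by simp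
next
  case (Suc N)
  have int: "G integrable_on {a..b}" for a b
    using assms by (intro integrable_continuous_real) (rule continuous_on_subset, auto)
  have sh: "integral {-1/2..1/2} (\<lambda>x. G (x + c)) = integral {-1/2 + c..1/2 + c} G" for c
    using integral_shift_Icc_real[of "-1/2" "1/2" G c] by (simp add: o_def add.commute)
  have "integral {-1/2 - real (Suc N)..1/2 + real (Suc N)} G =
      integral {-1/2 - real (Suc N)..-1/2 - real N} G + integral {-1/2 - real N..1/2 + real N} G +
      integral {1/2 + real N..1/2 + real (Suc N)} G"
  proof -
    have "integral {-1/2 - real (Suc N)..-1/2 - real N} G + integral {-1/2 - real N..1/2 + real N} G =
        integral {-1/2 - real (Suc N)..1/2 + real N} G"
      by (rule Henstock_Kurzweil_Integration.integral_combine) (auto intro: int)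
    moreover have "integral {-1/2 - real (Suc N)..1/2 + real N} G + integral {1/2 + real N..1/2 + real (Suc N)} G =
        integral {-1/2 - real (Suc N)..1/2 + real (Suc N)} G"
      by (rule Henstock_Kurzweil_Integration.integral_combine) (auto intro: int)
    ultimately show ?thesis by simp
  qed
  then show ?case
    unfolding sum_symmetric_int Suc.IH using sh[of "real_of_int (int (Suc N))"] sh[of "real_of_int (- int (Suc N))"]
    by (simp add: algebra_simps)
qed

lemma integral_expi:
  "integral {-1/2..1/2} (\<lambda>x. expi (real_of_int k * x)) = (if k = 0 then 1 else 0)"
proof (cases "k = 0")
  case False
  define c where "c = 2 * pi * real_of_int k"
  have c: "c \<noteq> 0" using False by (simp add: c_def)
  define c' where "c' = \<i> * complex_of_real c"
  have c': "c' \<noteq> 0" using c by (simp add: c'_def)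
  have "((\<lambda>x. cis (c * x)) has_integral (cis (c * (1/2)) / c' - cis (c * (-1/2)) / c')) {-1/2..1/2}"
  proof (rule fundamental_theorem_of_calculus)
    fix x :: real
    have "((\<lambda>z. exp (c' * z) / c') has_field_derivative exp (c' * of_real x)) (at (of_real x))"
      using c' by (auto intro!: derivative_eq_intros)
    then have "((\<lambda>x. exp (c' * of_real x) / c') has_vector_derivative exp (c' * of_real x)) (at x)"
      by (rule has_vector_derivative_real_field)
    then show "((\<lambda>x. cis (c * x) / c') has_vector_derivative cis (c * x)) (at x within {-1/2..1/2})"
      by (simp add: cis_conv_exp c'_def mult.assoc has_vector_derivative_at_within)
  qed simp
  moreover have "cis (c * (1/2)) = cis (c * (-1/2))"
  proof -
    have "cis (c * (1/2)) = cis (c * (-1/2)) * cis c" by (simp add: cis_mult field_simps)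
    also have "cis c = 1" unfolding c_def using cis_multiple_2pi[of "real_of_int k"] by (simp add: mult_ac)
    finally show ?thesis by simp
  qed
  ultimately have "((\<lambda>x. cis (c * x)) has_integral 0) {-1/2..1/2}" by simp
  then show ?thesis using False by (simp add: c_def mult.assoc integral_unique)
qed simp

lemma summable_inverse_square_shift: "summable (\<lambda>n. C / (1 + real n ^ 2))"
proof -
  have "summable (\<lambda>n. 1 / (1 + real n ^ 2))"
  proof (rule summable_comparison_test'[of "\<lambda>n. 2 * inverse (real n ^ 2)" 1])
    show "summable (\<lambda>n. 2 * inverse (real n ^ 2))"
      by (intro summable_mult inverse_power_summable) simp
    show "norm (1 / (1 + (real n)\<^sup>2)) \<le> 2 * inverse (real n ^ 2)" if "n \<ge> 1" for n
    proof -
      have "1 / (1 + (real n)\<^sup>2) \<le> 1 / (real n)\<^sup>2" using that by (intro divide_left_mono) (auto intro!: mult_pos_pos add_pos_nonneg)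
      also have "\<dots> \<le> 2 * inverse (real n ^ 2)" by (auto simp: inverse_eq_divide intro!: divide_right_mono)
      finally show ?thesis by simp
    qed
  qed
  from summable_mult[OF this, of C] show ?thesis by simp
qed

text \<open>\<open>h k\<close> is the \<open>k\<close>-th translate of \<open>f\<close> minus the
  \<open>k\<close>-th term of the expected Fourier series. The sum \<open>D\<close> over all
  \<open>k\<close> is continuous with vanishing Fourier coefficients, and \<open>D 0 = 0\<close> is
  the assertion. Pairing \<open>k\<close> with \<open>- k\<close> in \<open>d\<close> makes the
  partial sums symmetric.\<close>

lemma poisson_summation_aux:
  fixes f :: "real \<Rightarrow> complex" and g :: "int \<Rightarrow> complex"
  assumes cont: "continuous_on UNIV f"
    and fB: "\<And>x. norm (f x) \<le> B / (1 + x\<^sup>2)" and gB: "\<And>k. norm (g k) \<le> B / (1 + (real_of_int k)\<^sup>2)"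
    and ft: "\<And>k. (\<lambda>N. integral {-1/2 - real N..1/2 + real N} (\<lambda>x. f x * expi (- (real_of_int k * x)))) \<longlonglongrightarrow> g k"
  shows "(\<lambda>N. (\<Sum>n\<in>{-int N..int N}. f n) - (\<Sum>k\<in>{-int N..int N}. g k)) \<longlonglongrightarrow> 0"
proof -
  have B0: "B \<ge> 0" using order_trans[OF norm_ge_zero fB[of 0]] by simp
  define h where "h k x = f (x + real_of_int k) - g k * expi (real_of_int k * x)" for k x
  define d where "d j x = (if j = 0 then h 0 x else h (int j) x + h (- int j) x)" for j x
  define DN where "DN N x = (\<Sum>k\<in>{-int N..int N}. h k x)" for N x
  have DN: "(\<Sum>j<Suc N. d j x) = DN N x" for N x
    by (induction N) (simp_all add: DN_def sum_symmetric_int d_def del: of_nat_Suc)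
  \<comment> \<open>For \<open>|x| \<le> 1/2\<close> and \<open>k \<noteq> 0\<close> one has
    \<open>|k| \<le> 2 * |x + k|\<close>. The translate then costs a factor 8, and the Fourier term
    adds 1.\<close>
  have hB: "norm (h k x) \<le> 9 * B / (1 + (real_of_int k)\<^sup>2)" if x: "x \<in> {-1/2..1/2}" for k x
  proof -
    have "1 + (real_of_int k)\<^sup>2 \<le> 8 * (1 + (x + real_of_int k)\<^sup>2)"
    proof (cases "k = 0")
      case False
      then have "\<bar>real_of_int k\<bar> \<ge> 1" by linarith
      then have "\<bar>x + real_of_int k\<bar> \<ge> \<bar>real_of_int k\<bar> / 2" using x by (auto simp: abs_if)
      then have "\<bar>x + real_of_int k\<bar>\<^sup>2 \<ge> (\<bar>real_of_int k\<bar> / 2)\<^sup>2" by (intro power_mono) auto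
      then have "(real_of_int k)\<^sup>2 \<le> 4 * (x + real_of_int k)\<^sup>2" by (simp add: power_divide)
      moreover have "a \<le> 4 * b \<Longrightarrow> 0 \<le> b \<Longrightarrow> 1 + a \<le> 8 * (1 + b)" for a b :: real by simp
      ultimately show ?thesis using zero_le_power2 by blast
    qed auto
    then have "8 * B / (8 * (1 + (x + real_of_int k)\<^sup>2)) \<le> 8 * B / (1 + (real_of_int k)\<^sup>2)"
      using B0 by (intro divide_left_mono) (auto intro!: mult_pos_pos add_pos_nonneg)
    then have "B / (1 + (x + real_of_int k)\<^sup>2) \<le> 8 * B / (1 + (real_of_int k)\<^sup>2)"
      by (simp only: mult_divide_mult_cancel_left_if) simp
    then have "norm (f (x + real_of_int k)) \<le> 8 * B / (1 + (real_of_int k)\<^sup>2)"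
      using fB order_trans by blast
    moreover have "norm (g k * expi (real_of_int k * x)) \<le> B / (1 + (real_of_int k)\<^sup>2)"
      using gB by (simp add: norm_mult)
    moreover have "norm (h k x) \<le> norm (f (x + real_of_int k)) + norm (g k * expi (real_of_int k * x))"
      unfolding h_def by (rule norm_triangle_ineq4)
    moreover have "8 * B / (1 + (real_of_int k)\<^sup>2) + B / (1 + (real_of_int k)\<^sup>2) = 9 * B / (1 + (real_of_int k)\<^sup>2)"
      by (simp add: add_divide_distrib[symmetric])
    ultimately show ?thesis by linarith
  qed
  have dB: "norm (d j x) \<le> 18 * B / (1 + real j ^ 2)" if x: "x \<in> {-1/2..1/2}" for j x
  proof (cases "j = 0")
    case True
    then show ?thesis using hB[OF x, of 0] B0 by (simp add: d_def)
  next
    case False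
    have "norm (d j x) \<le> norm (h (int j) x) + norm (h (- int j) x)"
      using False by (simp add: d_def norm_triangle_ineq)
    then show ?thesis using hB[OF x, of "int j"] hB[OF x, of "- int j"]
      by (simp add: add_divide_distrib[symmetric])
  qed
  define D where "D x = (\<Sum>j. d j x)" for x
  have unif: "uniform_limit {-1/2..1/2} (\<lambda>n x. \<Sum>j<n. d j x) D sequentially"
    unfolding D_def by (rule Weierstrass_m_test[OF dB summable_inverse_square_shift])
  have unif': "uniform_limit {-1/2..1/2} DN D sequentially"
  proof -
    have "uniform_limit {-1/2..1/2} (\<lambda>n x. \<Sum>j<Suc n. d j x) D sequentially"
      using unif by (rule filterlim_compose[OF _ filterlim_Suc])
    then show ?thesis by (simp only: DN)
  qed
  have contf: "continuous_on A (\<lambda>x. f (x + c))" for A c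
    by (rule continuous_on_compose2[OF cont]) (auto intro!: continuous_intros)
  have contDN: "continuous_on A (DN N)" for A N
    unfolding DN_def h_def by (intro continuous_intros contf)
  have contD: "continuous_on {-1/2..1/2} D"
    by (rule uniform_limit_theorem[OF _ unif']) (auto intro!: always_eventually contDN)
  have "D 0 = 0"
  proof (rule fourier_coefficients_zero_imp_zero[OF contD])
    fix k' :: int
    define k where "k = - k'"
    have e: "expi (real_of_int k' * x) = expi (- (real_of_int k * x))" for x by (simp add: k_def)
    have "(\<lambda>N. integral {-1/2..1/2} (\<lambda>x. DN N x * expi (- (real_of_int k * x)))) \<longlonglongrightarrow>
        integral {-1/2..1/2} (\<lambda>x. D x * expi (- (real_of_int k * x)))"
    proof -
      have "uniform_limit {-1/2..1/2} (\<lambda>N x. DN N x * expi (- (real_of_int k * x)))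
          (\<lambda>x. D x * expi (- (real_of_int k * x))) sequentially"
      proof (rule uniform_lim_mult[OF unif' uniform_limit_const])
        show "bounded (D ` {-1/2..1/2})"
          by (intro compact_imp_bounded compact_continuous_image contD compact_Icc)
        show "bounded ((\<lambda>x. expi (- (real_of_int k * x))) ` {-1/2..1/2})"
          by (auto simp: bounded_iff intro!: exI[of _ 1])
      qed
      then obtain I J where I: "\<And>N. ((\<lambda>x. DN N x * expi (- (real_of_int k * x))) has_integral I N) {-1/2..1/2}"
        and J: "((\<lambda>x. D x * expi (- (real_of_int k * x))) has_integral J) {-1/2..1/2}" and IJ: "I \<longlonglongrightarrow> J"
        by (rule uniform_limit_integral[where F = sequentially])
           (auto intro!: continuous_intros contDN)
      then show ?thesis using integral_unique[OF I] integral_unique[OF J] by simp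
    qed
    moreover have "(\<lambda>N. integral {-1/2..1/2} (\<lambda>x. DN N x * expi (- (real_of_int k * x)))) \<longlonglongrightarrow> g k - g k"
    proof -
      \<comment> \<open>The exponential has period 1, so the integrals over unit intervals join to
        one over a growing interval; for \<open>N \<ge> |k|\<close> orthogonality extracts
        \<open>g k\<close> from the Fourier terms.\<close>
      have eqN: "integral {-1/2..1/2} (\<lambda>x. DN N x * expi (- (real_of_int k * x))) =
          integral {-1/2 - real N..1/2 + real N} (\<lambda>x. f x * expi (- (real_of_int k * x))) - g k"
        if N: "N \<ge> nat \<bar>k\<bar>" for N
      proof -
        let ?G = "\<lambda>x. f x * expi (- (real_of_int k * x))"
        have cG: "continuous_on UNIV ?G" by (intro continuous_intros cont)
        have sh: "f (x + real_of_int n) * expi (- (real_of_int k * x)) = ?G (x + real_of_int n)" for n x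
        proof -
          have "- (real_of_int k * (x + real_of_int n)) = - (real_of_int k * x) + real_of_int (- k * n)"
            by (simp add: algebra_simps)
          then have "expi (- (real_of_int k * (x + real_of_int n))) =
              expi (- (real_of_int k * x)) * expi (real_of_int (- k * n))"
            by (simp only: distrib_left cis_mult[symmetric])
          also have "expi (real_of_int (- k * n)) = 1" by (rule cis_multiple_2pi) auto
          finally show ?thesis by simp
        qed
        have ex: "g m * expi (real_of_int m * x) * expi (- (real_of_int k * x)) = g m * expi (real_of_int (m - k) * x)"
          for m x by (simp add: cis_mult algebra_simps)
        have iG: "(\<lambda>x. ?G (x + real_of_int n)) integrable_on {-1/2..1/2}" for n
          by (intro integrable_continuous_real continuous_on_compose2[OF cG]) (auto intro!: continuous_intros)
        have iE: "(\<lambda>x. g m * expi (real_of_int (m - k) * x)) integrable_on {-1/2..1/2}" for m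
          by (intro integrable_continuous_real continuous_intros)
        have lin: "integral {-1/2..1/2} (\<lambda>x. (\<Sum>n\<in>X. A n x) - (\<Sum>m\<in>X. E m x)) =
            (\<Sum>n\<in>X. integral {-1/2..1/2} (A n)) - (\<Sum>m\<in>X. integral {-1/2..1/2} (E m))"
          if "\<And>n. A n integrable_on {-1/2..1/2}" "\<And>m. E m integrable_on {-1/2..1/2}" "finite X"
          for A E :: "int \<Rightarrow> real \<Rightarrow> complex" and X
          using that by (subst integral_diff) (auto intro!: integrable_sum simp: integral_sum)
        have "integral {-1/2..1/2} (\<lambda>x. DN N x * expi (- (real_of_int k * x))) =
            integral {-1/2..1/2} (\<lambda>x. (\<Sum>n\<in>{-int N..int N}. ?G (x + real_of_int n)) -
                 (\<Sum>m\<in>{-int N..int N}. g m * expi (real_of_int (m - k) * x)))"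
          unfolding DN_def h_def sum_distrib_right left_diff_distrib sum_subtractf sh ex ..
        also have "\<dots> = (\<Sum>n\<in>{-int N..int N}. integral {-1/2..1/2} (\<lambda>x. ?G (x + real_of_int n))) -
            (\<Sum>m\<in>{-int N..int N}. g m * integral {-1/2..1/2} (\<lambda>x. expi (real_of_int (m - k) * x)))"
          using lin[of "\<lambda>n x. ?G (x + real_of_int n)" "\<lambda>m x. g m * expi (real_of_int (m - k) * x)" "{-int N..int N}",
              OF iG iE finite_atLeastAtMost_int]
          unfolding Henstock_Kurzweil_Integration.integral_mult_right .
        also have "(\<Sum>m\<in>{-int N..int N}. g m * integral {-1/2..1/2} (\<lambda>x. expi (real_of_int (m - k) * x))) =
            (\<Sum>m\<in>{-int N..int N}. if m = k then g m else 0)"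
          unfolding integral_expi by (intro sum.cong) auto
        also have "\<dots> = g k" using N by auto
        finally show ?thesis unfolding integral_combine_shifts[OF cG] .
      qed
      have "\<forall>\<^sub>F N in sequentially. integral {-1/2 - real N..1/2 + real N} (\<lambda>x. f x * expi (- (real_of_int k * x))) - g k =
          integral {-1/2..1/2} (\<lambda>x. DN N x * expi (- (real_of_int k * x)))"
        by (rule eventually_sequentiallyI[of "nat \<bar>k\<bar>"]) (rule eqN[symmetric])
      then show ?thesis by (rule Lim_transform_eventually[rotated]) (intro tendsto_intros ft)
    qed
    ultimately show "integral {-1/2..1/2} (\<lambda>x. D x * expi (real_of_int k' * x)) = 0"
      unfolding e using LIMSEQ_unique by fastforce
  qed
  moreover have "(\<lambda>N. DN N 0) \<longlonglongrightarrow> D 0" using tendsto_uniform_limitI[OF unif', of 0] by simp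
  moreover have "DN N 0 = (\<Sum>n\<in>{-int N..int N}. f n) - (\<Sum>k\<in>{-int N..int N}. g k)" for N
    by (simp add: DN_def h_def sum_subtractf)
  ultimately show ?thesis by simp
qed

lemma infsum_int_symmetric:
  fixes F :: "int \<Rightarrow> 'a :: banach"
  assumes "F summable_on UNIV"
  shows "(\<lambda>N. \<Sum>n\<in>{-int N..int N}. F n) \<longlonglongrightarrow> infsum F UNIV"
proof -
  have "(sum F \<longlongrightarrow> infsum F UNIV) (finite_subsets_at_top UNIV)"
    using has_sum_infsum[OF assms] by (simp add: has_sum_def)
  moreover have "filterlim (\<lambda>N. {-int N..int N}) (finite_subsets_at_top UNIV) sequentially"
    unfolding filterlim_finite_subsets_at_top
  proof safe
    fix X :: "int set" assume X: "finite X"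
    have "\<exists>N. \<forall>n\<in>X. \<bar>n\<bar> \<le> int N"
      using finite_imageI[OF X, of "\<lambda>n. nat \<bar>n\<bar>"] by (intro exI[of _ "Max ((\<lambda>n. nat \<bar>n\<bar>) ` X)"]) (auto simp: nat_le_iff[symmetric])
    then obtain N where N: "\<forall>n\<in>X. \<bar>n\<bar> \<le> int N" by blast
    show "\<forall>\<^sub>F N in sequentially. finite {-int N..int N} \<and> X \<subseteq> {-int N..int N} \<and> {-int N..int N} \<subseteq> UNIV"
      unfolding eventually_sequentially
    proof (intro exI[of _ N] allI impI conjI subsetI)
      fix M n assume "N \<le> M" "n \<in> X"
      then have "\<bar>n\<bar> \<le> int M" using N by force
      then show "n \<in> {-int M..int M}" by auto
    qed auto
  qed
  ultimately show ?thesis by (rule filterlim_compose)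
qed

lemma abs_summable_int_inverse_square:
  fixes F :: "int \<Rightarrow> 'a :: banach"
  assumes "\<And>n. norm (F n) \<le> B / (1 + (real_of_int n)\<^sup>2)"
  shows "(\<lambda>n. norm (F n)) summable_on UNIV"
proof -
  define G where "G n = B / (1 + (real_of_int n)\<^sup>2)" for n
  have 1: "G summable_on range int"
  proof -
    have "(\<lambda>n. G (int n)) summable_on UNIV"
      using summable_inverse_square_shift[of "\<bar>B\<bar>"]
      by (intro norm_summable_imp_summable_on) (simp add: G_def)
    then show ?thesis by (subst summable_on_reindex) (auto simp: o_def inj_on_def)
  qed
  have 2: "G summable_on range (\<lambda>n. - int n)"
  proof -
    have "(\<lambda>n. G (- int n)) summable_on UNIV"
      using summable_inverse_square_shift[of "\<bar>B\<bar>"]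
      by (intro norm_summable_imp_summable_on) (simp add: G_def)
    then show ?thesis by (subst summable_on_reindex) (auto simp: o_def inj_on_def)
  qed
  have "UNIV = range int \<union> range (\<lambda>n. - int n)"
  proof (intro subset_antisym subsetI)
    fix n :: int show "n \<in> range int \<union> range (\<lambda>n. - int n)"
      by (cases n rule: int_cases2) auto
  qed auto
  then have "G summable_on UNIV" using summable_on_union[OF 1 2] by simp
  then show ?thesis
    by (rule summable_on_comparison_test) (use assms in \<open>auto simp: G_def\<close>)
qed

text \<open>The transform is asked for as a limit over these particular intervals because the
  integer translates of the unit interval about 0 join to exactly them.\<close>

lemma poisson_summation:
  fixes f :: "real \<Rightarrow> complex" and g :: "int \<Rightarrow> complex"
  assumes cont: "continuous_on UNIV f"
    and fB: "\<And>x. norm (f x) \<le> B / (1 + x\<^sup>2)" and gB: "\<And>k. norm (g k) \<le> B / (1 + (real_of_int k)\<^sup>2)"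
    and ft: "\<And>k. (\<lambda>N. integral {-1/2 - real N..1/2 + real N} (\<lambda>x. f x * expi (- (real_of_int k * x)))) \<longlonglongrightarrow> g k"
  shows "(\<Sum>\<^sub>\<infinity>n::int. f n) = (\<Sum>\<^sub>\<infinity>k. g k)"
proof -
  have "(\<lambda>n::int. norm (f n)) summable_on UNIV" "(\<lambda>n. norm (g n)) summable_on UNIV"
    using fB gB by (intro abs_summable_int_inverse_square[of _ B]; simp)+
  from this[THEN abs_summable_summable, THEN infsum_int_symmetric]
  have "(\<lambda>N. (\<Sum>n\<in>{-int N..int N}. f n) - (\<Sum>k\<in>{-int N..int N}. g k)) \<longlonglongrightarrow> (\<Sum>\<^sub>\<infinity>n::int. f n) - (\<Sum>\<^sub>\<infinity>k. g k)"
    by (intro tendsto_intros)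
  with poisson_summation_aux[OF assms] show ?thesis using LIMSEQ_unique by fastforce
qed

subsection \<open>Gaussians\<close>

text \<open>A rescaling of the characteristic function of the standard normal distribution.\<close>

lemma gaussian_integral:
  assumes t: "t > 0"
  shows "integrable lborel (\<lambda>x. complex_of_real (exp (- (pi * t * x\<^sup>2))) * expi (- (k * x)))"
    and "(LBINT x. complex_of_real (exp (- (pi * t * x\<^sup>2))) * expi (- (k * x))) =
           of_real (exp (- (pi * k\<^sup>2 / t)) / sqrt t)"
proof -
  \<comment> \<open>Chosen so that \<open>(c * x)\<^sup>2 / 2 = pi * t * x\<^sup>2\<close>, and
    \<open>s\<close> so that \<open>s * (c * x) = - (2 * pi * k * x)\<close>.\<close>
  define c where "c = sqrt (2 * pi * t)"
  define s where "s = - (2 * pi * k / c)"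
  have c: "c > 0" "c\<^sup>2 = 2 * pi * t" using t by (auto simp: c_def)
  let ?f = "\<lambda>x. std_normal_density x *\<^sub>R iexp (s * x)"
  define K where "K = complex_of_real (1 / sqrt (2 * pi))"
  have K: "K \<noteq> 0" by (simp add: K_def)
  have f: "?f (0 + c * x) = K * (complex_of_real (exp (- (pi * t * x\<^sup>2))) * expi (- (k * x)))" for x
  proof -
    have "(c * x)\<^sup>2 / 2 = pi * t * x\<^sup>2" using c(2) by (simp add: power_mult_distrib)
    moreover have "s * (c * x) = 2 * pi * (- (k * x))" using c(1) by (simp add: s_def)
    ultimately show ?thesis
      by (simp add: std_normal_density_def cis_conv_exp scaleR_conv_of_real K_def)
  qed
  have "integrable lborel ?f"
  proof (rule Bochner_Integration.integrable_bound)
    show "integrable lborel std_normal_density" using integrable_std_normal_moment[of 0] by simp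
    show "AE x in lborel. norm (?f x) \<le> norm (std_normal_density x)" by simp
  qed simp
  from lborel_integrable_real_affine[OF this, of c 0] c
  have "integrable lborel (\<lambda>x. K * (complex_of_real (exp (- (pi * t * x\<^sup>2))) * expi (- (k * x))))"
    unfolding f by simp
  from integrable_mult_right[OF this, of "inverse K"]
  show "integrable lborel (\<lambda>x. complex_of_real (exp (- (pi * t * x\<^sup>2))) * expi (- (k * x)))"
    using K by (simp add: mult.assoc[symmetric])
  have "of_real (exp (- (s\<^sup>2) / 2)) = char std_normal_distribution s"
    by (simp add: char_std_normal_distribution)
  also have "\<dots> = (LBINT x. ?f x)"
    unfolding char_def by (subst integral_density) (auto simp: normal_density_nonneg)
  also have "\<dots> = c *\<^sub>R (LBINT x. ?f (0 + c * x))" using c by (subst lborel_integral_real_affine[of c _ 0]) auto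
  also have "\<dots> = of_real (c / sqrt (2 * pi)) * (LBINT x. complex_of_real (exp (- (pi * t * x\<^sup>2))) * expi (- (k * x)))"
    unfolding f by (simp add: scaleR_conv_of_real K_def)
  also have "c / sqrt (2 * pi) = sqrt t" by (simp add: c_def real_sqrt_mult)
  also have "- (s\<^sup>2) / 2 = - (pi * k\<^sup>2 / t)"
    using t c by (simp add: s_def power_divide power_mult_distrib) (simp add: power2_eq_square)
  finally show "(LBINT x. complex_of_real (exp (- (pi * t * x\<^sup>2))) * expi (- (k * x))) =
           of_real (exp (- (pi * k\<^sup>2 / t)) / sqrt t)"
    using t by (simp add: field_simps)
qed

lemma tendsto_integral_symmetric:
  fixes G :: "real \<Rightarrow> complex"
  assumes "integrable lborel G"
  shows "(\<lambda>N. integral {a - real N..b + real N} G) \<longlonglongrightarrow> integral\<^sup>L lborel G"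
proof -
  have eq: "integral {c..d} G = (LBINT x. indicator {c..d} x *\<^sub>R G x)" for c d :: real
  proof -
    have "set_integrable lborel {c..d} G"
      unfolding set_integrable_def using assms by (intro integrable_mult_indicator) auto
    then show ?thesis using set_borel_integral_eq_integral(2)[of "{c..d}" G]
      by (simp add: set_lebesgue_integral_def)
  qed
  show ?thesis unfolding eq
  proof (rule integral_dominated_convergence[where w = "\<lambda>x. norm (G x)"])
    show "integrable lborel (\<lambda>x. norm (G x))" using assms by simp
    show "AE x in lborel. (\<lambda>N. indicator {a - real N..b + real N} x *\<^sub>R G x) \<longlonglongrightarrow> G x"
    proof (rule AE_I2)
      fix x
      have "\<forall>\<^sub>F N in sequentially. G x = indicator {a - real N..b + real N} x *\<^sub>R G x"
      proof -
        have "a - real N \<le> x \<and> x \<le> b + real N" if "N \<ge> nat \<lceil>max (a - x) (x - b)\<rceil>" for N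
          using that by (auto simp: nat_le_iff ceiling_le_iff)
        then show ?thesis unfolding eventually_sequentially by (metis atLeastAtMost_iff indicator_simps(1) scaleR_one)
      qed
      then show "(\<lambda>N. indicator {a - real N..b + real N} x *\<^sub>R G x) \<longlonglongrightarrow> G x"
        by (rule Lim_transform_eventually[OF tendsto_const])
    qed
  qed (use assms in \<open>auto intro: borel_measurable_integrable simp: indicator_def\<close>)
qed

text \<open>The Fourier transform at \<open>k\<close> of
  \<open>x ^ \<kappa> * exp (- (pi * t * x\<^sup>2))\<close>, in a form common to the cases 0 and 1
  of \<open>\<kappa>\<close>.\<close>

definition gaussian_ft :: "nat \<Rightarrow> real \<Rightarrow> real \<Rightarrow> complex" where
  "gaussian_ft \<kappa> t k = (- \<i> * k / t) ^ \<kappa> * of_real (exp (- (pi * k\<^sup>2 / t)) / sqrt t)"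

text \<open>The case \<open>\<kappa> = 1\<close> follows from \<open>\<kappa> = 0\<close> on
  integrating \<open>H'\<close>, a combination of \<open>x * H\<close> and \<open>H\<close>: the
  boundary values of \<open>H\<close> die out.\<close>

lemma gaussian_ft:
  assumes t: "t > 0" and \<kappa>: "\<kappa> \<le> 1"
  shows "(\<lambda>N. integral {a - real N..b + real N}
            (\<lambda>x. complex_of_real (x ^ \<kappa> * exp (- (pi * t * x\<^sup>2))) * expi (- (k * x)))) \<longlonglongrightarrow> gaussian_ft \<kappa> t k"
proof -
  define H where "H x = complex_of_real (exp (- (pi * t * x\<^sup>2))) * expi (- (k * x))" for x
  have H_fun: "H = (\<lambda>x. complex_of_real (exp (- (pi * t * x\<^sup>2))) * expi (- (k * x)))"
    by (rule ext) (rule H_def)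
  have 0: "(\<lambda>N. integral {a - real N..b + real N} H) \<longlonglongrightarrow> of_real (exp (- (pi * k\<^sup>2 / t)) / sqrt t)"
    using tendsto_integral_symmetric[OF gaussian_integral(1)[OF t, of k], of a b]
    unfolding gaussian_integral(2)[OF t] H_fun .
  show ?thesis
  proof (cases "\<kappa> = 0")
    case True
    then show ?thesis using 0 by (simp add: gaussian_ft_def H_fun)
  next
    case False
    then have \<kappa>1: "\<kappa> = 1" using \<kappa> by simp
    define c where "c = complex_of_real (2 * pi * t)"
    have c: "c \<noteq> 0" using t by (simp add: c_def)
    have H_alt: "H x = exp (- (c / 2 * of_real x ^ 2) - 2 * pi * \<i> * k * of_real x)" for x
      by (simp add: H_def c_def cis_conv_exp exp_of_real[symmetric] exp_add[symmetric] mult_ac)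
    have int: "((\<lambda>x. - c * (of_real x * H x) - 2 * pi * \<i> * k * H x) has_integral (H v - H u)) {u..v}" if "u \<le> v" for u v
    proof (rule fundamental_theorem_of_calculus[OF that])
      fix x
      have "((\<lambda>z. exp (- (c / 2 * z ^ 2) - 2 * pi * \<i> * k * z)) has_field_derivative
          (- c * of_real x - 2 * pi * \<i> * k) * exp (- (c / 2 * of_real x ^ 2) - 2 * pi * \<i> * k * of_real x)) (at (of_real x))"
        by (auto intro!: derivative_eq_intros simp: algebra_simps)
      then have "(H has_vector_derivative (- c * of_real x - 2 * pi * \<i> * k) * H x) (at x)"
        unfolding H_alt by (rule has_vector_derivative_real_field)
      then show "(H has_vector_derivative - c * (of_real x * H x) - 2 * pi * \<i> * k * H x) (at x within {u..v})"
        by (simp add: algebra_simps has_vector_derivative_at_within)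
    qed
    have contH: "continuous_on A H" for A unfolding H_def by (intro continuous_intros)
    have eq: "integral {u..v} (\<lambda>x. of_real x * H x) = (- (2 * pi * \<i> * k) * integral {u..v} H - (H v - H u)) / c"
      if "u \<le> v" for u v
    proof -
      have i1: "(\<lambda>x. of_real x * H x) integrable_on {u..v}" and i2: "H integrable_on {u..v}"
        by (intro integrable_continuous_real continuous_intros contH)+
      have "((\<lambda>x. - c * (of_real x * H x) - 2 * pi * \<i> * k * H x) has_integral
          (- c * integral {u..v} (\<lambda>x. of_real x * H x) - 2 * pi * \<i> * k * integral {u..v} H)) {u..v}"
        using i1 i2 by (intro has_integral_diff has_integral_mult_right integrable_integral)
      from has_integral_unique[OF this int[OF that]] show ?thesis using c by (simp add: field_simps)
    qed
    have Hlim: "(\<lambda>N. H (w N)) \<longlonglongrightarrow> 0" if w: "filterlim (\<lambda>N. (w N)\<^sup>2) at_top sequentially" for w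
    proof -
      have "filterlim (\<lambda>N. pi * t * (w N)\<^sup>2) at_top sequentially"
        using t by (intro filterlim_tendsto_pos_mult_at_top[OF tendsto_const _ w]) auto
      then have "(\<lambda>N. exp (- (pi * t * (w N)\<^sup>2))) \<longlonglongrightarrow> 0"
        by (intro filterlim_compose[OF exp_at_bot] filterlim_uminus_at_bot_at_top[THEN filterlim_compose])
      then show ?thesis by (intro tendsto_norm_zero_cancel[of "\<lambda>N. H (w N)"]) (simp add: H_def norm_mult)
    qed
    have H1: "(\<lambda>N. H (b + real N)) \<longlonglongrightarrow> 0" by (rule Hlim) real_asymp
    have H2: "(\<lambda>N. H (a - real N)) \<longlonglongrightarrow> 0" by (rule Hlim) real_asymp
    have "(\<lambda>N. (- (2 * pi * \<i> * k) * integral {a - real N..b + real N} H - (H (b + real N) - H (a - real N))) / c)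
       \<longlonglongrightarrow> (- (2 * pi * \<i> * k) * of_real (exp (- (pi * k\<^sup>2 / t)) / sqrt t) - (0 - 0)) / c"
      by (intro tendsto_intros 0 H1 H2 c)
    also have "(- (2 * pi * \<i> * k) * of_real (exp (- (pi * k\<^sup>2 / t)) / sqrt t) - (0 - 0)) / c = gaussian_ft \<kappa> t k"
      using t by (simp add: gaussian_ft_def \<kappa>1 c_def field_simps)
    finally have lim: "(\<lambda>N. (- (2 * pi * \<i> * k) * integral {a - real N..b + real N} H - (H (b + real N) - H (a - real N))) / c)
       \<longlonglongrightarrow> gaussian_ft \<kappa> t k" .
    have "\<forall>\<^sub>F N in sequentially. (- (2 * pi * \<i> * k) * integral {a - real N..b + real N} H - (H (b + real N) - H (a - real N))) / c
        = integral {a - real N..b + real N} (\<lambda>x. complex_of_real (x ^ \<kappa> * exp (- (pi * t * x\<^sup>2))) * expi (- (k * x)))"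
    proof -
      have "(\<lambda>x. complex_of_real (x ^ \<kappa> * exp (- (pi * t * x\<^sup>2))) * expi (- (k * x))) = (\<lambda>x. of_real x * H x)"
        by (simp add: \<kappa>1 H_def mult.assoc)
      moreover have "\<forall>\<^sub>F N in sequentially. a - real N \<le> b + real N" by real_asymp
      ultimately show ?thesis by (auto elim!: eventually_mono simp: eq)
    qed
    then show ?thesis by (rule Lim_transform_eventually[OF lim])
  qed
qed

text \<open>Half of the exponent controls one factor,
  \<open>m * (1 + z) \<le> 1 + c / 2 * z \<le> exp (c / 2 * z)\<close>; squaring gives the bound
  \<open>1 / m\<^sup>2\<close>.\<close>

lemma polynomial_exp_bound:
  fixes c :: real
  assumes "c > 0"
  obtains B where "B > 0" "\<And>z. z \<ge> 0 \<Longrightarrow> (1 + z)\<^sup>2 * exp (- (c * z)) \<le> B"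
proof -
  define m where "m = min 1 (c / 2)"
  have m: "m > 0" "m \<le> 1" "m \<le> c / 2" using assms by (auto simp: m_def)
  have "(1 + z)\<^sup>2 * exp (- (c * z)) \<le> 1 / m\<^sup>2" if z: "z \<ge> 0" for z
  proof -
    have "m * (1 + z) \<le> 1 + c / 2 * z" using m z mult_right_mono[OF m(3) z] by (simp add: algebra_simps)
    also have "\<dots> \<le> exp (c / 2 * z)" by (rule exp_ge_add_one_self)
    finally have "(m * (1 + z))\<^sup>2 \<le> (exp (c / 2 * z))\<^sup>2" using m z by (intro power_mono) auto
    also have "(exp (c / 2 * z))\<^sup>2 = exp (c * z)" by (simp add: power2_eq_square exp_add[symmetric])
    finally have "m\<^sup>2 * (1 + z)\<^sup>2 \<le> exp (c * z)" unfolding power_mult_distrib .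
    moreover have "m\<^sup>2 * w \<le> E \<Longrightarrow> 0 < E \<Longrightarrow> w * inverse E \<le> 1 / m\<^sup>2" for w E :: real
      using m by (simp add: field_simps)
    ultimately show ?thesis by (simp add: exp_minus)
  qed
  then show ?thesis using that[of "1 / m\<^sup>2"] m by simp
qed

lemma gaussian_shift_bound:
  assumes t: "t > 0" and \<kappa>: "\<kappa> \<le> (1::nat)"
  shows "\<exists>B>0. \<forall>x. \<bar>x + u\<bar> ^ \<kappa> * exp (- (pi * t * (x + u)\<^sup>2)) \<le> B / (1 + x\<^sup>2)"
proof -
  obtain B where B: "B > 0" "\<And>z. z \<ge> 0 \<Longrightarrow> (1 + z)\<^sup>2 * exp (- (pi * t * z)) \<le> B"
    using polynomial_exp_bound[of "pi * t"] t by auto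
  define C where "C = 2 + 2 * u\<^sup>2"
  have C: "C > 0" by (simp add: C_def add_pos_nonneg)
  have "\<bar>x + u\<bar> ^ \<kappa> * exp (- (pi * t * (x + u)\<^sup>2)) \<le> (C * B) / (1 + x\<^sup>2)" for x
  proof -
    define y where "y = x + u"
    have "\<bar>y\<bar> \<le> 1 + y\<^sup>2" using zero_le_power2[of "\<bar>y\<bar> - 1"] by (simp add: power2_eq_square algebra_simps)
    then have 1: "\<bar>y\<bar> ^ \<kappa> \<le> 1 + y\<^sup>2" using \<kappa> by (cases \<kappa>) auto
    have "2 * u\<^sup>2 * y\<^sup>2 \<ge> 0" by simp
    moreover have "C * (1 + y\<^sup>2) = 2 + 2 * u\<^sup>2 + 2 * y\<^sup>2 + 2 * u\<^sup>2 * y\<^sup>2" by (simp add: C_def algebra_simps)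
    moreover have "1 + x\<^sup>2 \<le> 1 + 2 * y\<^sup>2 + 2 * u\<^sup>2"
      using zero_le_power2[of "y + u"] by (simp add: y_def power2_eq_square algebra_simps)
    ultimately have 2: "1 + x\<^sup>2 \<le> C * (1 + y\<^sup>2)" by linarith
    have "(1 + x\<^sup>2) * (\<bar>y\<bar> ^ \<kappa> * exp (- (pi * t * y\<^sup>2))) \<le> (C * (1 + y\<^sup>2)) * ((1 + y\<^sup>2) * exp (- (pi * t * y\<^sup>2)))"
      using 1 2 C by (intro mult_mono) (auto intro!: mult_nonneg_nonneg)
    also have "\<dots> = C * ((1 + y\<^sup>2)\<^sup>2 * exp (- (pi * t * y\<^sup>2)))" by (simp add: power2_eq_square)
    also have "\<dots> \<le> C * B" using B(2)[of "y\<^sup>2"] C by (intro mult_left_mono) auto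
    finally show ?thesis unfolding y_def by (simp add: pos_le_divide_eq add_pos_nonneg mult.commute)
  qed
  then show ?thesis using B C by (intro exI[of _ "C * B"]) auto
qed

lemma gaussian_ft_bound:
  assumes t: "t > 0" and \<kappa>: "\<kappa> \<le> 1"
  shows "\<exists>B>0. \<forall>k. norm (gaussian_ft \<kappa> t k) \<le> B / (1 + k\<^sup>2)"
proof -
  obtain B where B: "B > 0" "\<And>x. \<bar>x + 0\<bar> ^ \<kappa> * exp (- (pi * (1/t) * (x + 0)\<^sup>2)) \<le> B / (1 + x\<^sup>2)"
    using gaussian_shift_bound[of "1/t" \<kappa> 0] t \<kappa> divide_pos_pos[OF zero_less_one t] by blast
  define C where "C = (1 / t) ^ \<kappa> / sqrt t"
  have C: "C > 0" using t by (simp add: C_def)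
  have "norm (gaussian_ft \<kappa> t k) \<le> (C * B) / (1 + k\<^sup>2)" for k
  proof -
    have "norm (gaussian_ft \<kappa> t k) = C * (\<bar>k + 0\<bar> ^ \<kappa> * exp (- (pi * (1/t) * (k + 0)\<^sup>2)))"
      using t by (simp add: gaussian_ft_def norm_mult norm_power norm_divide C_def power_divide abs_divide)
    also have "\<dots> \<le> C * (B / (1 + k\<^sup>2))" using B(2)[of k] C by (intro mult_left_mono) auto
    finally show ?thesis by simp
  qed
  then show ?thesis using B C by (intro exI[of _ "C * B"]) auto
qed

text \<open>Translation by \<open>u\<close> multiplies the transform at \<open>k\<close> by the
  phase \<open>expi (k * u)\<close>.\<close>

lemma poisson_gaussian:
  assumes t: "t > 0" and \<kappa>: "\<kappa> \<le> 1"
  shows "(\<Sum>\<^sub>\<infinity>n::int. complex_of_real ((n + u) ^ \<kappa> * exp (- (pi * t * (n + u)\<^sup>2)))) =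
         (\<Sum>\<^sub>\<infinity>k::int. gaussian_ft \<kappa> t k * expi (k * u))"
proof -
  obtain B1 where B1: "B1 > 0" "\<And>x. \<bar>x + u\<bar> ^ \<kappa> * exp (- (pi * t * (x + u)\<^sup>2)) \<le> B1 / (1 + x\<^sup>2)"
    using gaussian_shift_bound[OF t \<kappa>, of u] by blast
  obtain B2 where B2: "B2 > 0" "\<And>k. norm (gaussian_ft \<kappa> t k) \<le> B2 / (1 + k\<^sup>2)"
    using gaussian_ft_bound[OF t \<kappa>] by blast
  define h where "h x = complex_of_real (x ^ \<kappa> * exp (- (pi * t * x\<^sup>2)))" for x
  have "(\<Sum>\<^sub>\<infinity>n::int. h (real_of_int n + u)) = (\<Sum>\<^sub>\<infinity>k::int. gaussian_ft \<kappa> t k * expi (k * u))"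
  proof (rule poisson_summation[where f = "\<lambda>x. h (x + u)" and B = "B1 + B2"])
    show "continuous_on UNIV (\<lambda>x. h (x + u))" unfolding h_def by (intro continuous_intros)
    show "norm (h (x + u)) \<le> (B1 + B2) / (1 + x\<^sup>2)" for x
    proof -
      have "norm (h (x + u)) = \<bar>x + u\<bar> ^ \<kappa> * exp (- (pi * t * (x + u)\<^sup>2))"
        by (simp add: h_def norm_mult norm_power abs_mult power_abs del: of_real_mult of_real_power)
      also have "\<dots> \<le> B1 / (1 + x\<^sup>2)" by (rule B1)
      also have "\<dots> \<le> (B1 + B2) / (1 + x\<^sup>2)" using B2 by (intro divide_right_mono) auto
      finally show ?thesis .
    qed
    show "norm (gaussian_ft \<kappa> t (real_of_int k) * expi (real_of_int k * u)) \<le> (B1 + B2) / (1 + (real_of_int k)\<^sup>2)" for k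
    proof -
      have "norm (gaussian_ft \<kappa> t (real_of_int k) * expi (real_of_int k * u)) \<le> B2 / (1 + (real_of_int k)\<^sup>2)"
        using B2(2) by (simp add: norm_mult)
      also have "\<dots> \<le> (B1 + B2) / (1 + (real_of_int k)\<^sup>2)" using B1 by (intro divide_right_mono) auto
      finally show ?thesis .
    qed
    fix k :: int
    have "integral {-1/2 - real N..1/2 + real N} (\<lambda>x. h (x + u) * expi (- (real_of_int k * x))) =
       expi (real_of_int k * u) * integral {(u - 1/2) - real N..(u + 1/2) + real N} (\<lambda>x. h x * expi (- (real_of_int k * x)))" for N
    proof -
      have e: "h (x + u) * expi (- (real_of_int k * x)) =
          expi (real_of_int k * u) * (h (x + u) * expi (- (real_of_int k * (x + u))))" for x
      proof -
        have "expi (- (real_of_int k * x)) = expi (real_of_int k * u) * expi (- (real_of_int k * (x + u)))"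
          by (simp add: cis_mult algebra_simps)
        then show ?thesis by simp
      qed
      have "integral {-1/2 - real N..1/2 + real N} (\<lambda>x. h (x + u) * expi (- (real_of_int k * x))) =
          expi (real_of_int k * u) * integral {-1/2 - real N..1/2 + real N} (\<lambda>x. h (x + u) * expi (- (real_of_int k * (x + u))))"
        unfolding e by simp
      also have "integral {-1/2 - real N..1/2 + real N} (\<lambda>x. h (x + u) * expi (- (real_of_int k * (x + u)))) =
          integral {-1/2 - real N + u..1/2 + real N + u} (\<lambda>x. h x * expi (- (real_of_int k * x)))"
        using integral_shift_Icc_real[of "-1/2 - real N" "1/2 + real N" "\<lambda>x. h x * expi (- (real_of_int k * x))" u]
        by (simp add: o_def add.commute)
      finally show ?thesis by (simp add: algebra_simps)
    qed
    moreover have "(\<lambda>N. expi (real_of_int k * u) * integral {(u - 1/2) - real N..(u + 1/2) + real N} (\<lambda>x. h x * expi (- (real_of_int k * x))))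
       \<longlonglongrightarrow> expi (real_of_int k * u) * gaussian_ft \<kappa> t k"
      unfolding h_def by (intro tendsto_intros gaussian_ft t \<kappa>)
    ultimately show "(\<lambda>N. integral {-1/2 - real N..1/2 + real N} (\<lambda>x. h (x + u) * expi (- (real_of_int k * x))))
       \<longlonglongrightarrow> gaussian_ft \<kappa> t k * expi (real_of_int k * u)"
      by (simp add: mult.commute)
  qed
  then show ?thesis by (simp add: h_def)
qed

subsection \<open>Gauss sums\<close>

definition gauss_sum :: "nat \<Rightarrow> (int \<Rightarrow> complex) \<Rightarrow> int \<Rightarrow> complex" where
  "gauss_sum q chi n = (\<Sum>a\<in>{0..<int q}. chi a * expi (real_of_int (n * a) / real q))"

lemma expi_cong:
  assumes "q > 0" "[m = n] (mod int q)"
  shows "expi (real_of_int m / real q) = expi (real_of_int n / real q)"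
proof -
  obtain k where k: "m = n + int q * k" using assms(2) by (metis cong_iff_lin cong_sym)
  have "real_of_int m / real q = real_of_int n / real q + real_of_int k"
    using assms(1) by (simp add: k field_simps)
  then have "expi (real_of_int m / real q) = expi (real_of_int n / real q) * expi (real_of_int k)"
    by (simp only: distrib_left cis_mult[symmetric])
  also have "expi (real_of_int k) = 1" by (rule cis_multiple_2pi) auto
  finally show ?thesis by simp
qed

text \<open>For \<open>n\<close> coprime to \<open>q\<close>, substitute \<open>n * a\<close> for
  \<open>a\<close>. Otherwise both sides are 0: with \<open>d = q / gcd(n, q)\<close>, primitivity
  gives a unit \<open>m\<close>, congruent to 1 modulo \<open>d\<close>, with
  \<open>chi m \<noteq> 1\<close>. Substituting \<open>m * a\<close> leaves \<open>n * a\<close>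
  fixed modulo \<open>q\<close> but multiplies the sum by \<open>chi m\<close>.\<close>

lemma gauss_sum_primitive:
  assumes "primitive_character q chi"
  shows "gauss_sum q chi n = cnj (chi n) * gauss_sum q chi 1"
proof -
  have chi: "dirichlet_character q chi" using assms unfolding primitive_character_def by blast
  note D = dirichlet_characterD[OF chi]
  have q: "q > 0" by (rule D)
  have per: "chi (a + int q) * expi (real_of_int (k * (a + int q)) / real q) =
      chi a * expi (real_of_int (k * a) / real q)" for k a
    by (subst D(3), subst expi_cong[OF q, of "k * (a + int q)" "k * a"]) (auto simp: cong_def algebra_simps)
  show ?thesis
  proof (cases "coprime n (int q)")
    case True
    have "gauss_sum q chi 1 = (\<Sum>a\<in>{0..<int q}. chi (n * a) * expi (real_of_int (n * a) / real q))"
      unfolding gauss_sum_def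
      using sum_periodic_mult[OF q True, of "\<lambda>a. chi a * expi (real_of_int (1 * a) / real q)"] per[of _ 1]
      by simp
    also have "\<dots> = chi n * gauss_sum q chi n"
      by (simp add: gauss_sum_def D(2) sum_distrib_left mult.assoc)
    finally have "cnj (chi n) * gauss_sum q chi 1 = (chi n * cnj (chi n)) * gauss_sum q chi n"
      by (simp add: mult_ac)
    then show ?thesis using dirichlet_character_mult_cnj[OF chi True] by simp
  next
    case False
    define g where "g = nat (gcd n (int q))"
    have g: "int g = gcd n (int q)" by (simp add: g_def)
    have "g dvd q" using g by (metis gcd_dvd2 int_dvd_int_iff)
    then obtain d where d: "q = g * d" by blast
    have "g \<noteq> 1" using False g by (auto simp: coprime_iff_gcd_eq_1)
    then have "d \<noteq> q" using d q by auto
    then obtain m where m: "coprime m (int q)" "[m = 1] (mod int d)" "chi m \<noteq> 1"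
      using primitive_character_kernel[OF assms, of d] d by auto
    obtain n' where n': "n = int g * n'" using g by (metis dvdE gcd_dvd1)
    obtain j where j: "m - 1 = int d * j" using m(2) by (auto simp: cong_iff_dvd_diff)
    have "n * (m * a) - n * a = int q * (n' * j * a)" for a
    proof -
      have "n * (m * a) - n * a = n * (m - 1) * a" by (simp add: algebra_simps)
      then show ?thesis unfolding j by (simp add: n' d)
    qed
    then have c: "[n * (m * a) = n * a] (mod int q)" for a by (simp add: cong_iff_dvd_diff)
    have "gauss_sum q chi n = (\<Sum>a\<in>{0..<int q}. chi (m * a) * expi (real_of_int (n * (m * a)) / real q))"
      unfolding gauss_sum_def
      using sum_periodic_mult[OF q m(1), of "\<lambda>a. chi a * expi (real_of_int (n * a) / real q)"] per[of _ n]
      by simp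
    also have "\<dots> = (\<Sum>a\<in>{0..<int q}. chi m * (chi a * expi (real_of_int (n * a) / real q)))"
      by (intro sum.cong refl, subst expi_cong[OF q c]) (simp add: D(2))
    also have "\<dots> = chi m * gauss_sum q chi n" by (simp add: gauss_sum_def sum_distrib_left)
    finally have "(1 - chi m) * gauss_sum q chi n = 0" by (simp add: algebra_simps)
    then have "gauss_sum q chi n = 0" using m(3) by simp
    then show ?thesis using D(4)[of n] False by simp
  qed
qed

subsection \<open>Theta functions of characters\<close>

text \<open>The power \<open>n ^ \<kappa>\<close> is there to match the parity of
  \<open>chi\<close>, so that the terms at \<open>n\<close> and \<open>- n\<close> reinforce each
  other.\<close>

definition theta :: "nat \<Rightarrow> nat \<Rightarrow> (int \<Rightarrow> complex) \<Rightarrow> real \<Rightarrow> complex" where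
  "theta q \<kappa> chi x =
     (\<Sum>\<^sub>\<infinity>n::int. chi n * of_real (real_of_int n ^ \<kappa> * exp (- (pi * (real_of_int n)\<^sup>2 * x / real q))))"

lemma infsum_int_residues:
  fixes F :: "int \<Rightarrow> complex"
  assumes q: "q > 0" and F: "F summable_on UNIV"
  shows "(\<Sum>\<^sub>\<infinity>n. F n) = (\<Sum>a\<in>{0..<int q}. \<Sum>\<^sub>\<infinity>m. F (a + m * int q))"
proof -
  define h where "h p = fst p + snd p * int q" for p :: "int \<times> int"
  have bij: "bij_betw h ({0..<int q} \<times> UNIV) UNIV"
    by (rule bij_betw_byWitness[where f' = "\<lambda>n. (n mod int q, n div int q)"])
       (use q in \<open>auto simp: h_def\<close>)
  have "(\<Sum>\<^sub>\<infinity>n. F n) = (\<Sum>\<^sub>\<infinity>p\<in>{0..<int q} \<times> UNIV. F (h p))"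
    by (rule infsum_reindex_bij_betw[OF bij, symmetric])
  also have "\<dots> = (\<Sum>\<^sub>\<infinity>(a, m)\<in>{0..<int q} \<times> UNIV. F (a + m * int q))"
    by (simp add: h_def case_prod_unfold)
  also have "\<dots> = (\<Sum>\<^sub>\<infinity>a\<in>{0..<int q}. \<Sum>\<^sub>\<infinity>m. F (a + m * int q))"
  proof (rule infsum_Sigma'_banach[symmetric])
    have "(\<lambda>p. F (h p)) summable_on ({0..<int q} \<times> UNIV)"
      using F summable_on_reindex_bij_betw[OF bij, of F] by simp
    then show "(\<lambda>(a, m). F (a + m * int q)) summable_on {0..<int q} \<times> UNIV"
      by (simp add: h_def case_prod_unfold)
  qed
  finally show ?thesis by simp
qed

lemma has_sum_finite_sum:
  fixes f :: "'a \<Rightarrow> 'b \<Rightarrow> 'c :: topological_comm_monoid_add"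
  assumes "finite A" "\<And>a. a \<in> A \<Longrightarrow> (f a has_sum s a) B"
  shows "((\<lambda>x. \<Sum>a\<in>A. f a x) has_sum (\<Sum>a\<in>A. s a)) B"
  using assms by (induction A rule: finite_induct) (auto intro: has_sum_add)

lemma theta_term_bound:
  assumes q: "q > 0" and x: "x > 0" and \<kappa>: "\<kappa> \<le> 1" and chi: "dirichlet_character q chi"
  shows "\<exists>B>0. \<forall>n. norm (chi n * of_real (real_of_int n ^ \<kappa> * exp (- (pi * (real_of_int n)\<^sup>2 * x / real q))))
           \<le> B / (1 + (real_of_int n)\<^sup>2)"
proof -
  obtain B where B: "B > 0" "\<And>y. \<bar>y + 0\<bar> ^ \<kappa> * exp (- (pi * (x / q) * (y + 0)\<^sup>2)) \<le> B / (1 + y\<^sup>2)"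
    using gaussian_shift_bound[of "x / q" \<kappa> 0] q x \<kappa> divide_pos_pos[of x "real q"] by auto
  have "norm (chi n * of_real (real_of_int n ^ \<kappa> * exp (- (pi * (real_of_int n)\<^sup>2 * x / real q))))
           \<le> B / (1 + (real_of_int n)\<^sup>2)" for n
  proof -
    have "norm (chi n * of_real (real_of_int n ^ \<kappa> * exp (- (pi * (real_of_int n)\<^sup>2 * x / real q)))) =
        norm (chi n) * (\<bar>real_of_int n\<bar> ^ \<kappa> * exp (- (pi * (real_of_int n)\<^sup>2 * x / real q)))"
      by (simp add: norm_mult abs_mult power_abs del: of_real_mult of_real_power)
    also have "\<dots> \<le> 1 * (\<bar>real_of_int n\<bar> ^ \<kappa> * exp (- (pi * (real_of_int n)\<^sup>2 * x / real q)))"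
      using norm_dirichlet_character_le[OF chi] by (intro mult_right_mono) auto
    also have "\<dots> \<le> B / (1 + (real_of_int n)\<^sup>2)" using B(2)[of "real_of_int n"] by (simp add: mult_ac)
    finally show ?thesis .
  qed
  then show ?thesis using B(1) by blast
qed

lemma theta_summable:
  assumes q: "q > 0" and x: "x > 0" and \<kappa>: "\<kappa> \<le> 1" and chi: "dirichlet_character q chi"
  shows "(\<lambda>n. chi n * of_real (real_of_int n ^ \<kappa> * exp (- (pi * (real_of_int n)\<^sup>2 * x / real q)))) summable_on UNIV"
proof -
  obtain B where "\<And>n. norm (chi n * of_real (real_of_int n ^ \<kappa> * exp (- (pi * (real_of_int n)\<^sup>2 * x / real q))))
      \<le> B / (1 + (real_of_int n)\<^sup>2)"
    using theta_term_bound[OF assms] by blast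
  then show ?thesis by (rule abs_summable_summable[OF abs_summable_int_inverse_square])
qed

text \<open>Split the sum into residue classes \<open>a\<close> modulo \<open>q\<close> and apply
  Poisson summation to the Gaussian of parameter \<open>q * x\<close> shifted by
  \<open>a / q\<close>. The phases collected over \<open>a\<close> form a Gauss sum, which
  primitivity turns back into a character value at \<open>k\<close>.\<close>

lemma theta_functional_equation:
  assumes prim: "primitive_character q chi" and x: "x > 0" and \<kappa>: "\<kappa> \<le> 1"
  shows "theta q \<kappa> chi x = gauss_sum q chi 1 * (- \<i>) ^ \<kappa> / of_real (sqrt q * (x ^ \<kappa> * sqrt x)) *
           theta q \<kappa> (\<lambda>n. cnj (chi n)) (1 / x)"
proof -
  have chi: "dirichlet_character q chi" using prim unfolding primitive_character_def by blast
  note D = dirichlet_characterD[OF chi]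
  have q: "q > 0" by (rule D)
  define t where "t = real q * x"
  have t: "t > 0" using q x by (simp add: t_def)
  let ?F = "\<lambda>n::int. chi n * complex_of_real (real_of_int n ^ \<kappa> * exp (- (pi * (real_of_int n)\<^sup>2 * x / real q)))"
  have "theta q \<kappa> chi x = (\<Sum>a\<in>{0..<int q}. \<Sum>\<^sub>\<infinity>m. ?F (a + m * int q))"
    unfolding theta_def by (rule infsum_int_residues[OF q theta_summable[OF q x \<kappa> chi]])
  also have "\<dots> = (\<Sum>a\<in>{0..<int q}. of_nat q ^ \<kappa> * chi a * (\<Sum>\<^sub>\<infinity>k::int. gaussian_ft \<kappa> t k * expi (k * (a / q))))"
  proof (intro sum.cong refl)
    fix a :: int
    have "?F (a + m * int q) = (of_nat q ^ \<kappa> * chi a) *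
        of_real ((real_of_int m + a / q) ^ \<kappa> * exp (- (pi * t * (real_of_int m + a / q)\<^sup>2)))" for m
    proof -
      have y: "real_of_int (a + m * int q) = real q * (real_of_int m + a / q)" using q by (simp add: field_simps)
      have e: "pi * (real q * y)\<^sup>2 * x / real q = pi * t * y\<^sup>2" for y
        using q by (simp add: t_def power2_eq_square)
      have "complex_of_real ((real q * y) ^ \<kappa> * exp (- (pi * (real q * y)\<^sup>2 * x / real q))) =
          of_nat q ^ \<kappa> * of_real (y ^ \<kappa> * exp (- (pi * t * y\<^sup>2)))" for y
        unfolding e by (simp add: power_mult_distrib)
      moreover have "chi (a + m * int q) = chi a" by (rule dirichlet_character_cong[OF chi]) (simp add: cong_def)
      ultimately show ?thesis unfolding y by (simp only: mult.assoc mult.left_commute)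
    qed
    then have "(\<Sum>\<^sub>\<infinity>m. ?F (a + m * int q)) = (of_nat q ^ \<kappa> * chi a) *
        (\<Sum>\<^sub>\<infinity>m::int. of_real ((real_of_int m + a / q) ^ \<kappa> * exp (- (pi * t * (real_of_int m + a / q)\<^sup>2))))"
      by (simp only: infsum_cmult_right')
    also have "(\<Sum>\<^sub>\<infinity>m::int. of_real ((real_of_int m + a / q) ^ \<kappa> * exp (- (pi * t * (real_of_int m + a / q)\<^sup>2)))) =
        (\<Sum>\<^sub>\<infinity>k::int. gaussian_ft \<kappa> t k * expi (k * (a / q)))"
      by (rule poisson_gaussian[OF t \<kappa>])
    finally show "(\<Sum>\<^sub>\<infinity>m. ?F (a + m * int q)) =
        of_nat q ^ \<kappa> * chi a * (\<Sum>\<^sub>\<infinity>k::int. gaussian_ft \<kappa> t k * expi (k * (a / q)))" .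
  qed
  also have "\<dots> = (\<Sum>a\<in>{0..<int q}. \<Sum>\<^sub>\<infinity>k::int. of_nat q ^ \<kappa> * chi a * (gaussian_ft \<kappa> t k * expi (k * (a / q))))"
    by (simp only: infsum_cmult_right')
  also have "\<dots> = (\<Sum>\<^sub>\<infinity>k::int. \<Sum>a\<in>{0..<int q}. of_nat q ^ \<kappa> * chi a * (gaussian_ft \<kappa> t k * expi (k * (a / q))))"
  proof (rule infsumI[symmetric], rule has_sum_finite_sum[OF finite_atLeastLessThan_int])
    fix a :: int
    obtain B where B: "B > 0" "\<And>k. norm (gaussian_ft \<kappa> t k) \<le> B / (1 + k\<^sup>2)"
      using gaussian_ft_bound[OF t \<kappa>] by blast
    have "(\<lambda>k::int. gaussian_ft \<kappa> t k * expi (k * (a / q))) summable_on UNIV"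
      by (rule abs_summable_summable[OF abs_summable_int_inverse_square[of _ B]]) (use B(2) in \<open>simp add: norm_mult\<close>)
    then show "((\<lambda>k::int. of_nat q ^ \<kappa> * chi a * (gaussian_ft \<kappa> t k * expi (k * (a / q)))) has_sum
        (\<Sum>\<^sub>\<infinity>k::int. of_nat q ^ \<kappa> * chi a * (gaussian_ft \<kappa> t k * expi (k * (a / q))))) UNIV"
      by (intro has_sum_infsum summable_on_cmult_right)
  qed
  also have "\<dots> = (\<Sum>\<^sub>\<infinity>k::int. gauss_sum q chi 1 * (- \<i>) ^ \<kappa> / of_real (sqrt q * (x ^ \<kappa> * sqrt x)) *
       (cnj (chi k) * of_real (real_of_int k ^ \<kappa> * exp (- (pi * (real_of_int k)\<^sup>2 * (1 / x) / real q)))))"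
  proof (rule infsum_cong)
    fix k :: int
    have "(\<Sum>a\<in>{0..<int q}. of_nat q ^ \<kappa> * chi a * (gaussian_ft \<kappa> t k * expi (k * (a / q)))) =
        of_nat q ^ \<kappa> * gaussian_ft \<kappa> t k * gauss_sum q chi k"
      by (simp add: gauss_sum_def sum_distrib_left mult_ac)
    also have "\<dots> = of_nat q ^ \<kappa> * gaussian_ft \<kappa> t k * (cnj (chi k) * gauss_sum q chi 1)"
      by (subst gauss_sum_primitive[OF prim]) simp
    also have "of_nat q ^ \<kappa> * gaussian_ft \<kappa> t k = (- \<i>) ^ \<kappa> / of_real (sqrt q * (x ^ \<kappa> * sqrt x)) *
        of_real (real_of_int k ^ \<kappa> * exp (- (pi * (real_of_int k)\<^sup>2 * (1 / x) / real q)))"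
    proof -
      have e1: "pi * (real_of_int k)\<^sup>2 / t = pi * (real_of_int k)\<^sup>2 * (1 / x) / real q" by (simp add: t_def mult.commute)
      have e2: "sqrt t = sqrt q * sqrt x" by (simp add: t_def real_sqrt_mult)
      have e3: "of_nat q ^ \<kappa> * (- \<i> * complex_of_real (real_of_int k) / of_real t) ^ \<kappa> =
          (- \<i>) ^ \<kappa> * of_int k ^ \<kappa> / of_real x ^ \<kappa>"
        using q x by (simp add: t_def power_mult_distrib[symmetric] power_divide[symmetric])
      show ?thesis unfolding gaussian_ft_def e1
        by (simp only: mult.assoc[symmetric] e3 e2) (simp add: mult_ac)
    qed
    finally show "(\<Sum>a\<in>{0..<int q}. of_nat q ^ \<kappa> * chi a * (gaussian_ft \<kappa> t k * expi (k * (a / q)))) =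
        gauss_sum q chi 1 * (- \<i>) ^ \<kappa> / of_real (sqrt q * (x ^ \<kappa> * sqrt x)) *
       (cnj (chi k) * of_real (real_of_int k ^ \<kappa> * exp (- (pi * (real_of_int k)\<^sup>2 * (1 / x) / real q))))"
      by (simp add: mult_ac)
  qed
  finally show ?thesis unfolding theta_def by (simp only: infsum_cmult_right')
qed

lemma theta_cnj: "theta q \<kappa> (\<lambda>n. cnj (chi n)) x = cnj (theta q \<kappa> chi x)"
  unfolding theta_def by (simp flip: infsum_cnj)

text \<open>Since \<open>chi\<close> and \<open>n ^ \<kappa>\<close> have the same parity, the terms
  at \<open>n\<close> and \<open>- n\<close> agree; \<open>q > 1\<close> gives
  \<open>chi 0 = 0\<close>, so there is no constant term.\<close>

lemma theta_sums:
  assumes chi: "dirichlet_character q chi" and q: "q > 1" and \<kappa>: "\<kappa> \<le> 1" and x: "x > 0"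
    and parity: "chi (-1) = (-1) ^ \<kappa>"
  shows "(\<lambda>n. 2 * (chi (int (Suc n)) * of_real (real (Suc n) ^ \<kappa> * exp (- (pi * (real (Suc n))\<^sup>2 * x / real q)))))
           sums theta q \<kappa> chi x"
proof -
  let ?F = "\<lambda>n::int. chi n * complex_of_real (real_of_int n ^ \<kappa> * exp (- (pi * (real_of_int n)\<^sup>2 * x / real q)))"
  have chi0: "chi 0 = 0" using dirichlet_characterD(4)[OF chi, of 0] q by auto
  have even: "?F (- n) = ?F n" for n
  proof -
    have "chi (- n) = (-1) ^ \<kappa> * chi n" using dirichlet_characterD(2)[OF chi, of "-1" n] parity by simp
    then show ?thesis using \<kappa> by (cases "\<kappa> = 0") (auto simp: le_Suc_eq)
  qed
  have "(\<Sum>n<N. 2 * ?F (int (Suc n))) = (\<Sum>n\<in>{-int N..int N}. ?F n)" for N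
  proof (induction N)
    case 0
    then show ?case by (simp add: chi0)
  next
    case (Suc N)
    then show ?case unfolding sum_symmetric_int even by (simp del: of_nat_Suc)
  qed
  moreover have "(\<lambda>N. \<Sum>n\<in>{-int N..int N}. ?F n) \<longlonglongrightarrow> theta q \<kappa> chi x"
    unfolding theta_def using q by (intro infsum_int_symmetric theta_summable chi \<kappa> x) auto
  ultimately have "(\<lambda>n. 2 * ?F (int (Suc n))) sums theta q \<kappa> chi x" unfolding sums_def by simp
  then show ?thesis by simp
qed

text \<open>In the absence of a constant term, the terms at 1 and -1 set the rate of decay.\<close>

lemma theta_bound:
  assumes chi: "dirichlet_character q chi" and q: "q > 1" and \<kappa>: "\<kappa> \<le> 1" and parity: "chi (-1) = (-1) ^ \<kappa>"
  shows "\<exists>C. \<forall>x\<ge>1. norm (theta q \<kappa> chi x) \<le> C * exp (- (pi / q * x))"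
proof -
  define c where "c = pi / real q"
  have c: "c > 0" using q by (simp add: c_def)
  define h where "h x n = 2 * (chi (int (Suc n)) * complex_of_real (real (Suc n) ^ \<kappa> * exp (- (pi * (real (Suc n))\<^sup>2 * x / real q))))"
    for x n
  define T where "T n = 2 * (real (Suc n) ^ \<kappa> * exp (- (c * (real (Suc n))\<^sup>2)))" for n
  obtain B where B: "B > 0" "\<And>y. \<bar>y + 0\<bar> ^ \<kappa> * exp (- (pi * (1 / q) * (y + 0)\<^sup>2)) \<le> B / (1 + y\<^sup>2)"
    using gaussian_shift_bound[of "1 / q" \<kappa> 0] q \<kappa> by auto
  have T: "summable T"
  proof (rule summable_comparison_test'[of "\<lambda>n. 2 * B / (1 + real n ^ 2)" 0])
    show "summable (\<lambda>n. 2 * B / (1 + real n ^ 2))" by (rule summable_inverse_square_shift)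
    show "norm (T n) \<le> 2 * B / (1 + real n ^ 2)" for n
    proof -
      have "norm (T n) = 2 * (\<bar>real (Suc n)\<bar> ^ \<kappa> * exp (- (c * (real (Suc n))\<^sup>2)))" by (simp add: T_def)
      also have "\<dots> \<le> 2 * (B / (1 + (real (Suc n))\<^sup>2))"
        using B(2)[of "real (Suc n)"] by (intro mult_left_mono) (auto simp: c_def)
      also have "\<dots> \<le> 2 * (B / (1 + real n ^ 2))"
        using B(1) by (intro mult_left_mono divide_left_mono add_left_mono power_mono) (auto intro!: mult_pos_pos add_pos_nonneg)
      finally show ?thesis by simp
    qed
  qed
  have "norm (theta q \<kappa> chi x) \<le> (exp c * (\<Sum>n. T n)) * exp (- (c * x))" if x: "x \<ge> 1" for x
  proof -
    have hb: "norm (h x n) \<le> exp c * exp (- (c * x)) * T n" for n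
    proof -
      define y where "y = (real (Suc n))\<^sup>2"
      have y: "y \<ge> 1" by (simp add: y_def)
      have "norm (h x n) = 2 * norm (chi (int (Suc n))) * (real (Suc n) ^ \<kappa> * exp (- (c * y * x)))"
        unfolding h_def y_def c_def
        by (simp only: norm_mult norm_of_real abs_mult abs_exp_cancel abs_of_nat power_abs) simp
      also have "\<dots> \<le> 2 * 1 * (real (Suc n) ^ \<kappa> * (exp c * exp (- (c * x)) * exp (- (c * y))))"
      proof (intro mult_mono)
        \<comment> \<open>From \<open>y * x \<ge> x + y - 1\<close> the exponential splits, so one
          convergent series in \<open>n\<close> serves all \<open>x \<ge> 1\<close>.\<close>
        have "0 \<le> c * ((y - 1) * (x - 1))" using c x y by simp
        then have "- (c * y * x) \<le> c + - (c * x) + - (c * y)" by (simp add: algebra_simps)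
        then show "exp (- (c * y * x)) \<le> exp c * exp (- (c * x)) * exp (- (c * y))"
          by (simp only: exp_add[symmetric] exp_le_cancel_iff)
      qed (use norm_dirichlet_character_le[OF chi] in auto)
      also have "\<dots> = exp c * exp (- (c * x)) * T n" by (simp add: T_def y_def)
      finally show ?thesis .
    qed
    have sm: "summable (\<lambda>n. exp c * exp (- (c * x)) * T n)" using T by (rule summable_mult)
    have hs: "h x sums theta q \<kappa> chi x"
      unfolding h_def using theta_sums[OF chi q \<kappa> _ parity, of x] x by simp
    have hn: "summable (\<lambda>n. norm (h x n))"
      using hb by (intro summable_comparison_test'[OF sm, of 0]) auto
    have "norm (theta q \<kappa> chi x) \<le> (\<Sum>n. norm (h x n))"
      using summable_norm[OF hn] sums_unique[OF hs] by simp
    also have "\<dots> \<le> (\<Sum>n. exp c * exp (- (c * x)) * T n)" by (rule suminf_le[OF hb hn sm])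
    also have "\<dots> = exp c * exp (- (c * x)) * (\<Sum>n. T n)" by (rule suminf_mult[OF T])
    finally show ?thesis by (simp add: mult_ac)
  qed
  then show ?thesis unfolding c_def by blast
qed

subsection \<open>The completed L-function\<close>

text \<open>Euler's integral after the substitution of \<open>exp u\<close>; a translation of
  \<open>u\<close> by \<open>ln a\<close> produces the power of \<open>a\<close>. In this scale
  Mellin transforms become integrals over the whole line.\<close>

lemma Gamma_integral_exp:
  fixes w :: complex and a :: real
  assumes w: "Re w > 0" and a: "a > 0"
  shows "integrable lborel (\<lambda>u. exp (of_real u * w - of_real (a * exp u)))"
    and "(LBINT u. exp (of_real u * w - of_real (a * exp u))) = exp (- (w * of_real (ln a))) * Gamma w"
proof -
  let ?f = "\<lambda>t. complex_of_real t powr (w - 1) / of_real (exp t)"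
  let ?G = "\<lambda>u. exp (of_real u * w - of_real (exp u))"
  have range: "exp ` UNIV = {0::real<..}"
  proof (intro subset_antisym subsetI)
    fix x :: real assume "x \<in> {0<..}"
    then show "x \<in> exp ` UNIV" by (intro image_eqI[of _ _ "ln x"]) auto
  qed auto
  have "?f absolutely_integrable_on exp ` UNIV \<and> integral (exp ` UNIV) ?f = Gamma w"
    unfolding range using absolutely_integrable_Gamma_integral'[OF w] Gamma_integral_complex'[OF w]
    by (auto intro: integral_unique)
  then have "(\<lambda>u. \<bar>exp u\<bar> *\<^sub>R ?f (exp u)) absolutely_integrable_on UNIV \<and>
      integral UNIV (\<lambda>u. \<bar>exp u\<bar> *\<^sub>R ?f (exp u)) = Gamma w"
    by (subst has_absolute_integral_change_of_variables_real) (auto intro!: derivative_eq_intros inj_onI)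
  moreover have "\<bar>exp u\<bar> *\<^sub>R ?f (exp u) = ?G u" for u :: real
  proof -
    have "complex_of_real (exp u) powr (w - 1) = exp ((w - 1) * of_real u)"
      by (simp add: powr_def Ln_of_real)
    then have "\<bar>exp u\<bar> *\<^sub>R ?f (exp u) = exp (of_real u) * exp ((w - 1) * of_real u) * exp (- of_real (exp u))"
      by (simp add: scaleR_conv_of_real exp_of_real exp_minus divide_inverse)
    also have "\<dots> = ?G u" by (simp add: exp_add[symmetric] algebra_simps)
    finally show ?thesis .
  qed
  ultimately have *: "?G absolutely_integrable_on UNIV" "integral UNIV ?G = Gamma w" by auto
  have "?G \<in> borel_measurable borel"
    by (intro borel_measurable_continuous_onI continuous_intros)
  then have "?G \<in> borel_measurable lborel" by simp
  then have int: "integrable lborel ?G"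
    using *(1) integrable_completion[of ?G lborel] by (simp add: set_integrable_def)
  have val: "(LBINT u. ?G u) = Gamma w" using integral_lborel[OF int] *(2) by simp
  have sh: "exp (of_real u * w - of_real (a * exp u)) = exp (- (w * of_real (ln a))) * ?G (ln a + 1 * u)" for u
  proof -
    have "exp (ln a + 1 * u) = a * exp u" using a by (simp add: exp_add)
    then show ?thesis by (simp only: exp_add[symmetric]) (simp add: algebra_simps)
  qed
  show "integrable lborel (\<lambda>u. exp (of_real u * w - of_real (a * exp u)))"
    unfolding sh using lborel_integrable_real_affine[OF int, of 1 "ln a"] by simp
  show "(LBINT u. exp (of_real u * w - of_real (a * exp u))) = exp (- (w * of_real (ln a))) * Gamma w"
    unfolding sh using lborel_integral_real_affine[of 1 ?G "ln a"] val by simp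
qed

text \<open>The theta function in logarithmic scale, weighted so that the functional equation becomes a
  reflection.\<close>

definition log_theta :: "nat \<Rightarrow> nat \<Rightarrow> (int \<Rightarrow> complex) \<Rightarrow> real \<Rightarrow> complex" where
  "log_theta q \<kappa> chi u = theta q \<kappa> chi (exp u) * of_real (exp ((real \<kappa> + 1/2) / 2 * u))"

text \<open>The constant \<open>W\<close> of the functional equation
  \<open>\<xi>(1 - cnj s) = W * cnj (\<xi>(s))\<close>.\<close>

definition root_const :: "nat \<Rightarrow> nat \<Rightarrow> (int \<Rightarrow> complex) \<Rightarrow> complex" where
  "root_const q \<kappa> chi = gauss_sum q chi 1 * (- \<i>) ^ \<kappa> / of_real (sqrt q)"

text \<open>With \<open>x = exp u\<close> this is the Mellin transform of theta at
  \<open>(s + \<kappa>) / 2\<close>. The weight in \<open>log_theta\<close> centres it at 1/2, so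
  that \<open>s \<mapsto> 1 - cnj s\<close> corresponds to \<open>u \<mapsto> - u\<close>. Decay in
  both directions makes the integral converge for every \<open>s\<close>.\<close>

definition completed_L :: "nat \<Rightarrow> nat \<Rightarrow> (int \<Rightarrow> complex) \<Rightarrow> complex \<Rightarrow> complex" where
  "completed_L q \<kappa> chi s = (LBINT u. log_theta q \<kappa> chi u * exp ((s - 1/2) / 2 * of_real u))"

text \<open>The condition \<open>q1\<close> sets the zeta function apart: it makes
  \<open>chi 0 = 0\<close>, so the theta function decays at infinity and the completed L-function is
  entire.\<close>

locale primitive_parity =
  fixes q \<kappa> :: nat and chi :: "int \<Rightarrow> complex"
  assumes primitive: "primitive_character q chi" and q1: "q > 1"
    and \<kappa>: "\<kappa> \<le> 1" and parity: "chi (-1) = (-1) ^ \<kappa>"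
begin

lemma chi: "dirichlet_character q chi"
  using primitive unfolding primitive_character_def by blast

text \<open>The exponent \<open>(\<kappa> + 1/2) / 2\<close> in the weight is half of that in the
  factor \<open>x ^ \<kappa> * sqrt x\<close> of the theta equation, which is thus shared evenly
  between \<open>u\<close> and \<open>- u\<close>.\<close>

lemma log_theta_reflect: "log_theta q \<kappa> chi u = root_const q \<kappa> chi * cnj (log_theta q \<kappa> chi (- u))"
proof -
  have sq: "sqrt (exp u) = exp (u / 2)" by (simp add: real_sqrt_unique power2_eq_square exp_add[symmetric])
  have "exp u ^ \<kappa> * sqrt (exp u) = exp ((real \<kappa> + 1/2) * u)"
    by (simp add: sq exp_of_nat_mult[symmetric] exp_add[symmetric] algebra_simps)
  moreover have "exp ((real \<kappa> + 1/2) / 2 * u) = exp ((real \<kappa> + 1/2) * u) * exp ((real \<kappa> + 1/2) / 2 * (- u))"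
    by (simp add: exp_add[symmetric] field_simps)
  ultimately show ?thesis
    unfolding log_theta_def root_const_def
    by (simp add: theta_functional_equation[OF primitive exp_gt_zero \<kappa>, of u] theta_cnj exp_minus inverse_eq_divide field_simps)
qed

lemma log_theta_measurable [measurable]: "log_theta q \<kappa> chi \<in> borel_measurable borel"
proof -
  define h where "h n u = 2 * (chi (int (Suc n)) * complex_of_real (real (Suc n) ^ \<kappa> * exp (- (pi * (real (Suc n))\<^sup>2 * exp u / real q))))"
    for n u
  have [measurable]: "h n \<in> borel_measurable borel" for n
    unfolding h_def by (intro borel_measurable_continuous_onI continuous_intros) (use q1 in auto)
  have "theta q \<kappa> chi (exp u) = (\<Sum>n. h n u)" for u
    unfolding h_def by (rule sums_unique[OF theta_sums[OF chi q1 \<kappa> exp_gt_zero parity]])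
  then have "log_theta q \<kappa> chi = (\<lambda>u. (\<Sum>n. h n u) * of_real (exp ((real \<kappa> + 1/2) / 2 * u)))"
    by (simp add: log_theta_def fun_eq_iff)
  then show ?thesis by simp
qed

text \<open>The decay is doubly exponential as \<open>u\<close> grows, and reflection carries it
  over to negative \<open>u\<close>. What is kept is tailored to later use: the cube yields the
  growth exponent 3/2, the square an integrable majorant.\<close>

lemma log_theta_bound: "\<exists>B. B \<ge> 0 \<and> (\<forall>u. norm (log_theta q \<kappa> chi u) \<le> B * exp (- (\<bar>u\<bar> ^ 3 + u\<^sup>2)))"
proof -
  define c where "c = pi / real q"
  have c: "c > 0" using q1 by (simp add: c_def)
  obtain C where C: "\<And>x. x \<ge> 1 \<Longrightarrow> norm (theta q \<kappa> chi x) \<le> C * exp (- (c * x))"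
    using theta_bound[OF chi q1 \<kappa> parity] unfolding c_def by blast
  have C0: "C \<ge> 0" using order_trans[OF norm_ge_zero C[of 1]] by (simp add: zero_le_mult_iff)
  have "\<forall>\<^sub>F u in at_top. c * exp u - u - u ^ 3 - u\<^sup>2 \<ge> 0" using c by real_asymp
  then obtain U where U: "\<And>u. u \<ge> U \<Longrightarrow> c * exp u - u - u ^ 3 - u\<^sup>2 \<ge> 0"
    unfolding eventually_at_top_linorder by blast
  \<comment> \<open>An allowance for the bounded range below \<open>U\<close>, where the asymptotic
    inequality may fail.\<close>
  define K where "K = \<bar>U\<bar> + \<bar>U\<bar> ^ 3 + \<bar>U\<bar>\<^sup>2"
  have K: "c * exp u - u - u ^ 3 - u\<^sup>2 \<ge> - K" if "u \<ge> 0" for u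
  proof (cases "u \<ge> U")
    case True
    then show ?thesis using U[OF True] by (simp add: K_def) (smt (verit) zero_le_power abs_ge_zero zero_le_power2)
  next
    case False
    then have "u \<le> \<bar>U\<bar>" by simp
    then have "u + u ^ 3 + u\<^sup>2 \<le> K" unfolding K_def using that by (intro add_mono power_mono) auto
    moreover have "c * exp u \<ge> 0" using c by simp
    ultimately show ?thesis by linarith
  qed
  define B where "B = C * exp K"
  have B0: "B \<ge> 0" using C0 by (simp add: B_def)
  have pos: "norm (log_theta q \<kappa> chi u) \<le> B * exp (- (\<bar>u\<bar> ^ 3 + u\<^sup>2))" if u: "u \<ge> 0" for u
  proof -
    have "norm (log_theta q \<kappa> chi u) = norm (theta q \<kappa> chi (exp u)) * exp ((real \<kappa> + 1/2) / 2 * u)"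
      by (simp add: log_theta_def norm_mult)
    also have "\<dots> \<le> (C * exp (- (c * exp u))) * exp u"
    proof (intro mult_mono C)
      have "(real \<kappa> + 1/2) / 2 * u \<le> 1 * u" using \<kappa> u by (intro mult_right_mono) auto
      then show "exp ((real \<kappa> + 1/2) / 2 * u) \<le> exp u" by simp
    qed (use u C0 in auto)
    also have "\<dots> = C * exp (u - c * exp u)" by (simp add: exp_diff exp_minus field_simps)
    also have "\<dots> \<le> C * exp (K + - (\<bar>u\<bar> ^ 3 + u\<^sup>2))"
      using K[OF u] u C0 by (intro mult_left_mono) auto
    also have "\<dots> = B * exp (- (\<bar>u\<bar> ^ 3 + u\<^sup>2))" by (simp only: B_def exp_add mult.assoc)
    finally show ?thesis .
  qed
  define B' where "B' = B + norm (root_const q \<kappa> chi) * B"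
  have "norm (log_theta q \<kappa> chi u) \<le> B' * exp (- (\<bar>u\<bar> ^ 3 + u\<^sup>2))" for u
  proof (cases "u \<ge> 0")
    case True
    have "B * exp (- (\<bar>u\<bar> ^ 3 + u\<^sup>2)) \<le> B' * exp (- (\<bar>u\<bar> ^ 3 + u\<^sup>2))"
      unfolding B'_def using B0 by (intro mult_right_mono) auto
    then show ?thesis using pos[OF True] by linarith
  next
    case False
    have "norm (log_theta q \<kappa> chi u) = norm (root_const q \<kappa> chi) * norm (log_theta q \<kappa> chi (- u))"
      by (subst log_theta_reflect) (simp add: norm_mult)
    also have "\<dots> \<le> norm (root_const q \<kappa> chi) * (B * exp (- (\<bar>- u\<bar> ^ 3 + (- u)\<^sup>2)))"
      using pos[of "- u"] False by (intro mult_left_mono) auto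
    also have "\<dots> = (norm (root_const q \<kappa> chi) * B) * exp (- (\<bar>u\<bar> ^ 3 + u\<^sup>2))" by simp
    also have "\<dots> \<le> B' * exp (- (\<bar>u\<bar> ^ 3 + u\<^sup>2))"
      unfolding B'_def using B0 by (intro mult_right_mono) auto
    finally show ?thesis .
  qed
  moreover have "B' \<ge> 0" using B0 by (simp add: B'_def)
  ultimately show ?thesis by blast
qed

text \<open>Either \<open>|u| \<le> sqrt R\<close>, and then \<open>R * |u|\<close> is at most
  \<open>R powr (3/2)\<close>, or \<open>R \<le> |u| ^ 2\<close>, and then it is at most the cube
  that the decay provides.\<close>

lemma log_theta_weighted:
  obtains B where "B \<ge> 0"
    "\<And>R u. R \<ge> 0 \<Longrightarrow> norm (log_theta q \<kappa> chi u) * exp (R * \<bar>u\<bar>) \<le> B * exp (R powr (3/2)) * exp (- u\<^sup>2)"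
proof -
  obtain B where B: "B \<ge> 0" "\<And>u. norm (log_theta q \<kappa> chi u) \<le> B * exp (- (\<bar>u\<bar> ^ 3 + u\<^sup>2))"
    using log_theta_bound by blast
  have "norm (log_theta q \<kappa> chi u) * exp (R * \<bar>u\<bar>) \<le> B * exp (R powr (3/2)) * exp (- u\<^sup>2)" if R: "R \<ge> 0" for R u
  proof -
    have "R * \<bar>u\<bar> \<le> R powr (3/2) + \<bar>u\<bar> ^ 3"
    proof (cases "\<bar>u\<bar> \<le> sqrt R")
      case True
      then have "R * \<bar>u\<bar> \<le> R * sqrt R" using R by (intro mult_left_mono)
      also have "\<dots> = R powr (1 + 1/2)" using R by (simp only: powr_add) (simp add: powr_half_sqrt)
      finally show ?thesis by (rule order_trans) simp
    next
      case False
      then have "sqrt R ^ 2 \<le> \<bar>u\<bar> ^ 2" by (intro power_mono) (use R in auto)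
      then have "R * \<bar>u\<bar> \<le> \<bar>u\<bar> ^ 2 * \<bar>u\<bar>" using R by (intro mult_right_mono) auto
      also have "\<dots> = \<bar>u\<bar> ^ 3" by (simp add: power3_eq_cube power2_eq_square)
      finally show ?thesis by (simp add: add_increasing)
    qed
    then have "exp (R * \<bar>u\<bar>) \<le> exp (R powr (3/2) + \<bar>u\<bar> ^ 3)" by simp
    then have "norm (log_theta q \<kappa> chi u) * exp (R * \<bar>u\<bar>) \<le>
        (B * exp (- (\<bar>u\<bar> ^ 3 + u\<^sup>2))) * exp (R powr (3/2) + \<bar>u\<bar> ^ 3)"
      using B by (intro mult_mono) auto
    also have "\<dots> = B * exp (R powr (3/2)) * exp (- u\<^sup>2)"
    proof -
      have "exp (- (\<bar>u\<bar> ^ 3 + u\<^sup>2)) * exp (R powr (3/2) + \<bar>u\<bar> ^ 3) = exp (R powr (3/2)) * exp (- u\<^sup>2)"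
        by (simp add: exp_add[symmetric])
      then show ?thesis by (simp only: mult.assoc)
    qed
    finally show ?thesis .
  qed
  then show ?thesis using that B(1) by blast
qed

lemma integrable_exp_neg_square: "integrable lborel (\<lambda>u::real. exp (- u\<^sup>2))"
  using integrable_norm[OF gaussian_integral(1)[of "1 / pi" 0]] by simp

lemma log_theta_integrable:
  assumes "R \<ge> 0"
  shows "integrable lborel (\<lambda>u. norm (log_theta q \<kappa> chi u) * exp (R * \<bar>u\<bar>))"
proof -
  obtain B where B: "\<And>R u. R \<ge> 0 \<Longrightarrow> norm (log_theta q \<kappa> chi u) * exp (R * \<bar>u\<bar>) \<le> B * exp (R powr (3/2)) * exp (- u\<^sup>2)"
    using log_theta_weighted by metis
  show ?thesis
  proof (rule Bochner_Integration.integrable_bound[OF integrable_mult_right[OF integrable_exp_neg_square, of "B * exp (R powr (3/2))"]])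
    show "AE u in lborel. norm (norm (log_theta q \<kappa> chi u) * exp (R * \<bar>u\<bar>)) \<le> norm (B * exp (R powr (3/2)) * exp (- u\<^sup>2))"
      using B[OF assms] by (intro AE_I2) (smt (verit) real_norm_def mult_nonneg_nonneg norm_ge_zero exp_ge_zero)
  qed simp
qed

lemma completed_L_growth:
  obtains C where "\<And>s. norm (completed_L q \<kappa> chi s) \<le> C * exp ((norm ((s - 1/2) / 2)) powr (3/2))"
proof -
  obtain B where B: "\<And>R u. R \<ge> 0 \<Longrightarrow> norm (log_theta q \<kappa> chi u) * exp (R * \<bar>u\<bar>) \<le> B * exp (R powr (3/2)) * exp (- u\<^sup>2)"
    using log_theta_weighted by metis
  define C where "C = B * (LBINT u. exp (- u\<^sup>2))"
  have "norm (completed_L q \<kappa> chi s) \<le> C * exp ((norm ((s - 1/2) / 2)) powr (3/2))" for s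
  proof -
    define z where "z = (s - 1/2) / 2"
    have "norm (completed_L q \<kappa> chi s) \<le> (LBINT u. B * exp (norm z powr (3/2)) * exp (- u\<^sup>2))"
      unfolding completed_L_def z_def[symmetric]
    proof (rule order_trans[OF integral_norm_bound integral_mono])
      show "integrable lborel (\<lambda>u. B * exp (norm z powr (3/2)) * exp (- u\<^sup>2))"
        using integrable_exp_neg_square by simp
      have le: "norm (log_theta q \<kappa> chi u * exp (z * of_real u)) \<le> norm (log_theta q \<kappa> chi u) * exp (norm z * \<bar>u\<bar>)" for u
      proof -
        have "Re (z * of_real u) \<le> norm (z * of_real u)" by (rule complex_Re_le_cmod)
        then show ?thesis by (simp add: norm_mult mult_left_mono)
      qed
      show "norm (log_theta q \<kappa> chi u * exp (z * of_real u)) \<le> B * exp (norm z powr (3/2)) * exp (- u\<^sup>2)" for u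
        using le[of u] B[of "norm z" u] by simp
      show "integrable lborel (\<lambda>u. norm (log_theta q \<kappa> chi u * exp (z * of_real u)))"
        by (rule integrable_norm, rule Bochner_Integration.integrable_bound[OF log_theta_integrable[of "norm z"]]) (use le in auto)
    qed
    also have "\<dots> = C * exp (norm z powr (3/2))" by (simp add: C_def)
    finally show ?thesis unfolding z_def .
  qed
  then show ?thesis using that by blast
qed

text \<open>Expanding the exponential and integrating term by term gives a power series in
  \<open>(s - 1/2) / 2\<close> that converges everywhere; the integrable majorant is
  \<open>norm (log_theta q \<kappa> chi u) * exp (norm z * |u|)\<close>.\<close>

lemma completed_L_holomorphic: "completed_L q \<kappa> chi holomorphic_on UNIV"
proof -
  define F where "F z = (LBINT u. log_theta q \<kappa> chi u * exp (z * of_real u))" for z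
  define a where "a n = (LBINT u. log_theta q \<kappa> chi u * (of_real u ^ n / fact n))" for n
  have sums: "(\<lambda>n. a n * z ^ n) sums F z" for z
  proof -
    define f where "f n u = log_theta q \<kappa> chi u * ((z * of_real u) ^ n / fact n)" for n and u :: real
    have nf: "norm (f n u) = norm (log_theta q \<kappa> chi u) * ((norm z * \<bar>u\<bar>) ^ n / fact n)" for n u
      by (simp add: f_def norm_mult norm_divide norm_power)
    have es: "(\<lambda>n. (norm z * \<bar>u\<bar>) ^ n / fact n) sums exp (norm z * \<bar>u\<bar>)" for u
      using exp_converges[of "norm z * \<bar>u\<bar>"] by (simp add: divide_inverse mult.commute)
    have part: "(\<Sum>n<N. norm (f n u)) \<le> norm (log_theta q \<kappa> chi u) * exp (norm z * \<bar>u\<bar>)" for N u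
    proof -
      have "(\<Sum>n<N. (norm z * \<bar>u\<bar>) ^ n / fact n) \<le> exp (norm z * \<bar>u\<bar>)"
        unfolding sums_unique[OF es] by (rule sum_le_suminf) (use es sums_summable in auto)
      then show ?thesis unfolding nf sum_distrib_left[symmetric] by (intro mult_left_mono) auto
    qed
    have [measurable]: "f n \<in> borel_measurable borel" for n unfolding f_def by measurable
    have int: "integrable lborel (f n)" for n
    proof (rule Bochner_Integration.integrable_bound[OF log_theta_integrable[of "norm z"]])
      have "norm (f n u) \<le> norm (log_theta q \<kappa> chi u) * exp (norm z * \<bar>u\<bar>)" for u
        using part[of u "Suc n"] sum_nonneg[of "{..<n}" "\<lambda>n. norm (f n u)"] by simp
      then show "AE u in lborel. norm (f n u) \<le> norm (norm (log_theta q \<kappa> chi u) * exp (norm z * \<bar>u\<bar>))" by simp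
    qed auto
    have "(\<lambda>n. integral\<^sup>L lborel (f n)) sums (LBINT u. (\<Sum>n. f n u))"
    proof (rule sums_integral[OF int])
      show "AE u in lborel. summable (\<lambda>n. norm (f n u))"
        unfolding nf using es sums_summable by (intro AE_I2 summable_mult) blast
      show "summable (\<lambda>n. LBINT u. norm (f n u))"
      proof (rule summableI_nonneg_bounded)
        show "0 \<le> (LBINT u. norm (f n u))" for n by simp
        show "(\<Sum>n<N. LBINT u. norm (f n u)) \<le> (LBINT u. norm (log_theta q \<kappa> chi u) * exp (norm z * \<bar>u\<bar>))" for N
        proof -
          have "(\<Sum>n<N. LBINT u. norm (f n u)) = (LBINT u. \<Sum>n<N. norm (f n u))"
            by (rule Bochner_Integration.integral_sum[symmetric]) (use int in auto)
          also have "\<dots> \<le> (LBINT u. norm (log_theta q \<kappa> chi u) * exp (norm z * \<bar>u\<bar>))"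
            by (rule integral_mono) (use int part log_theta_integrable[of "norm z"] in auto)
          finally show ?thesis .
        qed
      qed
    qed
    moreover have "(\<Sum>n. f n u) = log_theta q \<kappa> chi u * exp (z * of_real u)" for u
    proof -
      have "(\<lambda>n. (z * of_real u) ^ n / fact n) sums exp (z * of_real u)"
        using exp_converges[of "z * of_real u"] by (simp add: scaleR_conv_of_real divide_inverse mult.commute)
      then show ?thesis unfolding f_def by (intro sums_unique[symmetric] sums_mult)
    qed
    moreover have "integral\<^sup>L lborel (f n) = a n * z ^ n" for n
    proof -
      have "f n u = (log_theta q \<kappa> chi u * (of_real u ^ n / fact n)) * z ^ n" for u
        by (simp add: f_def power_mult_distrib)
      then have "integral\<^sup>L lborel (f n) = (LBINT u. (log_theta q \<kappa> chi u * (of_real u ^ n / fact n)) * z ^ n)"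
        by presburger
      then show ?thesis unfolding a_def by (simp only: integral_mult_left_zero)
    qed
    ultimately show ?thesis by (simp add: F_def)
  qed
  have "F holomorphic_on ball 0 r" for r
    by (rule power_series_holomorphic[of 0 r a]) (use sums in simp)
  then have "F field_differentiable at z" for z
    using holomorphic_on_imp_differentiable_at[of F "ball 0 (norm z + 1)" z] by simp
  then have F: "F holomorphic_on UNIV" by (simp add: holomorphic_on_def field_differentiable_at_within)
  have "completed_L q \<kappa> chi = F \<circ> (\<lambda>s. (s - 1/2) / 2)" by (simp add: completed_L_def F_def fun_eq_iff)
  then show ?thesis
    by (simp only:) (intro holomorphic_on_compose[OF _ holomorphic_on_subset[OF F]] holomorphic_intros; simp)
qed

lemma completed_L_functional_equation:
  "completed_L q \<kappa> chi (1 - cnj s) = root_const q \<kappa> chi * cnj (completed_L q \<kappa> chi s)"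
proof -
  define z where "z = (s - 1/2) / 2"
  have cnj_int: "(LBINT u. cnj (g u)) = cnj (LBINT u. g u)" for g :: "real \<Rightarrow> complex"
    by (rule integral_bounded_linear'[OF bounded_linear_cnj bounded_linear_cnj]) simp
  have z: "(1 - cnj s - 1/2) / 2 = - cnj z" by (simp add: z_def field_simps)
  have "completed_L q \<kappa> chi (1 - cnj s) = (LBINT u. log_theta q \<kappa> chi u * exp (- cnj z * of_real u))"
    unfolding completed_L_def z ..
  also have "\<dots> = (LBINT u. log_theta q \<kappa> chi (0 + (-1) * u) * exp (- cnj z * of_real (0 + (-1) * u)))"
    by (subst lborel_integral_real_affine[of "-1" _ 0]) auto
  also have "\<dots> = (LBINT u. root_const q \<kappa> chi * cnj (log_theta q \<kappa> chi u * exp (z * of_real u)))"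
  proof (intro Bochner_Integration.integral_cong refl)
    fix u
    show "log_theta q \<kappa> chi (0 + (-1) * u) * exp (- cnj z * of_real (0 + (-1) * u)) =
        root_const q \<kappa> chi * cnj (log_theta q \<kappa> chi u * exp (z * of_real u))"
      using log_theta_reflect[of "- u"] by (simp add: exp_cnj mult.assoc)
  qed
  also have "\<dots> = root_const q \<kappa> chi * cnj (LBINT u. log_theta q \<kappa> chi u * exp (z * of_real u))"
    by (simp only: integral_mult_right_zero cnj_int)
  finally show ?thesis unfolding completed_L_def z_def .
qed

text \<open>Each term of the theta series becomes a Gamma integral with
  \<open>a n = pi * (Suc n)\<^sup>2 / q\<close>. The interchange of sum and integral rests on the
  sum of the integrals of the norms, which the terms at the real exponent \<open>Re s\<close>
  control.\<close>

lemma completed_L_sums: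
  fixes s :: complex
  assumes s: "Re s > 1"
  shows "(\<lambda>n. 2 * exp ((s + \<kappa>) / 2 * of_real (ln (q / pi))) * Gamma ((s + \<kappa>) / 2) *
           (chi (int (Suc n)) / of_nat (Suc n) powr s)) sums completed_L q \<kappa> chi s"
proof -
  define w where "w = (s + \<kappa>) / 2"
  have Rew: "Re w > 0" "2 * Re w = Re s + real \<kappa>" using s by (auto simp: w_def)
  define a where "a n = pi * (real (Suc n))\<^sup>2 / real q" for n
  have a: "a n > 0" for n using q1 by (simp add: a_def)
  define f where "f n u = 2 * chi (int (Suc n)) * of_nat (Suc n) ^ \<kappa> * exp (of_real u * w - of_real (a n * exp u))"
    for n and u :: real
  have intg: "integrable lborel (f n)" for n
    unfolding f_def using Gamma_integral_exp(1)[OF Rew(1) a] by simp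
  have val: "integral\<^sup>L lborel (f n) = 2 * exp ((s + \<kappa>) / 2 * of_real (ln (q / pi))) * Gamma ((s + \<kappa>) / 2) *
           (chi (int (Suc n)) / of_nat (Suc n) powr s)" for n
  proof -
    have ln_a: "ln (a n) = 2 * ln (real (Suc n)) - ln (q / pi)"
      using q1 by (simp add: a_def ln_mult ln_div ln_realpow)
    have pw: "of_nat (Suc n) ^ \<kappa> = exp (of_nat \<kappa> * complex_of_real (ln (real (Suc n))))"
      by (simp add: exp_of_nat_mult exp_of_real del: of_nat_Suc)
    have ps: "of_nat (Suc n) powr s = exp (s * complex_of_real (ln (real (Suc n))))"
      by (simp add: powr_def Ln_of_nat del: of_nat_Suc)
    have "of_nat (Suc n) ^ \<kappa> * exp (- (w * of_real (ln (a n)))) = exp (w * of_real (ln (q / pi))) / of_nat (Suc n) powr s"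
      unfolding pw ps ln_a exp_minus[symmetric] divide_inverse exp_add[symmetric]
      by (rule arg_cong[where f = exp]) (simp add: w_def field_simps del: of_nat_Suc)
    then have "2 * chi (int (Suc n)) * (of_nat (Suc n) ^ \<kappa> * exp (- (w * of_real (ln (a n))))) * Gamma w =
       2 * exp (w * of_real (ln (q / pi))) * Gamma w * (chi (int (Suc n)) / of_nat (Suc n) powr s)"
      by simp
    moreover have "integral\<^sup>L lborel (f n) = 2 * chi (int (Suc n)) * of_nat (Suc n) ^ \<kappa> *
        (LBINT u. exp (of_real u * w - of_real (a n * exp u)))"
      unfolding f_def by (rule integral_mult_right_zero)
    ultimately show ?thesis unfolding Gamma_integral_exp(2)[OF Rew(1) a]
      by (simp add: w_def mult.assoc del: of_nat_Suc)
  qed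
  \<comment> \<open>Passing to norms amounts to replacing \<open>w\<close> by \<open>Re w\<close>,
    so the same Gamma integral evaluates the norms.\<close>
  have nf: "norm (f n u) = 2 * norm (chi (int (Suc n))) * real (Suc n) ^ \<kappa> *
      norm (exp (of_real u * of_real (Re w) - complex_of_real (a n * exp u)))" for n u
    by (simp add: f_def norm_mult norm_power mult_ac del: of_nat_Suc)
  have "(\<lambda>n. integral\<^sup>L lborel (f n)) sums (LBINT u. (\<Sum>n. f n u))"
  proof (rule sums_integral[OF intg])
    show "AE u in lborel. summable (\<lambda>n. norm (f n u))"
    proof (rule AE_I2)
      fix u
      obtain B where B: "\<And>n. norm (chi n * of_real (real_of_int n ^ \<kappa> * exp (- (pi * (real_of_int n)\<^sup>2 * exp u / real q))))
           \<le> B / (1 + (real_of_int n)\<^sup>2)" and B0: "B > 0"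
        using theta_term_bound[OF _ exp_gt_zero \<kappa> chi, of u] q1 by auto
      show "summable (\<lambda>n. norm (f n u))"
      proof (rule summable_comparison_test'[of "\<lambda>n. 2 * exp (u * Re w) * (B / (1 + real n ^ 2))" 0])
        show "summable (\<lambda>n. 2 * exp (u * Re w) * (B / (1 + real n ^ 2)))"
          by (intro summable_mult summable_inverse_square_shift)
        show "norm (norm (f n u)) \<le> 2 * exp (u * Re w) * (B / (1 + real n ^ 2))" for n
        proof -
          have "norm (f n u) = 2 * exp (u * Re w) *
              norm (chi (int (Suc n)) * of_real (real_of_int (int (Suc n)) ^ \<kappa> * exp (- (pi * (real_of_int (int (Suc n)))\<^sup>2 * exp u / real q))))"
            unfolding f_def by (simp add: norm_mult norm_power a_def exp_diff exp_minus norm_divide field_simps abs_mult del: of_nat_Suc)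
          also have "\<dots> \<le> 2 * exp (u * Re w) * (B / (1 + (real_of_int (int (Suc n)))\<^sup>2))"
            by (intro mult_left_mono B) auto
          also have "\<dots> \<le> 2 * exp (u * Re w) * (B / (1 + real n ^ 2))"
            using B0 by (intro mult_left_mono divide_left_mono add_left_mono power_mono) (auto intro!: mult_pos_pos add_pos_nonneg)
          finally show ?thesis by simp
        qed
      qed
    qed
    show "summable (\<lambda>n. LBINT u. norm (f n u))"
    proof (rule summable_comparison_test'[of "\<lambda>n. 2 * norm (exp (Re w * ln (q / pi)) * Gamma (complex_of_real (Re w))) * real (Suc n) powr - Re s" 0])
      have "summable (\<lambda>n. real n powr - Re s)" using s by (subst summable_real_powr_iff) auto
      then have "summable (\<lambda>n. real (Suc n) powr - Re s)" by (subst summable_Suc_iff)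
      then show "summable (\<lambda>n. 2 * norm (exp (Re w * ln (q / pi)) * Gamma (complex_of_real (Re w))) * real (Suc n) powr - Re s)"
        by (rule summable_mult)
      show "norm (LBINT u. norm (f n u)) \<le> 2 * norm (exp (Re w * ln (q / pi)) * Gamma (complex_of_real (Re w))) * real (Suc n) powr - Re s" for n
      proof -
        let ?e = "\<lambda>u. exp (of_real u * of_real (Re w) - complex_of_real (a n * exp u))"
        \<comment> \<open>At a real exponent the integrand is a positive real, so the norm may be
          moved outside the integral.\<close>
        have "(LBINT u. norm (?e u)) = norm (LBINT u. ?e u)"
        proof -
          have e: "?e u = of_real (exp (u * Re w - a n * exp u))" for u by (simp add: exp_of_real[symmetric])
          have "(LBINT u. ?e u) = of_real (LBINT u. exp (u * Re w - a n * exp u))"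
            unfolding e by simp
          moreover have "norm (?e u) = exp (u * Re w - a n * exp u)" for u unfolding e by simp
          moreover have "(LBINT u. exp (u * Re w - a n * exp u)) \<ge> 0" by simp
          ultimately show ?thesis by simp
        qed
        also have "\<dots> = exp (- (Re w * ln (a n))) * norm (Gamma (complex_of_real (Re w)))"
          using Gamma_integral_exp(2)[of "of_real (Re w)" "a n"] Rew(1) a
          by (simp add: norm_mult exp_of_real[symmetric] del: exp_of_real)
        finally have I: "(LBINT u. norm (?e u)) = exp (- (Re w * ln (a n))) * norm (Gamma (complex_of_real (Re w)))" .
        have ln_a: "ln (a n) = 2 * ln (real (Suc n)) - ln (q / pi)"
          using q1 by (simp add: a_def ln_mult ln_div ln_realpow)
        have "real (Suc n) ^ \<kappa> * exp (- (Re w * ln (a n))) = exp (Re w * ln (q / pi)) * real (Suc n) powr - Re s"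
        proof -
          have "real (Suc n) ^ \<kappa> = exp (real \<kappa> * ln (real (Suc n)))" by (simp add: exp_of_nat_mult)
          moreover have "real (Suc n) powr - Re s = exp (- Re s * ln (real (Suc n)))" by (simp add: powr_def)
          moreover have "real \<kappa> = 2 * Re w - Re s" using Rew by simp
          ultimately show ?thesis unfolding ln_a
            by (simp add: exp_add[symmetric] algebra_simps)
        qed
        then have "real (Suc n) ^ \<kappa> * (LBINT u. norm (?e u)) =
            norm (exp (Re w * ln (q / pi)) * Gamma (complex_of_real (Re w))) * real (Suc n) powr - Re s"
          unfolding I by (simp add: norm_mult)
        moreover have "(LBINT u. norm (f n u)) = 2 * norm (chi (int (Suc n))) * real (Suc n) ^ \<kappa> * (LBINT u. norm (?e u))"
          unfolding nf by (rule integral_mult_right_zero)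
        ultimately have "(LBINT u. norm (f n u)) = norm (chi (int (Suc n))) *
           (2 * norm (exp (Re w * ln (q / pi)) * Gamma (complex_of_real (Re w))) * real (Suc n) powr - Re s)"
          by (simp add: mult_ac)
        also have "\<dots> \<le> 1 * (2 * norm (exp (Re w * ln (q / pi)) * Gamma (complex_of_real (Re w))) * real (Suc n) powr - Re s)"
          using norm_dirichlet_character_le[OF chi] by (intro mult_right_mono) auto
        finally show ?thesis by simp
      qed
    qed
  qed
  moreover have "(\<Sum>n. f n u) = log_theta q \<kappa> chi u * exp ((s - 1/2) / 2 * of_real u)" for u
  proof -
    have e: "of_real (exp ((real \<kappa> + 1/2) / 2 * u)) * exp ((s - 1/2) / 2 * of_real u) = exp (of_real u * w)"
      unfolding exp_of_real[symmetric] exp_add[symmetric]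
      by (rule arg_cong[where f = exp]) (simp add: w_def field_simps)
    have "f n u = (2 * (chi (int (Suc n)) * of_real (real (Suc n) ^ \<kappa> * exp (- (pi * (real (Suc n))\<^sup>2 * exp u / real q))))) * exp (of_real u * w)" for n
      by (simp add: f_def a_def exp_diff exp_minus exp_of_real[symmetric] divide_inverse mult_ac del: exp_of_real of_nat_Suc)
    then have "(\<lambda>n. f n u) sums (theta q \<kappa> chi (exp u) * exp (of_real u * w))"
      using sums_mult2[OF theta_sums[OF chi q1 \<kappa> exp_gt_zero parity]] by simp
    then show ?thesis unfolding log_theta_def e[symmetric] mult.assoc by (rule sums_unique[symmetric])
  qed
  ultimately show ?thesis unfolding val completed_L_def by simp
qed

end

subsection \<open>The logarithmic derivative of an entire function of order less than two\<close>

lemma zorder_entire: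
  fixes g :: "complex \<Rightarrow> complex"
  assumes "g holomorphic_on UNIV" "g a \<noteq> 0"
  shows "zorder g z > 0 \<longleftrightarrow> g z = 0" "zorder g z \<ge> 0"
proof -
  have "\<exists>w\<in>UNIV. g w \<noteq> 0" using assms(2) by blast
  from zorder_exist_zero[OF assms(1) open_UNIV connected_UNIV UNIV_I[of z] this]
  show "zorder g z > 0 \<longleftrightarrow> g z = 0" "zorder g z \<ge> 0" by (auto split: if_splits)
qed

lemma finite_zeros_ball:
  fixes g :: "complex \<Rightarrow> complex"
  assumes "g holomorphic_on UNIV" "g a \<noteq> 0"
  shows "finite {z. g z = 0 \<and> norm z < r}"
proof (cases "\<exists>b. g b = 0")
  case True
  then obtain b where "g b = 0" by blast
  then have "\<not> g constant_on UNIV" using assms(2) unfolding constant_on_def by (metis UNIV_I)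
  then have "finite {z\<in>cball 0 r. g z = 0}"
    by (intro holomorphic_compact_finite_zeros[OF assms(1)]) auto
  then show ?thesis by (rule finite_subset[rotated]) auto
next
  case False
  then show ?thesis by simp
qed

text \<open>Normalised to be 1 at 0, so that dividing a function by it preserves the value at
  0.\<close>

definition zero_prod :: "complex set \<Rightarrow> (complex \<Rightarrow> nat) \<Rightarrow> complex \<Rightarrow> complex" where
  "zero_prod Z m s = (\<Prod>z\<in>Z. (1 - s / z) ^ m z)"

lemma zero_prod_holomorphic: "0 \<notin> Z \<Longrightarrow> zero_prod Z m holomorphic_on A"
  unfolding zero_prod_def by (intro holomorphic_intros) auto

lemma zero_prod_nonzero: "0 \<notin> Z \<Longrightarrow> finite Z \<Longrightarrow> s \<notin> Z \<Longrightarrow> zero_prod Z m s \<noteq> 0"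
  unfolding zero_prod_def by (auto simp: prod_zero_iff divide_eq_1_iff)

lemma zorder_zero_prod:
  assumes "0 \<notin> Z" "finite Z" "z \<in> Z"
  shows "zorder (zero_prod Z m) z = int (m z)"
proof (rule zorder_eqI[where S = UNIV and g = "\<lambda>s. zero_prod (Z - {z}) m s * (- 1 / z) ^ m z"])
  show "(\<lambda>s. zero_prod (Z - {z}) m s * (- 1 / z) ^ m z) holomorphic_on UNIV"
    using assms by (intro holomorphic_intros zero_prod_holomorphic) auto
  have "z \<noteq> 0" using assms by auto
  then show "zero_prod (Z - {z}) m z * (- 1 / z) ^ m z \<noteq> 0" using assms by (simp add: zero_prod_nonzero)
  fix w
  have "zero_prod Z m w = (1 - w / z) ^ m z * zero_prod (Z - {z}) m w"
    unfolding zero_prod_def using assms by (simp add: prod.remove)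
  also have "1 - w / z = (- 1 / z) * (w - z)" using \<open>z \<noteq> 0\<close> by (simp add: field_simps)
  finally show "zero_prod Z m w = zero_prod (Z - {z}) m w * (- 1 / z) ^ m z * (w - z) powi int (m z)"
    by (simp only: power_mult_distrib mult_ac power_int_of_nat)
qed auto

lemma has_field_derivative_zero_prod:
  assumes "finite Z" "0 \<notin> Z" "s \<notin> Z"
  shows "(zero_prod Z m has_field_derivative zero_prod Z m s * (\<Sum>z\<in>Z. of_nat (m z) / (s - z))) (at s)"
  using assms
proof (induction Z rule: finite_induct)
  case empty
  then show ?case by (simp add: zero_prod_def[abs_def])
next
  case (insert a Z)
  have a: "a \<noteq> 0" "s \<noteq> a" using insert.prems by blast+
  have "((\<lambda>s. (1 - s / a) ^ m a) has_field_derivative of_nat (m a) * (1 - s / a) ^ (m a - 1) * (- 1 / a)) (at s)"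
    using a by (auto intro!: derivative_eq_intros)
  also have "of_nat (m a) * (1 - s / a) ^ (m a - 1) * (- 1 / a) = (1 - s / a) ^ m a * (of_nat (m a) / (s - a))"
  proof (cases "m a")
    case (Suc k)
    have "(1 - s / a) / (s - a) = - 1 / a" using a by (simp add: field_simps)
    then have "(1 - s / a) ^ Suc k * (of_nat (Suc k) / (s - a)) = of_nat (Suc k) * (1 - s / a) ^ k * (- 1 / a)"
      by (metis (no_types, lifting) mult.assoc mult.commute power_Suc times_divide_eq_left times_divide_eq_right)
    then show ?thesis unfolding Suc by simp
  qed simp
  finally have 1: "((\<lambda>s. (1 - s / a) ^ m a) has_field_derivative (1 - s / a) ^ m a * (of_nat (m a) / (s - a))) (at s)" .
  have eq: "zero_prod (insert a Z) m = (\<lambda>s. (1 - s / a) ^ m a * zero_prod Z m s)"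
    using insert by (simp add: zero_prod_def fun_eq_iff)
  have IH: "(zero_prod Z m has_field_derivative zero_prod Z m s * (\<Sum>z\<in>Z. of_nat (m z) / (s - z))) (at s)"
    using insert by auto
  show ?case unfolding eq sum.insert[OF insert.hyps]
    using DERIV_mult[OF 1 IH] by (simp add: algebra_simps)
qed

text \<open>Each factor has norm at least \<open>norm (s / z) - 1 \<ge> 1\<close>. So at twice the
  radius of the disc of zeros, dividing by the product does not enlarge a function.\<close>

lemma norm_zero_prod_ge_1:
  assumes "\<And>z. z \<in> Z \<Longrightarrow> z \<noteq> 0 \<and> 2 * norm z \<le> norm s"
  shows "norm (zero_prod Z m s) \<ge> 1"
proof -
  have "1 \<le> (\<Prod>z\<in>Z. norm ((1 - s / z) ^ m z))"
  proof (rule prod_ge_1)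
    fix z assume "z \<in> Z"
    then have z: "z \<noteq> 0" "2 * norm z \<le> norm s" using assms by auto
    have "norm (s / z) - norm (1::complex) \<le> norm (s / z - 1)" by (rule norm_triangle_ineq2)
    moreover have "norm (s / z) \<ge> 2" using z by (simp add: norm_divide pos_le_divide_eq)
    ultimately have "1 \<le> norm (1 - s / z)" by (simp add: norm_minus_commute)
    then show "1 \<le> norm ((1 - s / z) ^ m z)" by (simp add: norm_power)
  qed
  then show ?thesis by (simp add: zero_prod_def prod_norm)
qed

text \<open>A Borel-Caratheodory estimate, obtained from the Schwarz lemma for \<open>H / (2 A - H)\<close>.\<close>

lemma borel_caratheodory:
  assumes H: "H holomorphic_on ball 0 R" "H 0 = 0" and R: "R > 0" and A: "A > 0"
    and le: "\<And>z. z \<in> ball 0 R \<Longrightarrow> Re (H z) < A" and z: "norm z \<le> R / 2"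
  shows "norm (H z) \<le> 2 * A"
proof -
  have lt: "norm (H w) < norm (2 * of_real A - H w)" if "w \<in> ball 0 R" for w
  proof -
    have "(2 * A - Re (H w))\<^sup>2 - (Re (H w))\<^sup>2 = 4 * A * (A - Re (H w))"
      by (simp add: power2_eq_square algebra_simps)
    moreover have "\<dots> > 0" using le[OF that] A by simp
    ultimately have "(norm (H w))\<^sup>2 < (norm (2 * of_real A - H w))\<^sup>2"
      by (simp add: cmod_power2)
    then show ?thesis by (rule power2_less_imp_less) simp
  qed
  define f where "f w = H (of_real R * w) / (2 * of_real A - H (of_real R * w))" for w
  have Rw: "of_real R * w \<in> ball 0 R" if "norm w < 1" for w :: complex
    using that R by (simp add: norm_mult)
  have nz: "2 * of_real A - H (of_real R * w) \<noteq> 0" if "norm w < 1" for w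
    using lt[OF Rw[OF that]] by auto
  have holHR: "(\<lambda>w. H (of_real R * w)) holomorphic_on ball 0 1"
  proof -
    have "(\<lambda>w. of_real R * w) ` ball (0::complex) 1 \<subseteq> ball 0 R" using Rw by auto
    from holomorphic_on_compose_gen[OF _ H(1) this] show ?thesis
      by (auto simp: o_def intro!: holomorphic_intros)
  qed
  have "f holomorphic_on ball 0 1" unfolding f_def using nz by (intro holomorphic_intros holHR) auto
  moreover have "f 0 = 0" using H by (simp add: f_def)
  moreover have "norm (f w) < 1" if "norm w < 1" for w
    using lt[OF Rw[OF that]] nz[OF that] by (simp add: f_def norm_divide)
  moreover define w where "w = z / of_real R"
  moreover have w: "norm w \<le> 1/2" using z R by (simp add: w_def norm_divide pos_divide_le_eq)
  ultimately have "norm (f w) \<le> norm w" by (intro Schwarz_Lemma(1)[of f]) auto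
  then have fw: "norm (f w) \<le> 1/2" using w by linarith
  have Rwz: "of_real R * w = z" using R by (simp add: w_def)
  \<comment> \<open>Solving for \<open>H z\<close> with \<open>norm (f w) \<le> 1/2\<close> gives
    \<open>norm (H z) \<le> A + norm (H z) / 2\<close>.\<close>
  have "H z = f w * (2 * of_real A - H z)" using nz[of w] w Rwz by (simp add: f_def)
  then have "norm (H z) = norm (f w) * norm (2 * of_real A - H z)" by (metis norm_mult)
  also have "\<dots> \<le> 1/2 * (2 * A + norm (H z))"
  proof (rule mult_mono)
    show "norm (2 * of_real A - H z) \<le> 2 * A + norm (H z)"
      using norm_triangle_ineq4[of "2 * of_real A" "H z"] A by (simp add: norm_mult)
  qed (use fw in auto)
  finally show ?thesis by simp
qed

text \<open>Let \<open>h = g / f\<close> with \<open>f\<close> the product over the zeros in the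
  disc, and let \<open>H\<close> be its logarithm normalised to 0 at 0. The growth of
  \<open>g\<close> at radius \<open>2 * R\<close> bounds \<open>Re H\<close>, Borel-Caratheodory
  bounds \<open>H\<close> for radius \<open>R / 2\<close>, and Cauchy's inequality bounds its second
  derivative on the unit disc. The quantity to be estimated is \<open>H'(1) - H'(0)\<close>.\<close>

lemma log_deriv_difference_bound:
  fixes g :: "complex \<Rightarrow> complex"
  assumes g: "g holomorphic_on UNIV" "g 0 \<noteq> 0" "g 1 \<noteq> 0"
    and growth: "\<And>s. norm s = 2 * R \<Longrightarrow> norm (g s) \<le> exp M" and R: "R \<ge> 8"
    and M: "ln (norm (g 0)) < M"
  shows "norm ((deriv g 1 / g 1 - deriv g 0 / g 0) -
           (\<Sum>z | g z = 0 \<and> norm z < R. of_int (zorder g z) * (1 / (1 - z) + 1 / z)))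
         \<le> 128 * (M - ln (norm (g 0))) / R\<^sup>2"
proof -
  define Z where "Z = {z. g z = 0 \<and> norm z < R}"
  define m where "m z = nat (zorder g z)" for z
  define f where "f = zero_prod Z m"
  have finZ: "finite Z" unfolding Z_def by (rule finite_zeros_ball[OF g(1,2)])
  have Z0: "0 \<notin> Z" using g by (simp add: Z_def)
  have mz: "int (m z) = zorder g z" for z using zorder_entire(2)[OF g(1,2), of z] by (simp add: m_def)
  have holf: "f holomorphic_on A" for A unfolding f_def by (rule zero_prod_holomorphic[OF Z0])
  have fnz: "f z \<noteq> 0" if "z \<notin> Z" for z unfolding f_def by (rule zero_prod_nonzero[OF Z0 finZ that])
  have holg: "g holomorphic_on A" for A using g(1) holomorphic_on_subset by blast
  have fz: "f z = 0 \<longleftrightarrow> z \<in> Z" for z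
  proof
    assume z: "z \<in> Z"
    then have "m z > 0" using zorder_entire(1)[OF g(1,2), of z] by (simp add: m_def Z_def)
    moreover have "z \<noteq> 0" using z Z0 by auto
    ultimately show "f z = 0" unfolding f_def zero_prod_def using finZ z by (auto simp: prod_zero_iff intro!: bexI[of _ z])
  qed (use fnz in blast)
  obtain h where h: "h holomorphic_on ball 0 R" "\<And>z. z \<in> ball 0 R \<Longrightarrow> h z \<noteq> 0" "\<And>z. z \<in> ball 0 R \<Longrightarrow> g z = h z * f z"
  proof (rule holomorphic_zorder_factorization[of g "ball 0 R" f])
    show "g holomorphic_on ball 0 R" "f holomorphic_on ball 0 R" by (rule holg, rule holf)
    show "f z = 0 \<longleftrightarrow> g z = 0" if "z \<in> ball 0 R" for z using that fz by (simp add: Z_def)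
    show "zorder f z = zorder g z" if "z \<in> ball 0 R" for z
    proof (cases "z \<in> Z")
      case True
      then show ?thesis unfolding f_def using zorder_zero_prod[OF Z0 finZ True] mz by simp
    next
      case False
      then have "g z \<noteq> 0" using that by (simp add: Z_def)
      then have "zorder g z = 0" using zorder_entire[OF g(1,2), of z] by linarith
      moreover have "zorder f z = 0"
        using fnz[OF False] holf[of UNIV] by (intro zorder_eq_0I) (auto simp: analytic_on_open analytic_at)
      ultimately show ?thesis by simp
    qed
  qed auto
  \<comment> \<open>\<open>h\<close> lives only on the disc of radius \<open>R\<close>. Glued with
    \<open>g / f\<close> outside, it is entire, and the maximum principle applies at radius
    \<open>2 * R\<close>.\<close>
  define F where "F z = (if z \<in> ball 0 R then h z else g z / f z)" for z
  have "F holomorphic_on (ball 0 R \<union> - Z)"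
    unfolding F_def
  proof (rule holomorphic_on_If_Un[OF h(1)])
    show "(\<lambda>z. g z / f z) holomorphic_on - Z" using fnz by (intro holomorphic_intros holg holf) auto
    show "open (- Z)" using finZ by (simp add: finite_imp_closed open_Compl)
    show "h z = g z / f z" if "z \<in> ball 0 R" "z \<in> - Z" for z using h(3)[OF that(1)] fnz[of z] that by auto
  qed simp
  moreover have "ball 0 R \<union> - Z = UNIV" by (auto simp: Z_def)
  ultimately have holF: "F holomorphic_on UNIV" by simp
  have FM: "norm (F s) \<le> exp M" if "s \<in> cball 0 (2 * R)" for s
  proof (rule maximum_modulus_frontier[of F "cball 0 (2 * R)"])
    show "F holomorphic_on interior (cball 0 (2 * R))" by (rule holomorphic_on_subset[OF holF]) simp
    show "continuous_on (closure (cball 0 (2 * R))) F"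
      by (intro holomorphic_on_imp_continuous_on holomorphic_on_subset[OF holF]) simp
    fix z :: complex assume "z \<in> frontier (cball 0 (2 * R))"
    then have z: "norm z = 2 * R" using R by (simp add: frontier_cball)
    have "1 \<le> norm (f z)" unfolding f_def
      by (rule norm_zero_prod_ge_1) (use Z0 z in \<open>auto simp: Z_def\<close>)
    then have "norm (g z) / norm (f z) \<le> norm (g z) / 1" by (intro divide_left_mono) auto
    then have "norm (F z) \<le> norm (g z)" using z R by (simp add: F_def norm_divide)
    then show "norm (F z) \<le> exp M" using growth[OF z] by linarith
  qed (use that in auto)
  obtain G where G: "G holomorphic_on ball 0 R" "\<And>z. z \<in> ball 0 R \<Longrightarrow> exp (G z) = h z"
    using holomorphic_logarithm_exists[of "ball 0 R" h 0] h(1,2) R by auto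
  define A where "A = M - ln (norm (g 0))"
  have A: "A > 0" using M by (simp add: A_def)
  have in_ball: "0 \<in> ball 0 R" "1 \<in> ball (0::complex) R" using R by auto
  have f0: "f 0 = 1" by (simp add: f_def zero_prod_def)
  have h0: "h 0 = g 0" using h(3)[OF in_ball(1)] f0 by simp
  have ReG: "Re (G z) = ln (norm (h z))" if "z \<in> ball 0 R" for z
    using G(2)[OF that] by (metis norm_exp_eq_Re ln_exp)
  define H where "H z = G z - G 0" for z
  have holH: "H holomorphic_on ball 0 R" unfolding H_def by (intro holomorphic_intros G)
  have Hb: "norm (H z) \<le> 4 * A" if z: "norm z \<le> R / 2" for z
  proof -
    have "norm (H z) \<le> 2 * (2 * A)"
    proof (rule borel_caratheodory[OF holH _ _ _ _ z])
      fix w :: complex assume w: "w \<in> ball 0 R"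
      have "norm (h w) \<le> exp M" using FM[of w] w R by (simp add: F_def)
      then have "ln (norm (h w)) \<le> M" using h(2)[OF w] by (metis ln_exp ln_le_cancel_iff zero_less_norm_iff exp_gt_zero)
      then have "Re (H w) \<le> A" using ReG[OF w] ReG[OF in_ball(1)] h0 by (simp add: H_def A_def)
      then show "Re (H w) < 2 * A" using A by simp
    qed (use R A in \<open>auto simp: H_def\<close>)
    then show ?thesis by simp
  qed
  have H2: "norm (deriv (deriv H) z) \<le> 128 * A / R\<^sup>2" if z: "z \<in> cball 0 1" for z
  proof -
    \<comment> \<open>Discs of this radius about points of the unit disc stay within radius
      \<open>R / 2\<close>, as \<open>R \<ge> 8\<close>. The constant is
      \<open>2 * 4 * 4\<^sup>2 = 128\<close>, from the factorial, the bound \<open>4 * A\<close> and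
      the square of the 4 in \<open>R / 4\<close>.\<close>
    define r where "r = R / 4"
    have r: "r > 0" "r + 1 \<le> R / 2" using R by (auto simp: r_def)
    have sub: "cball z r \<subseteq> cball 0 (R / 2)"
    proof
      fix w assume "w \<in> cball z r"
      then have "norm (w - z) \<le> r" by (simp add: dist_norm norm_minus_commute)
      then show "w \<in> cball 0 (R / 2)" using z r norm_triangle_ineq2[of w z] by simp
    qed
    have sub2: "cball z r \<subseteq> ball 0 R" using sub R by (auto simp: subset_iff)
    have "norm ((deriv ^^ 2) H z) \<le> fact 2 * (4 * A) / r ^ 2"
    proof (rule Cauchy_inequality)
      show "H holomorphic_on ball z r" by (rule holomorphic_on_subset[OF holH]) (use sub2 ball_subset_cball in blast)
      show "continuous_on (cball z r) H"
        by (intro holomorphic_on_imp_continuous_on holomorphic_on_subset[OF holH] sub2)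
      show "norm (H x) \<le> 4 * A" if "norm (z - x) = r" for x
      proof -
        have "x \<in> cball z r" using that by (simp add: dist_norm)
        then have "norm x \<le> R / 2" using sub by auto
        then show ?thesis by (rule Hb)
      qed
    qed (use r in auto)
    also have "fact 2 * (4 * A) / r ^ 2 = 128 * A / R\<^sup>2" by (simp add: r_def power_divide)
    finally show ?thesis by (simp add: numeral_2_eq_2)
  qed
  have dd: "norm (deriv H 1 - deriv H 0) \<le> 128 * A / R\<^sup>2 * norm (1 - 0 :: complex)"
  proof (rule field_differentiable_bound[where S = "cball 0 1"])
    fix z :: complex assume z: "z \<in> cball 0 1"
    then have "z \<in> ball 0 R" using R by auto
    then show "(deriv H has_field_derivative deriv (deriv H) z) (at z within cball 0 1)"
      using holomorphic_derivI[OF holomorphic_deriv[OF holH open_ball] open_ball] by (auto intro: has_field_derivative_at_within)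
    show "norm (deriv (deriv H) z) \<le> 128 * A / R\<^sup>2" by (rule H2[OF z])
  qed auto
  have dH: "deriv H z = deriv g z / g z - (\<Sum>w\<in>Z. of_nat (m w) / (z - w))" if z: "z \<in> ball 0 R" "g z \<noteq> 0" for z
  proof -
    have zZ: "z \<notin> Z" using z by (simp add: Z_def)
    have dG: "(G has_field_derivative deriv G z) (at z)" by (rule holomorphic_derivI[OF G(1) open_ball z(1)])
    have "(h has_field_derivative exp (G z) * deriv G z) (at z)"
      by (rule has_field_derivative_transform_within_open[OF DERIV_chain2[OF DERIV_exp dG] open_ball z(1) G(2)])
    then have dh: "(h has_field_derivative h z * deriv G z) (at z)" using G(2)[OF z(1)] by simp
    have df: "(f has_field_derivative f z * (\<Sum>w\<in>Z. of_nat (m w) / (z - w))) (at z)"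
      unfolding f_def by (rule has_field_derivative_zero_prod[OF finZ Z0 zZ])
    have "(g has_field_derivative h z * deriv G z * f z + f z * (\<Sum>w\<in>Z. of_nat (m w) / (z - w)) * h z) (at z)"
      by (rule has_field_derivative_transform_within_open[OF DERIV_mult[OF dh df] open_ball z(1)]) (use h(3) in auto)
    then have "deriv g z = h z * deriv G z * f z + f z * (\<Sum>w\<in>Z. of_nat (m w) / (z - w)) * h z" by (rule DERIV_imp_deriv)
    also have "\<dots> = g z * (deriv G z + (\<Sum>w\<in>Z. of_nat (m w) / (z - w)))" using h(3)[OF z(1)] by (simp add: algebra_simps)
    finally have "deriv g z / g z = deriv G z + (\<Sum>w\<in>Z. of_nat (m w) / (z - w))" using z(2) by simp
    moreover have "deriv H z = deriv G z"
      unfolding H_def[abs_def] by (rule DERIV_imp_deriv) (auto intro!: derivative_eq_intros dG)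
    ultimately show ?thesis by simp
  qed
  have "(\<Sum>z\<in>Z. of_int (zorder g z) * (1 / (1 - z) + 1 / z)) =
      (\<Sum>w\<in>Z. of_nat (m w) / (1 - w)) - (\<Sum>w\<in>Z. of_nat (m w) / (0 - w))"
    unfolding sum_subtractf[symmetric]
  proof (intro sum.cong refl)
    fix z
    show "of_int (zorder g z) * (1 / (1 - z) + 1 / z) = of_nat (m z) / (1 - z) - of_nat (m z) / (0 - z)"
      unfolding mz[symmetric] by (simp add: algebra_simps)
  qed
  then have "(deriv g 1 / g 1 - deriv g 0 / g 0) - (\<Sum>z\<in>Z. of_int (zorder g z) * (1 / (1 - z) + 1 / z)) =
      deriv H 1 - deriv H 0"
    using dH[OF in_ball(1) g(2)] dH[OF in_ball(2) g(3)] by simp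
  then show ?thesis using dd unfolding Z_def A_def by simp
qed

subsection \<open>Dirichlet L-functions\<close>

lemma Re_pos_imp_not_nonpos_Int:
  assumes "Re w > 0"
  shows "w \<notin> \<int>\<^sub>\<le>\<^sub>0"
proof
  assume "w \<in> \<int>\<^sub>\<le>\<^sub>0"
  then obtain n where "w = of_int n" "n \<le> 0" by (rule nonpos_Ints_cases)
  then show False using assms by simp
qed

text \<open>The uniqueness behind the description in \<open>dirichlet_L\<close>. The difference of
  \<open>f\<close> and \<open>L\<close> vanishes near 2, hence in a punctured neighbourhood of every
  point. So \<open>f\<close> has no pole, and nice meromorphy makes its value at each point the
  limit there.\<close>

lemma nicely_meromorphic_eq_entire:
  assumes f: "f nicely_meromorphic_on UNIV" and L: "L holomorphic_on UNIV"
    and eq: "\<And>s. Re s > 1 \<Longrightarrow> f s = L s"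
  shows "f = L"
proof
  fix z
  have anL: "L analytic_on UNIV" using L by (simp add: analytic_on_open)
  have "(\<lambda>s. f s - L s) meromorphic_on UNIV"
    by (rule meromorphic_on_diff[OF _ analytic_on_imp_meromorphic_on[OF anL]])
       (use f in \<open>simp add: nicely_meromorphic_on_def\<close>)
  then have "(\<forall>x. \<forall>\<^sub>F s in at x. f s - L s = 0) \<or> (\<forall>x. \<forall>\<^sub>F s in at x. f s - L s \<noteq> 0)"
    using meromorphic_imp_constant_or_avoid[of "\<lambda>s. f s - L s" UNIV 0] connected_UNIV
    by (simp add: eventually_cosparse_open_eq)
  moreover have "\<not> (\<forall>\<^sub>F s in at 2. f s - L s \<noteq> 0)"
  proof
    assume *: "\<forall>\<^sub>F s in at 2. f s - L s \<noteq> 0"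
    have "\<forall>\<^sub>F s in at (2::complex). s \<in> {s. Re s > 1}"
      by (intro eventually_at_in_open' open_halfspace_Re_gt) simp
    with * have "\<forall>\<^sub>F s in at (2::complex). False" by eventually_elim (use eq in auto)
    then show False by simp
  qed
  ultimately have ev: "\<forall>\<^sub>F s in at z. f s = L s" by auto
  have Lz: "L \<midarrow>z\<rightarrow> L z"
    using anL by (intro isContD analytic_at_imp_isCont) (auto intro: analytic_on_subset)
  have "\<not> is_pole f z"
  proof
    assume "is_pole f z"
    then have "is_pole L z" using ev is_pole_cong by blast
    then show False using Lz unfolding is_pole_def
      using not_tendsto_and_filterlim_at_infinity[of "at z" L "L z"] by auto
  qed
  then have "f \<midarrow>z\<rightarrow> f z" using f unfolding nicely_meromorphic_on_def by auto
  moreover have "f \<midarrow>z\<rightarrow> L z" using Lz tendsto_cong[OF ev] by blast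
  ultimately show "f z = L z" by (rule LIM_unique)
qed

lemma dirichlet_L_eqI:
  assumes chi: "dirichlet_character q chi" and L: "L holomorphic_on UNIV"
    and eq: "\<And>s. Re s > 1 \<Longrightarrow> L s = dser (\<lambda>n. chi (int n)) s"
  shows "dirichlet_L chi = L"
  unfolding dirichlet_L_def
proof (rule the_equality)
  have abs: "dser_abs (\<lambda>n. chi (int n))" using cmultiplicativeD(4)[OF cmultiplicative_character[OF chi]] .
  have sums: "(\<lambda>n. chi (int (Suc n)) / of_nat (Suc n) powr s) sums L s" if "Re s > 1" for s
    using dser_sums[OF abs that] eq[OF that] by (subst sums_Suc_iff) simp
  show "L nicely_meromorphic_on UNIV \<and>
      (\<forall>s. Re s > 1 \<longrightarrow> (\<lambda>n. chi (int (Suc n)) / of_nat (Suc n) powr s) sums L s)"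
    using sums L by (auto intro!: analytic_on_imp_nicely_meromorphic_on simp: analytic_on_open)
  fix f assume f: "f nicely_meromorphic_on UNIV \<and>
      (\<forall>s. Re s > 1 \<longrightarrow> (\<lambda>n. chi (int (Suc n)) / of_nat (Suc n) powr s) sums f s)"
  show "f = L"
  proof (rule nicely_meromorphic_eq_entire[OF _ L])
    show "f nicely_meromorphic_on UNIV" using f by blast
    show "f s = L s" if "Re s > 1" for s using f sums[OF that] that sums_unique2 by blast
  qed
qed

lemma zorder_mult_nonzero:
  fixes g u :: "complex \<Rightarrow> complex"
  assumes g: "g holomorphic_on UNIV" "g a \<noteq> 0" and u: "u holomorphic_on UNIV" "u z \<noteq> 0"
  shows "zorder (\<lambda>s. g s * u s) z = zorder g z"
proof -
  have "\<exists>w\<in>UNIV. g w \<noteq> 0" using g(2) by blast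
  from zorder_exist_zero[OF g(1) open_UNIV connected_UNIV UNIV_I[of z] this]
  obtain r where r: "r > 0" "zor_poly g z holomorphic_on cball z r"
    "\<And>w. w \<in> cball z r \<Longrightarrow> g w = zor_poly g z w * (w - z) ^ nat (zorder g z) \<and> zor_poly g z w \<noteq> 0" by blast
  show ?thesis
  proof (rule zorder_eqI[of "ball z r" z "\<lambda>w. zor_poly g z w * u w"])
    show "(\<lambda>w. zor_poly g z w * u w) holomorphic_on ball z r"
      by (intro holomorphic_intros holomorphic_on_subset[OF r(2)] holomorphic_on_subset[OF u(1)]) auto
    show "zor_poly g z z * u z \<noteq> 0" using r(3)[of z] r(1) u(2) by simp
    fix w assume w: "w \<in> ball z r"
    have "(w - z) ^ nat (zorder g z) = (w - z) powi zorder g z"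
      using zorder_entire(2)[OF g, of z] by (simp add: power_int_def)
    then show "g w * u w = zor_poly g z w * u w * (w - z) powi zorder g z"
      using r(3)[of w] w by simp
  qed (use r in auto)
qed

text \<open>On \<open>Re s > 0\<close> the factor \<open>u\<close> alters neither zeros nor
  multiplicities. It will be the product of Euler factors that separates a character from its
  primitive inducer.\<close>

lemma b_chi_mult_nonzero:
  assumes L: "dirichlet_L psi holomorphic_on UNIV" "dirichlet_L psi a \<noteq> 0"
    and u: "u holomorphic_on UNIV" "\<And>s. Re s > 0 \<Longrightarrow> u s \<noteq> 0"
    and eq: "\<And>s. dirichlet_L chi s = dirichlet_L psi s * u s"
  shows "b_chi chi = b_chi psi"
proof -
  have "dirichlet_L chi = (\<lambda>s. dirichlet_L psi s * u s)" using eq by (rule ext)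
  then have "zorder (dirichlet_L chi) (Complex (1/2) t) = zorder (dirichlet_L psi) (Complex (1/2) t)" for t
    using zorder_mult_nonzero[OF L u(1), of "Complex (1/2) t"] u(2)[of "Complex (1/2) t"] by simp
  moreover have "dirichlet_L chi (Complex (1/2) t) = 0 \<longleftrightarrow> dirichlet_L psi (Complex (1/2) t) = 0" for t
    using eq[of "Complex (1/2) t"] u(2)[of "Complex (1/2) t"] by simp
  ultimately show ?thesis unfolding b_chi_def by simp
qed

section \<open>Zeros and logarithmic derivative of a primitive L-function\<close>

context primitive_parity
begin

text \<open>The reciprocal of the Gamma and conductor factors. Written with \<open>rGamma\<close> it
  is entire, so its product with the completed L-function continues the L-function to the whole
  plane.\<close>

definition L_factor :: "complex \<Rightarrow> complex" where
  "L_factor s = rGamma ((s + of_nat \<kappa>) / 2) * exp (- ((s + of_nat \<kappa>) / 2 * of_real (ln (q / pi)))) / 2"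

lemma L_factor_holomorphic: "L_factor holomorphic_on A"
  unfolding L_factor_def by (intro holomorphic_intros) auto

lemma L_factor_nonzero:
  assumes "Re s > 0"
  shows "L_factor s \<noteq> 0"
proof -
  have "Re ((s + of_nat \<kappa>) / 2) > 0" using assms by simp
  then have "(s + of_nat \<kappa>) / 2 \<notin> \<int>\<^sub>\<le>\<^sub>0" by (rule Re_pos_imp_not_nonpos_Int)
  then show ?thesis by (simp add: L_factor_def rGamma_eq_zero_iff)
qed

lemma L_factor_inverse:
  assumes "Re s > 0"
  shows "2 * exp ((s + of_nat \<kappa>) / 2 * of_real (ln (q / pi))) * Gamma ((s + of_nat \<kappa>) / 2) * L_factor s = 1"
proof -
  define X where "X = (s + of_nat \<kappa>) / 2 * of_real (ln (q / pi))"
  define G where "G = Gamma ((s + of_nat \<kappa>) / 2)"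
  have "Re ((s + of_nat \<kappa>) / 2) > 0" using assms by simp
  then have "G \<noteq> 0" unfolding G_def Gamma_eq_zero_iff by (rule Re_pos_imp_not_nonpos_Int)
  moreover have "exp X * exp (- X) = 1" by (simp add: exp_minus)
  moreover have "2 * exp X * G * (inverse G * exp (- X) / 2) = (G * inverse G) * (exp X * exp (- X))" by simp
  ultimately have "2 * exp X * G * (inverse G * exp (- X) / 2) = 1" by simp
  then show ?thesis by (simp only: L_factor_def X_def G_def rGamma_inverse_Gamma)
qed

lemma completed_L_dser:
  assumes "Re s > 1"
  shows "completed_L q \<kappa> chi s * L_factor s = dser (\<lambda>n. chi (int n)) s"
proof -
  define K where "K = 2 * exp ((s + of_nat \<kappa>) / 2 * of_real (ln (q / pi))) * Gamma ((s + of_nat \<kappa>) / 2)"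
  have abs: "dser_abs (\<lambda>n. chi (int n))" using cmultiplicativeD(4)[OF cmultiplicative_character[OF chi]] .
  have "(\<lambda>n. chi (int (Suc n)) / of_nat (Suc n) powr s) sums dser (\<lambda>n. chi (int n)) s"
    using dser_sums[OF abs assms] by (subst sums_Suc_iff) simp
  then have "(\<lambda>n. K * (chi (int (Suc n)) / of_nat (Suc n) powr s)) sums (K * dser (\<lambda>n. chi (int n)) s)"
    by (rule sums_mult)
  then have c: "completed_L q \<kappa> chi s = K * dser (\<lambda>n. chi (int n)) s"
    using completed_L_sums[OF assms] sums_unique2 unfolding K_def by blast
  have "K * L_factor s = 1" unfolding K_def using assms by (intro L_factor_inverse) simp
  then show ?thesis unfolding c by (simp add: mult.assoc mult.commute mult.left_commute)
qed

lemma dirichlet_L_eq: "dirichlet_L chi = (\<lambda>s. completed_L q \<kappa> chi s * L_factor s)"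
  by (rule dirichlet_L_eqI[OF chi])
     (auto intro!: holomorphic_intros completed_L_holomorphic L_factor_holomorphic completed_L_dser)

lemma dirichlet_L_holomorphic: "dirichlet_L chi holomorphic_on UNIV"
  unfolding dirichlet_L_eq by (intro holomorphic_intros completed_L_holomorphic L_factor_holomorphic)

lemma dirichlet_L_dser: "Re s > 1 \<Longrightarrow> dirichlet_L chi s = dser (\<lambda>n. chi (int n)) s"
  unfolding dirichlet_L_eq by (rule completed_L_dser)

lemma dirichlet_L_nonzero:
  assumes "Re s \<ge> 1"
  shows "dirichlet_L chi s \<noteq> 0"
proof (cases "Re s > 1")
  case True
  then show ?thesis
    using dser_cmultiplicative_nonzero[OF cmultiplicative_character[OF chi]] dirichlet_L_dser by simp
next
  case False
  then have "s = 1 + \<i> * of_real (Im s)" using assms by (simp add: complex_eq_iff)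
  then show ?thesis
    using L_nonzero_Re_1[OF chi q1 dirichlet_L_holomorphic dirichlet_L_dser, of "Im s"] by simp
qed

lemma completed_L_nonzero_right:
  assumes "Re s \<ge> 1"
  shows "completed_L q \<kappa> chi s \<noteq> 0"
  using dirichlet_L_nonzero[OF assms] unfolding dirichlet_L_eq by auto

text \<open>Otherwise the functional equation at \<open>s = -1\<close> would make the completed
  L-function vanish at 2.\<close>

lemma root_const_nonzero: "root_const q \<kappa> chi \<noteq> 0"
proof
  assume "root_const q \<kappa> chi = 0"
  then have "completed_L q \<kappa> chi (1 - cnj (-1)) = 0" by (subst completed_L_functional_equation) simp
  then show False using completed_L_nonzero_right[of 2] by simp
qed

lemma completed_L_reflect:
  "completed_L q \<kappa> chi s = root_const q \<kappa> chi * cnj (completed_L q \<kappa> chi (1 - cnj s))"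
  using completed_L_functional_equation[of "1 - cnj s"] by simp

lemma completed_L_nonzero_left:
  assumes "Re s \<le> 0"
  shows "completed_L q \<kappa> chi s \<noteq> 0"
  using completed_L_nonzero_right[of "1 - cnj s"] root_const_nonzero assms
  by (subst completed_L_reflect) simp

text \<open>Nonvanishing for \<open>Re s \<ge> 1\<close>, and by reflection for
  \<open>Re s \<le> 0\<close>, puts the zeros into the open strip to which \<open>GRH\<close>
  applies. For the converse, \<open>L_factor\<close> has no zeros with positive real part.\<close>

lemma completed_L_zero_iff:
  assumes GRH
  shows "completed_L q \<kappa> chi s = 0 \<longleftrightarrow> Re s = 1/2 \<and> dirichlet_L chi s = 0"
proof
  assume z: "completed_L q \<kappa> chi s = 0"
  then have "Re s < 1" "Re s > 0"
    using completed_L_nonzero_left[of s] completed_L_nonzero_right[of s] by force+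
  moreover have "dirichlet_L chi s = 0" using z unfolding dirichlet_L_eq by simp
  ultimately show "Re s = 1/2 \<and> dirichlet_L chi s = 0" using assms chi unfolding GRH_def by blast
next
  assume "Re s = 1/2 \<and> dirichlet_L chi s = 0"
  then show "completed_L q \<kappa> chi s = 0" using L_factor_nonzero[of s] unfolding dirichlet_L_eq by simp
qed

text \<open>Differentiate the functional equation at 0: the inner \<open>1 - s\<close> contributes
  the sign, and the root constant cancels in the quotient.\<close>

lemma completed_L_log_deriv_reflect:
  "deriv (completed_L q \<kappa> chi) 0 / completed_L q \<kappa> chi 0 =
     - cnj (deriv (completed_L q \<kappa> chi) 1 / completed_L q \<kappa> chi 1)"
proof -
  define f where "f = completed_L q \<kappa> chi"
  define W where "W = root_const q \<kappa> chi"
  have holf: "f holomorphic_on UNIV" unfolding f_def by (rule completed_L_holomorphic)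
  have f1: "(f has_field_derivative deriv f 1) (at (cnj 1))"
    using holomorphic_derivI[OF holf open_UNIV, of 1] by simp
  have d: "((cnj \<circ> f \<circ> cnj) has_field_derivative cnj (deriv f 1)) (at (1 - 0))"
    using has_field_derivative_cnj_cnj[OF f1] by simp
  have "((\<lambda>s. (cnj \<circ> f \<circ> cnj) (1 - s)) has_field_derivative cnj (deriv f 1) * (- 1)) (at 0)"
    by (rule DERIV_chain2[where g = "\<lambda>s. 1 - s" and x = 0, OF d]) (auto intro!: derivative_eq_intros)
  from DERIV_cmult[OF this, of W]
  have "((\<lambda>s. W * (cnj \<circ> f \<circ> cnj) (1 - s)) has_field_derivative W * (cnj (deriv f 1) * (- 1))) (at 0)" .
  moreover have "(\<lambda>s. W * (cnj \<circ> f \<circ> cnj) (1 - s)) = f"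
  proof
    fix s
    show "W * (cnj \<circ> f \<circ> cnj) (1 - s) = f s"
      unfolding f_def W_def o_def using completed_L_reflect[of s] by simp
  qed
  ultimately have "deriv f 0 = - (W * cnj (deriv f 1))" by (simp add: DERIV_imp_deriv)
  moreover have "f 0 = W * cnj (f 1)" unfolding f_def W_def using completed_L_reflect[of 0] by simp
  ultimately show ?thesis using root_const_nonzero unfolding f_def[symmetric] W_def[symmetric] by simp
qed

lemma completed_L_log_deriv_1:
  "deriv (completed_L q \<kappa> chi) 1 / completed_L q \<kappa> chi 1 =
     of_real (ln (q / pi)) / 2 + Digamma ((1 + of_nat \<kappa>) / 2) / 2 + deriv (dirichlet_L chi) 1 / dirichlet_L chi 1"
proof -
  define f where "f = completed_L q \<kappa> chi"
  define w where "w = (1 + of_nat \<kappa>) / (2 :: complex)"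
  define g where "g s = 2 * exp ((s + of_nat \<kappa>) / 2 * of_real (ln (q / pi))) * Gamma ((s + of_nat \<kappa>) / 2) * dirichlet_L chi s" for s
  have pos: "(s + of_nat \<kappa>) / 2 \<notin> \<int>\<^sub>\<le>\<^sub>0" if "Re s > 0" for s :: complex
  proof -
    have "Re ((s + of_nat \<kappa>) / 2) > 0" using that by simp
    then show ?thesis by (rule Re_pos_imp_not_nonpos_Int)
  qed
  have fg: "g s = f s" if "s \<in> {s. Re s > 0}" for s
  proof -
    have "g s = (2 * exp ((s + of_nat \<kappa>) / 2 * of_real (ln (q / pi))) * Gamma ((s + of_nat \<kappa>) / 2) * L_factor s) * f s"
      by (simp only: g_def f_def dirichlet_L_eq mult_ac)
    then show ?thesis using L_factor_inverse[of s] that by simp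
  qed
  have w: "w \<notin> \<int>\<^sub>\<le>\<^sub>0" using pos[of 1] by (simp add: w_def)
  have dL: "(dirichlet_L chi has_field_derivative deriv (dirichlet_L chi) 1) (at 1)"
    by (rule holomorphic_derivI[OF dirichlet_L_holomorphic open_UNIV]) simp
  have dw: "((\<lambda>s. (s + of_nat \<kappa>) / 2) has_field_derivative 1/2) (at (1::complex))"
    by (auto intro!: derivative_eq_intros)
  have dG: "((\<lambda>s. Gamma ((s + of_nat \<kappa>) / 2)) has_field_derivative (Gamma w * Digamma w) * (1/2)) (at 1)"
    using DERIV_chain2[OF _ dw, of Gamma] has_field_derivative_Gamma[OF w] by (simp add: w_def)
  define c where "c = complex_of_real (ln (q / pi))"
  have dE: "((\<lambda>s. 2 * exp ((s + of_nat \<kappa>) / 2 * c)) has_field_derivative 2 * (exp (w * c) * (1/2 * c))) (at 1)"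
    by (rule DERIV_cmult) (auto intro!: derivative_eq_intros simp: w_def)
  define L where "L = dirichlet_L chi 1"
  define L' where "L' = deriv (dirichlet_L chi) 1"
  have "(g has_field_derivative
      (2 * (exp (w * c) * (1/2 * c)) * Gamma w + (Gamma w * Digamma w) * (1/2) * (2 * exp (w * c))) * L
       + L' * (2 * exp (w * c) * Gamma w)) (at 1)"
    using DERIV_mult[OF DERIV_mult[OF dE dG] dL] unfolding g_def[abs_def] c_def L_def L'_def w_def by simp
  then have "(f has_field_derivative
      (2 * (exp (w * c) * (1/2 * c)) * Gamma w + (Gamma w * Digamma w) * (1/2) * (2 * exp (w * c))) * L
       + L' * (2 * exp (w * c) * Gamma w)) (at 1)"
    by (rule has_field_derivative_transform_within_open[OF _ open_halfspace_Re_gt[of 0]]) (use fg in auto)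
  then have df: "deriv f 1 = (2 * (exp (w * c) * (1/2 * c)) * Gamma w + (Gamma w * Digamma w) * (1/2) * (2 * exp (w * c))) * L
       + L' * (2 * exp (w * c) * Gamma w)" by (rule DERIV_imp_deriv)
  have f1: "f 1 = 2 * exp (w * c) * Gamma w * L" using fg[of 1] by (simp add: g_def w_def c_def L_def)
  have nz: "exp (w * c) \<noteq> 0" "Gamma w \<noteq> 0" "L \<noteq> 0"
    using w dirichlet_L_nonzero[of 1] by (auto simp: Gamma_eq_zero_iff L_def)
  have "deriv f 1 = f 1 * (c / 2 + Digamma w / 2 + L' / L)"
    unfolding df f1 using nz by (simp add: field_simps)
  then have "deriv f 1 / f 1 = c / 2 + Digamma w / 2 + L' / L" using nz f1 by simp
  then show ?thesis by (simp add: f_def c_def w_def L_def L'_def)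
qed

text \<open>The error in \<open>log_deriv_difference_bound\<close> tends to 0 because
  \<open>M r\<close> grows like \<open>r powr (3/2)\<close>. The factor 2 appears since by
  reflection the value at 0 contributes the same real part as the value at 1.\<close>

lemma completed_L_zero_sum:
  assumes GRH
  shows "b_chi chi = 2 * Re (deriv (completed_L q \<kappa> chi) 1 / completed_L q \<kappa> chi 1)"
proof -
  define f where "f = completed_L q \<kappa> chi"
  define ld where "ld = deriv f 1 / f 1 - deriv f 0 / f 0"
  have holf: "f holomorphic_on UNIV" unfolding f_def by (rule completed_L_holomorphic)
  have f0: "f 0 \<noteq> 0" unfolding f_def by (rule completed_L_nonzero_left) simp
  have f1: "f 1 \<noteq> 0" unfolding f_def by (rule completed_L_nonzero_right) simp
  have ld: "Re ld = 2 * Re (deriv f 1 / f 1)"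
    unfolding ld_def f_def completed_L_log_deriv_reflect
    by (simp only: minus_complex.simps uminus_complex.simps cnj.simps)
  define \<Gamma> where "\<Gamma> = {t::real. dirichlet_L chi (Complex (1/2) t) = 0}"
  define a where "a t = of_int (zorder (dirichlet_L chi) (Complex (1/2) t)) / (1/4 + t\<^sup>2)" for t :: real
  have zord: "zorder (dirichlet_L chi) (Complex (1/2) t) = zorder f (Complex (1/2) t)" for t
    unfolding dirichlet_L_eq f_def[symmetric]
    by (rule zorder_mult_nonzero[OF holf f0 L_factor_holomorphic L_factor_nonzero]) simp
  have a_nonneg: "a t \<ge> 0" for t
    unfolding a_def zord using zorder_entire(2)[OF holf f0, of "Complex (1/2) t"] by simp
  have zero_iff: "f s = 0 \<longleftrightarrow> Re s = 1/2 \<and> Im s \<in> \<Gamma>" for s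
    unfolding f_def \<Gamma>_def completed_L_zero_iff[OF assms] mem_Collect_eq by (metis complex_surj)
  define \<Gamma>n where "\<Gamma>n r = {t\<in>\<Gamma>. norm (Complex (1/2) t) < r}" for r
  have sum_eq: "(\<Sum>z | f z = 0 \<and> norm z < r. of_int (zorder f z) * (1 / (1 - z) + 1 / z)) = of_real (\<Sum>t\<in>\<Gamma>n r. a t)" for r
  proof -
    have "(\<Sum>z | f z = 0 \<and> norm z < r. of_int (zorder f z) * (1 / (1 - z) + 1 / z)) = (\<Sum>t\<in>\<Gamma>n r. of_real (a t))"
    proof (rule sum.reindex_bij_witness[where i = "\<lambda>t. Complex (1/2) t" and j = Im])
      fix z assume "z \<in> {z. f z = 0 \<and> norm z < r}"
      then have z: "Re z = 1/2" "Im z \<in> \<Gamma>" "norm z < r" using zero_iff by auto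
      show "Complex (1/2) (Im z) = z" using z by (simp add: complex_eq_iff)
      then show "Im z \<in> \<Gamma>n r" using z by (simp add: \<Gamma>n_def)
      have z': "z = Complex (1/2) (Im z)" using z by (simp add: complex_eq_iff)
      \<comment> \<open>On the critical line \<open>1 - z = cnj z\<close>, so the two fractions add
        up to the reciprocal of \<open>(norm z)\<^sup>2\<close>.\<close>
      have "z * (1 - z) = of_real (1/4 + (Im z)\<^sup>2)" by (simp add: complex_eq_iff power2_eq_square z(1))
      moreover have "1/4 + (Im z)\<^sup>2 > 0" by (rule add_pos_nonneg) auto
      ultimately have "z * (1 - z) \<noteq> 0" by (metis of_real_eq_0_iff less_irrefl)
      then have "1 / (1 - z) + 1 / z = 1 / (z * (1 - z))" by (simp add: add_frac_eq mult.commute)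
      then have "1 / (1 - z) + 1 / z = 1 / of_real (1/4 + (Im z)\<^sup>2)"
        by (simp only: \<open>z * (1 - z) = of_real (1/4 + (Im z)\<^sup>2)\<close>)
      moreover have "zorder (dirichlet_L chi) (Complex (1/2) (Im z)) = zorder f z"
        using zord[of "Im z"] z' by metis
      ultimately show "of_real (a (Im z)) = of_int (zorder f z) * (1 / (1 - z) + 1 / z)"
        by (simp add: a_def)
    next
      fix t assume "t \<in> \<Gamma>n r"
      then show "Complex (1/2) t \<in> {z. f z = 0 \<and> norm z < r}" using zero_iff by (simp add: \<Gamma>n_def)
    qed auto
    then show ?thesis by simp
  qed
  obtain C where C: "\<And>s. norm (f s) \<le> C * exp ((norm ((s - 1/2) / 2)) powr (3/2))"
    using completed_L_growth unfolding f_def by metis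
  define c where "c = max 1 C"
  have c: "c \<ge> 1" "C \<le> c" by (auto simp: c_def)
  define l where "l = ln (norm (f 0))"
  \<comment> \<open>The argument \<open>r + 1\<close> covers \<open>norm ((s - 1/2) / 2)\<close> on
    the circle of radius \<open>2 * r\<close>; adding \<open>|l| + 1\<close> ensures
    \<open>l < M r\<close>.\<close>
  define M where "M r = ln c + (r + 1) powr (3/2) + \<bar>l\<bar> + 1" for r
  have bound: "\<bar>Re ld - (\<Sum>t\<in>\<Gamma>n r. a t)\<bar> \<le> 128 * (M r - l) / r\<^sup>2" if r: "r \<ge> 8" for r
  proof -
    have "norm (ld - (\<Sum>z | f z = 0 \<and> norm z < r. of_int (zorder f z) * (1 / (1 - z) + 1 / z))) \<le> 128 * (M r - l) / r\<^sup>2"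
      unfolding ld_def l_def
    proof (rule log_deriv_difference_bound[OF holf f0 f1 _ r])
      fix s :: complex assume s: "norm s = 2 * r"
      have "norm (s - 1/2) \<le> norm s + norm (1/2 :: complex)" by (rule norm_triangle_ineq4)
      then have "norm ((s - 1/2) / 2) \<le> r + 1" using s by (simp add: norm_divide)
      then have "norm ((s - 1/2) / 2) powr (3/2) \<le> (r + 1) powr (3/2)" by (intro powr_mono2) auto
      then have "C * exp (norm ((s - 1/2) / 2) powr (3/2)) \<le> c * exp ((r + 1) powr (3/2))"
        using c by (intro mult_mono) auto
      also have "\<dots> = exp (ln c + (r + 1) powr (3/2))" using c by (simp add: exp_add)
      also have "\<dots> \<le> exp (M r)" by (simp add: M_def)
      finally show "norm (f s) \<le> exp (M r)" using C[of s] by linarith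
    next
      have "(r + 1) powr (3/2) \<ge> 0" "ln c \<ge> 0" using c by auto
      then have "l < M r" unfolding M_def by linarith
      then show "ln (norm (f 0)) < M r" by (simp add: l_def)
    qed
    moreover have "\<bar>Re (ld - of_real (\<Sum>t\<in>\<Gamma>n r. a t))\<bar> \<le> norm (ld - of_real (\<Sum>t\<in>\<Gamma>n r. a t))" by (rule abs_Re_le_cmod)
    ultimately show ?thesis unfolding sum_eq by simp
  qed
  have lim0: "((\<lambda>r. 128 * (M r - l) / r\<^sup>2) \<longlongrightarrow> 0) at_top" unfolding M_def by real_asymp
  have lim: "((\<lambda>r. \<Sum>t\<in>\<Gamma>n r. a t) \<longlongrightarrow> Re ld) at_top"
  proof -
    have "((\<lambda>r. Re ld - (\<Sum>t\<in>\<Gamma>n r. a t)) \<longlongrightarrow> 0) at_top"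
      by (rule Lim_null_comparison[OF _ lim0])
         (use bound in \<open>auto intro!: eventually_mono[OF eventually_ge_at_top[of 8]]\<close>)
    from tendsto_diff[OF tendsto_const[of "Re ld"] this] show ?thesis by simp
  qed
  have fin: "finite (\<Gamma>n r)" for r
  proof -
    have "\<Gamma>n r \<subseteq> Im ` {z. f z = 0 \<and> norm z < r}"
    proof
      fix t assume "t \<in> \<Gamma>n r"
      then show "t \<in> Im ` {z. f z = 0 \<and> norm z < r}"
        using zero_iff[of "Complex (1/2) t"] by (intro image_eqI[of _ _ "Complex (1/2) t"]) (auto simp: \<Gamma>n_def)
    qed
    then show ?thesis using finite_zeros_ball[OF holf f0] finite_subset by blast
  qed
  \<comment> \<open>The terms are nonnegative and every finite set of zeros lies in some disc. So
    the finite sums are bounded by the limit of the disc sums, and this gives both summability and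
    the value.\<close>
  have le: "sum a F \<le> Re ld" if F: "finite F" "F \<subseteq> \<Gamma>" for F
  proof (rule tendsto_lowerbound[OF lim])
    define B where "B = Max (insert 0 ((\<lambda>t. norm (Complex (1/2) t)) ` F))"
    have "sum a F \<le> (\<Sum>t\<in>\<Gamma>n r. a t)" if "r > B" for r
    proof (rule sum_mono2[OF fin])
      show "F \<subseteq> \<Gamma>n r"
      proof
        fix t assume t: "t \<in> F"
        then have "norm (Complex (1/2) t) \<le> B" unfolding B_def using F by (intro Max_ge) auto
        then show "t \<in> \<Gamma>n r" using t F that by (auto simp: \<Gamma>n_def)
      qed
    qed (use a_nonneg in auto)
    then show "\<forall>\<^sub>F r in at_top. sum a F \<le> (\<Sum>t\<in>\<Gamma>n r. a t)"
      by (auto intro: eventually_mono[OF eventually_gt_at_top[of B]])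
  qed simp
  have summ: "a summable_on \<Gamma>"
    by (rule nonneg_bdd_above_summable_on) (use a_nonneg le in \<open>auto intro!: bdd_aboveI2[where M = "Re ld"]\<close>)
  have "infsum a \<Gamma> \<le> Re ld" by (rule infsum_le_finite_sums[OF summ]) (use le in auto)
  moreover have "Re ld \<le> infsum a \<Gamma>"
  proof (rule tendsto_upperbound[OF lim])
    show "\<forall>\<^sub>F r in at_top. (\<Sum>t\<in>\<Gamma>n r. a t) \<le> infsum a \<Gamma>"
      by (intro always_eventually allI finite_sum_le_infsum[OF summ fin]) (use a_nonneg in \<open>auto simp: \<Gamma>n_def\<close>)
  qed simp
  ultimately have "infsum a \<Gamma> = Re ld" by simp
  then show ?thesis unfolding b_chi_def a_def[symmetric] \<Gamma>_def[symmetric] ld f_def[symmetric] .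
qed

text \<open>\<open>Digamma\<close> is \<open>- euler_mascheroni - 2 * ln 2\<close> at 1/2, the even
  case, and \<open>- euler_mascheroni\<close> at 1, the odd case; the factor
  \<open>1 + Re (chi (-1))\<close> covers both.\<close>

lemma b_chi_primitive:
  assumes GRH
  shows "b_chi chi = ln q - (euler_mascheroni + ln pi) - (1 + Re (chi (-1))) * ln 2 +
           2 * Re (deriv (dirichlet_L chi) 1 / dirichlet_L chi 1)"
proof -
  have "Re (Digamma ((1 + of_nat \<kappa>) / 2)) = - euler_mascheroni - (1 + Re (chi (-1))) * ln 2"
  proof (cases "\<kappa> = 0")
    case True
    have "Re euler_mascheroni = euler_mascheroni" by (metis Re_complex_of_real of_real_euler_mascheroni)
    with True show ?thesis using parity by (simp add: Digamma_one_half)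
  next
    case False
    then have "\<kappa> = 1" using \<kappa> by simp
    have "Re euler_mascheroni = euler_mascheroni" by (metis Re_complex_of_real of_real_euler_mascheroni)
    with \<open>\<kappa> = 1\<close> show ?thesis using parity by simp
  qed
  moreover have "ln (real q / pi) = ln q - ln pi" using q1 by (simp add: ln_div)
  ultimately show ?thesis
    unfolding completed_L_zero_sum[OF assms] completed_L_log_deriv_1 by (simp add: algebra_simps)
qed

end

section \<open>Imprimitive characters and the sum over all characters\<close>

lemma dirichlet_L_cnj:
  assumes chi: "dirichlet_character q chi" and L: "dirichlet_L chi holomorphic_on UNIV"
    and eq: "\<And>s. Re s > 1 \<Longrightarrow> dirichlet_L chi s = dser (\<lambda>n. chi (int n)) s"
  shows "dirichlet_L (\<lambda>n. cnj (chi n)) = cnj \<circ> dirichlet_L chi \<circ> cnj"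
proof (rule dirichlet_L_eqI[OF dirichlet_character_cnj[OF chi]])
  have "cnj ` UNIV = UNIV" by (metis complex_cnj_cnj surjI)
  then have "cnj \<circ> dirichlet_L chi \<circ> cnj holomorphic_on UNIV"
    using holomorphic_on_compose_cnj_cnj[of "dirichlet_L chi" UNIV] L by simp
  then show "cnj \<circ> dirichlet_L chi \<circ> cnj holomorphic_on UNIV" .
  have abs: "dser_abs (\<lambda>n. chi (int n))" using cmultiplicativeD(4)[OF cmultiplicative_character[OF chi]] .
  fix s :: complex assume "Re s > 1"
  then show "(cnj \<circ> dirichlet_L chi \<circ> cnj) s = dser (\<lambda>n. cnj (chi (int n))) s"
    using eq[of "cnj s"] dser_cnj[OF abs, of s] by simp
qed

lemma primitive_inducing_parity:
  assumes chi: "dirichlet_character q chi" and nonprincipal: "chi \<noteq> principal_character q"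
  defines "psi \<equiv> primitive_inducing q chi"
  shows "primitive_parity (conductor q chi) (if psi (-1) = 1 then 0 else 1) psi"
proof
  show "primitive_character (conductor q chi) psi" unfolding psi_def by (rule primitive_inducing(1)[OF chi])
  then have "dirichlet_character (conductor q chi) psi" unfolding primitive_character_def by blast
  then show "psi (-1) = (-1) ^ (if psi (-1) = 1 then 0 else 1)"
    using dirichlet_character_minus_1[of "conductor q chi" psi] by auto
qed (use conductor_gt_1[OF chi nonprincipal] in auto)

lemma b_chi_nonprincipal:
  assumes GRH and chi: "dirichlet_character q chi" and nonprincipal: "chi \<noteq> principal_character q"
  defines "psi \<equiv> primitive_inducing q chi"
  shows "b_chi chi = ln (real (conductor q chi)) - (euler_mascheroni + ln pi)
           - (1 + Re (chi (-1))) * ln 2 + 2 * Re (deriv (dirichlet_L psi) 1 / dirichlet_L psi 1)"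
proof -
  define \<kappa> :: nat where "\<kappa> = (if psi (-1) = 1 then 0 else 1)"
  interpret psi: primitive_parity "conductor q chi" \<kappa> psi
    unfolding psi_def \<kappa>_def by (rule primitive_inducing_parity[OF chi nonprincipal])
  have q: "q > 0" using chi by (rule dirichlet_characterD(1))
  note I = inducesD[OF primitive_inducing(2)[OF chi], folded psi_def]
  \<comment> \<open>All primes of \<open>q\<close> may be removed, including those that divide the
    conductor: \<open>psi\<close> vanishes at the latter, so their Euler factors are 1.\<close>
  have chi_eq: "(\<lambda>n. chi (int n)) = (\<lambda>n. if \<exists>p\<in>prime_factors q. p dvd n then 0 else psi (int n))"
  proof
    fix n
    show "chi (int n) = (if \<exists>p\<in>prime_factors q. p dvd n then 0 else psi (int n))"
      using coprime_int_prime_factors[OF q, of n] I(4)[of "int n"] dirichlet_characterD(4)[OF chi, of "int n"]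
      by auto
  qed
  define u where "u = euler_factors q (\<lambda>n. psi (int n))"
  have u: "u holomorphic_on UNIV" "\<And>s. Re s > 0 \<Longrightarrow> u s \<noteq> 0"
    unfolding u_def
    by (rule euler_factors_holomorphic, rule euler_factors_nonzero)
       (auto intro: norm_dirichlet_character_le[OF I(1)])
  have "dirichlet_L chi = (\<lambda>s. dirichlet_L psi s * u s)"
  proof (rule dirichlet_L_eqI[OF chi])
    show "(\<lambda>s. dirichlet_L psi s * u s) holomorphic_on UNIV"
      by (intro holomorphic_intros psi.dirichlet_L_holomorphic u)
    fix s :: complex assume s: "Re s > 1"
    have "dser (\<lambda>n. chi (int n)) s = u s * dser (\<lambda>n. psi (int n)) s"
      unfolding chi_eq u_def euler_factors_def
      using dser_remove_primes[OF _ cmultiplicative_character[OF I(1)] s, of "prime_factors q"]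
      by (auto simp: in_prime_factors_iff)
    then show "dirichlet_L psi s * u s = dser (\<lambda>n. chi (int n)) s"
      using psi.dirichlet_L_dser[OF s] by simp
  qed
  then have "b_chi chi = b_chi psi"
    using b_chi_mult_nonzero[OF psi.dirichlet_L_holomorphic psi.dirichlet_L_nonzero[of 1] u] by simp
  moreover have "chi (-1) = psi (-1)" by (rule I(4)) simp
  ultimately show ?thesis using psi.b_chi_primitive[OF assms(1)] by simp
qed

lemma log_deriv_primitive_inducing_cnj:
  assumes chi: "dirichlet_character q chi" and nonprincipal: "chi \<noteq> principal_character q"
  defines "psi \<equiv> primitive_inducing q chi"
  defines "psi' \<equiv> primitive_inducing q (\<lambda>n. cnj (chi n))"
  shows "deriv (dirichlet_L psi') 1 / dirichlet_L psi' 1 =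
           cnj (deriv (dirichlet_L psi) 1 / dirichlet_L psi 1)"
proof -
  interpret psi: primitive_parity "conductor q chi" "if psi (-1) = 1 then 0 else 1" psi
    unfolding psi_def by (rule primitive_inducing_parity[OF chi nonprincipal])
  have "psi' = (\<lambda>n. cnj (psi n))" unfolding psi_def psi'_def by (rule primitive_inducing_cnj[OF chi])
  then have L: "dirichlet_L psi' = cnj \<circ> dirichlet_L psi \<circ> cnj"
    using dirichlet_L_cnj[OF psi.chi psi.dirichlet_L_holomorphic psi.dirichlet_L_dser] by simp
  have "(dirichlet_L psi has_field_derivative deriv (dirichlet_L psi) (cnj 1)) (at (cnj 1))"
    by (rule holomorphic_derivI[OF psi.dirichlet_L_holomorphic]) auto
  then have "(cnj \<circ> dirichlet_L psi \<circ> cnj has_field_derivative cnj (deriv (dirichlet_L psi) (cnj 1))) (at 1)"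
    by (rule has_field_derivative_cnj_cnj)
  then have "deriv (cnj \<circ> dirichlet_L psi \<circ> cnj) 1 = cnj (deriv (dirichlet_L psi) (cnj 1))"
    by (rule DERIV_imp_deriv)
  then show ?thesis unfolding L by simp
qed

lemma M_star_real:
  "M_star q a b = of_real (\<Sum>chi\<in>dirichlet_characters q - {principal_character q}. (cmod (chi b - chi a))\<^sup>2 *
     Re (deriv (dirichlet_L (primitive_inducing q chi)) 1 / dirichlet_L (primitive_inducing q chi) 1))"
proof -
  define C where "C = dirichlet_characters q - {principal_character q}"
  define R where "R chi = deriv (dirichlet_L (primitive_inducing q chi)) 1 / dirichlet_L (primitive_inducing q chi) 1" for chi
  define W where "W chi = (cmod (chi b - chi a))\<^sup>2" for chi :: "int \<Rightarrow> complex"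
  define conj_char :: "(int \<Rightarrow> complex) \<Rightarrow> int \<Rightarrow> complex" where "conj_char chi = (\<lambda>n. cnj (chi n))" for chi
  have M: "M_star q a b = (\<Sum>chi\<in>C. of_real (W chi) * R chi)"
    unfolding M_star_def C_def R_def W_def by (simp only: norm_minus_commute)
  have invol: "conj_char (conj_char chi) = chi" for chi by (simp add: conj_char_def)
  have principal: "conj_char (principal_character q) = principal_character q"
    by (auto simp: conj_char_def principal_character_def)
  have C: "conj_char chi \<in> C" if "chi \<in> C" for chi
  proof -
    have "conj_char chi \<noteq> principal_character q"
      using that invol[of chi] principal unfolding C_def by auto
    then show ?thesis using that dirichlet_character_cnj[of q chi]
      by (auto simp: C_def dirichlet_characters_def conj_char_def)
  qed
  have W: "W (conj_char chi) = W chi" for chi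
    unfolding W_def conj_char_def by (metis complex_cnj_diff complex_mod_cnj)
  have R: "R (conj_char chi) = cnj (R chi)" if "chi \<in> C" for chi
    unfolding R_def conj_char_def
    by (rule log_deriv_primitive_inducing_cnj) (use that in \<open>auto simp: C_def dirichlet_characters_def\<close>)
  have "(\<Sum>chi\<in>C. of_real (W chi) * R chi) = (\<Sum>chi\<in>C. of_real (W chi) * cnj (R chi))"
    by (rule sum.reindex_bij_witness[where i = conj_char and j = conj_char]) (use invol C W R in auto)
  also have "\<dots> = cnj (\<Sum>chi\<in>C. of_real (W chi) * R chi)" by simp
  finally have "M_star q a b = cnj (M_star q a b)" unfolding M .
  then have "Im (M_star q a b) = 0" by (metis Reals_cnj_iff complex_is_Real_iff)
  then have "M_star q a b = of_real (Re (M_star q a b))" by (simp add: complex_eq_iff)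
  also have "Re (M_star q a b) = (\<Sum>chi\<in>C. W chi * Re (R chi))" unfolding M by simp
  finally show ?thesis unfolding C_def R_def W_def .
qed

text \<open>With the weights \<open>2 - 2 * Re (chi c)\<close>, the sums over characters are
  differences of orthogonality at 1 and at \<open>c\<close>; for the term with
  \<open>chi (-1)\<close>, at -1 and at \<open>- c\<close>.\<close>

lemma V_q_eq:
  fixes q :: nat and a b c :: int
  assumes GRH and q: "q > 0" and a: "coprime a (int q)" and b: "coprime b (int q)"
    and ab: "\<not> [a = b] (mod int q)" and c: "[c * b = a] (mod int q)"
  shows "V_q q a b = 2 * real (totient q) * (calL q + K_q q (a - b) + iota_q q (- c) * ln 2)
           + 2 * (\<Sum>chi\<in>dirichlet_characters q - {principal_character q}. (cmod (chi b - chi a))\<^sup>2 *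
     Re (deriv (dirichlet_L (primitive_inducing q chi)) 1 / dirichlet_L (primitive_inducing q chi) 1))"
proof -
  define C where "C = dirichlet_characters q"
  define \<phi> where "\<phi> = real (totient q)"
  define R where "R chi = Re (deriv (dirichlet_L (primitive_inducing q chi)) 1 / dirichlet_L (primitive_inducing q chi) 1)" for chi
  define W where "W chi = (cmod (chi b - chi a))\<^sup>2" for chi :: "int \<Rightarrow> complex"
  define l where "l chi = ln (real (conductor q chi))" for chi
  define \<Lambda> where "\<Lambda> = (let e = q div nat (gcd (int q) (a - b)) in mangoldt e / real (totient e) :: real)"
  define P where "P = (\<Sum>p\<in>prime_factors q. ln (real p) / (real p - 1))"
  have C: "dirichlet_character q chi" if "chi \<in> C" for chi using that by (simp add: C_def dirichlet_characters_def)
  have at_1: "chi 1 = 1" if "chi \<in> C" for chi by (rule dirichlet_character_1[OF C[OF that]])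
  have "coprime (c * b) (int q)" using a c by (meson cong_imp_coprime cong_sym)
  then have c': "coprime c (int q)" by simp
  have c1: "\<not> [c = 1] (mod int q)"
  proof
    assume "[c = 1] (mod int q)"
    then have "[c * b = 1 * b] (mod int q)" by (rule cong_scalar_right)
    then show False using ab c by (metis cong_sym cong_trans mult_1)
  qed
  \<comment> \<open>Modulo 1 and 2 all units are congruent, so distinct \<open>a\<close> and
    \<open>b\<close> force \<open>q > 2\<close>. Then -1 is not 1 modulo \<open>q\<close>, and the
    sum of \<open>chi (-1)\<close> vanishes.\<close>
  have "\<not> int q dvd 2"
  proof
    assume "int q dvd 2"
    then have "q \<le> 2" using zdvd_imp_le by fastforce
    then consider "q = 1" | "q = 2" using q by linarith
    then have "[a = b] (mod int q)"
    proof cases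
      case 2
      then have "odd a" "odd b" using a b by simp_all
      then show ?thesis using 2 by (simp add: cong_iff_dvd_diff)
    qed simp
    then show False using ab by simp
  qed
  then have m1: "\<not> [-1 = 1] (mod int q)"
    by (metis cong_iff_dvd_diff cong_sym_eq diff_minus_eq_add one_add_one)
  \<comment> \<open>The divisor belonging to \<open>K_q\<close> is stated with \<open>a - b\<close>,
    while orthogonality produces \<open>c - 1\<close>; the two differ by the unit \<open>b\<close>
    modulo \<open>q\<close>.\<close>
  have gcd_eq: "gcd (int q) (a - b) = gcd (int q) (c - 1)"
  proof -
    have "[a - b = (c - 1) * b] (mod int q)"
      using cong_diff[OF cong_sym[OF c] cong_refl[of b]] by (simp add: algebra_simps)
    then have "gcd (a - b) (int q) = gcd ((c - 1) * b) (int q)" by (rule cong_gcd_eq)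
    then show ?thesis using b by (simp add: gcd.commute gcd_mult_right_right_cancel coprime_commute)
  qed
  have W: "W chi = 2 - 2 * Re (chi c)" if "chi \<in> C" for chi
  proof -
    note D = C[OF that]
    have "chi a = chi c * chi b"
      using dirichlet_character_cong[OF D c] dirichlet_characterD(2)[OF D] by simp
    then have "chi b - chi a = (1 - chi c) * chi b" by (simp add: algebra_simps)
    then have "W chi = (cmod (1 - chi c))\<^sup>2"
      using norm_dirichlet_character[OF D b] by (simp add: W_def norm_mult)
    also have "\<dots> = 1 - 2 * Re (chi c) + (cmod (chi c))\<^sup>2"
      unfolding cmod_power2 by (simp add: power2_eq_square algebra_simps)
    finally show ?thesis using norm_dirichlet_character[OF D c'] by simp
  qed
  have W0: "W (principal_character q) = 0" using a b by (simp add: W_def principal_character_def)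
  have sum_Re: "(\<Sum>chi\<in>C. Re (chi x)) = (if [x = 1] (mod int q) then \<phi> else 0)" if "coprime x (int q)" for x
    using arg_cong[OF sum_characters[OF q that], of Re] unfolding C_def \<phi>_def by simp
  have sum_Re_l: "(\<Sum>chi\<in>C. Re (chi x) * l chi) = Re (\<Sum>chi\<in>C. chi x * of_real (ln (real (conductor q chi))))" for x
    unfolding l_def by simp
  have "(\<Sum>chi\<in>C. Re (chi c) * l chi) = - (\<phi> * \<Lambda>)"
    unfolding sum_Re_l unfolding C_def sum_characters_ln_conductor[OF q c'] using c1
    by (simp add: \<Lambda>_def \<phi>_def Let_def gcd_eq)
  moreover have "(\<Sum>chi\<in>C. Re (chi 1) * l chi) = \<phi> * (ln (real q) - P)"
    unfolding sum_Re_l unfolding C_def sum_characters_ln_conductor[OF q coprime_1_left] by (simp add: P_def \<phi>_def)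
  then have "(\<Sum>chi\<in>C. l chi) = \<phi> * (ln (real q) - P)" by (simp add: at_1)
  moreover have "(\<Sum>chi\<in>C. W chi * l chi) = 2 * (\<Sum>chi\<in>C. l chi) - 2 * (\<Sum>chi\<in>C. Re (chi c) * l chi)"
    unfolding sum_distrib_left sum_subtractf[symmetric] by (intro sum.cong) (auto simp: W algebra_simps)
  ultimately have Wl: "(\<Sum>chi\<in>C. W chi * l chi) = 2 * \<phi> * (ln (real q) - P + \<Lambda>)" by (simp add: algebra_simps)
  have "(\<Sum>chi\<in>C. Re (chi 1)) = \<phi>" using sum_Re[of 1] by simp
  then have "(\<Sum>chi\<in>C. 1) = \<phi>" by (simp add: at_1)
  moreover have "(\<Sum>chi\<in>C. W chi) = 2 * (\<Sum>chi\<in>C. 1) - 2 * (\<Sum>chi\<in>C. Re (chi c))"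
    unfolding sum_distrib_left sum_subtractf[symmetric] by (intro sum.cong) (auto simp: W)
  ultimately have W1: "(\<Sum>chi\<in>C. W chi) = 2 * \<phi>" using sum_Re[OF c'] c1 by simp
  \<comment> \<open>The value \<open>chi (-1)\<close> is real, so multiplying by it commutes with
    taking real parts.\<close>
  have Wm: "W chi * Re (chi (-1)) = 2 * Re (chi (-1)) - 2 * Re (chi (-c))" if "chi \<in> C" for chi
  proof -
    have "chi (-c) = chi (-1) * chi c" using dirichlet_characterD(2)[OF C[OF that], of "-1" c] by simp
    then show ?thesis using dirichlet_character_minus_1[OF C[OF that]] by (auto simp: W[OF that])
  qed
  have "(\<Sum>chi\<in>C. W chi * Re (chi (-1))) = 2 * (\<Sum>chi\<in>C. Re (chi (-1))) - 2 * (\<Sum>chi\<in>C. Re (chi (-c)))"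
    unfolding sum_distrib_left sum_subtractf[symmetric] by (intro sum.cong) (auto simp: Wm)
  then have W2: "(\<Sum>chi\<in>C. W chi * Re (chi (-1))) = - (2 * \<phi> * iota_q q (-c))"
    using sum_Re[of "-1"] sum_Re[of "-c"] c' m1 by (simp add: iota_q_def)
  have "V_q q a b = (\<Sum>chi\<in>C. W chi * b_chi chi)" by (simp add: V_q_def C_def W_def)
  also have "\<dots> = (\<Sum>chi\<in>C. W chi * (l chi - (euler_mascheroni + ln pi) - (1 + Re (chi (-1))) * ln 2 + 2 * R chi))"
  \<comment> \<open>For the principal character both sides are 0, because its weight is.\<close>
  proof (rule sum.cong)
    fix chi assume "chi \<in> C"
    then show "W chi * b_chi chi = W chi * (l chi - (euler_mascheroni + ln pi) - (1 + Re (chi (-1))) * ln 2 + 2 * R chi)"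
      using b_chi_nonprincipal[OF \<open>GRH\<close> C, of chi] W0
      by (cases "chi = principal_character q") (simp_all add: l_def R_def)
  qed simp
  also have "\<dots> = (\<Sum>chi\<in>C. W chi * l chi) - (euler_mascheroni + ln pi + ln 2) * (\<Sum>chi\<in>C. W chi)
      - ln 2 * (\<Sum>chi\<in>C. W chi * Re (chi (-1))) + 2 * (\<Sum>chi\<in>C. W chi * R chi)"
    unfolding sum_distrib_left sum_subtractf[symmetric] sum.distrib[symmetric]
    by (intro sum.cong) (auto simp: algebra_simps)
  also have "\<dots> = 2 * \<phi> * (ln (real q) - P + \<Lambda> - (euler_mascheroni + ln pi + ln 2) + iota_q q (-c) * ln 2)
      + 2 * (\<Sum>chi\<in>C. W chi * R chi)"
    unfolding Wl W1 W2 by (simp add: algebra_simps)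
  \<comment> \<open>The term \<open>mangoldt q / totient q\<close> added in \<open>calL\<close>
    cancels the one subtracted in \<open>K_q\<close>; the remaining term of \<open>K_q\<close> is
    \<open>\<Lambda>\<close>.\<close>
  also have "ln (real q) - P + \<Lambda> - (euler_mascheroni + ln pi + ln 2) = calL q + K_q q (a - b)"
    by (simp add: calL_def K_q_def P_def \<Lambda>_def Let_def ln_mult)
  also have "(\<Sum>chi\<in>C. W chi * R chi) = (\<Sum>chi\<in>C - {principal_character q}. W chi * R chi)"
    by (rule sum.mono_neutral_right) (auto simp: W0 C_def)
  finally show ?thesis by (simp add: C_def W_def R_def \<phi>_def)
qed

theorem theorem1p4:
  fixes q :: nat and a b c :: int
  assumes GRH
    and "q > 0"
    and "coprime a (int q)" and "coprime b (int q)"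
    and "\<not> [a = b] (mod int q)"
    \<comment> \<open>\<open>c\<close> is any integer representing the class of \<open>a b\<^sup>-\<^sup>1\<close>\<close>
    and "[c * b = a] (mod int q)"
  shows "complex_of_real (V_q q a b) =
           of_real (2 * real (totient q) * (calL q + K_q q (a - b) + iota_q q (- c) * ln 2))
           + 2 * M_star q a b"
  unfolding V_q_eq[OF assms] M_star_real by simp

end
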